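(* Let $U\in\mathcal E'(\mathrm{HC})$. Then the function $\zeta\mapsto\widehat U(\zeta)=\langle U,\pi_{-\zeta}\rangle$, $\zeta\in\mathbb R$, extends to complex values of $\zeta$, and the extended function $\widehat U:\mathbb C\to\mathcal H$ is an entire holomorphic function with values in $\mathcal H$.
   Context: Algebra. Let $V$ be a purely odd real super vector space of dimension $n\ge 1$ with a positive definite symmetric bilinear form $\beta$, and fix an orthonormal basis $a_1,\dots,a_n$. The Heisenberg--Clifford Lie superalgebra is $\mathfrak{hc}=V\oplus\mathbb R z$ with $z$ even and central, $V$ odd, and $[u+\lambda z,v+\mu z]=2\beta(u,v)z$. Its universal enveloping algebra $\mathfrak U(\mathfrak{hc})$ is the unital real superalgebra generated by odd $a_1,\dots,a_n$ and an even central element $z$ with $a_ia_j=-a_ja_i$ ($i\ne j$) and $a_i^2=z$. For $I=\{i_1<\dots<i_r\}\subset\{1,\dots,n\}$ put $a_I=a_{i_1}\cdots a_{i_r}$ ($a_\emptyset=1$), $\gamma=a_1\cdots a_n$, and $*a_I=\pm a_{I^c}$ with the sign such that $a_I\cdot( *a_I)=\gamma$. Functions and distributions. $\mathcal C^\infty(\mathrm{HC})$ is the space of linear maps $F:\mathfrak U(\mathfrak{hc})\to C^\infty(\mathbb R)$ (complex-valued functions) with $F(zu)=F(u)'$ for all $u$. The map $F\mapsto(F(a_I))_I$ identifies it with $\bigoplus_{I\subset\{1,\dots,n\}}C^\infty(\mathbb R)$, from which it gets its Fréchet topology. $\mathcal E'(\mathrm{HC})$ is its topological dual; its elements are called compactly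 supported distributions. Every $U\in\mathcal E'(\mathrm{HC})$ can be written uniquely as $\langle U,\Phi\rangle=\sum_I(-1)^{(\#I)(n-\#I)}\langle U(a_I),\Phi( *a_I)\rangle$ with $U(a_I)\in\mathcal E'(\mathbb R)$. Representations. For $\zeta\in\mathbb C$ put $\sigma=\begin{pmatrix}1&0\\0&-1\end{pmatrix}$, $X_\zeta=\begin{pmatrix}0&\zeta\\1&0\end{pmatrix}$, $Y_\zeta=\begin{pmatrix}0&i\zeta\\-i&0\end{pmatrix}$. If $n=2k$: $\mathcal H_\zeta=\mathrm{Mat}_{2^k}(\mathbb C)=\mathrm{End}((\mathbb C^{1|1})^{\otimes k})$, and for $1\le j\le k$, $c_\zeta(a_{2j-1})=\sigma^{\otimes(j-1)}\otimes X_\zeta\otimes 1^{\otimes(k-j)}$, $c_\zeta(a_{2j})=\sigma^{\otimes(j-1)}\otimes Y_\zeta\otimes1^{\otimes(k-j)}$. If $n=2k+1$: let $D_\zeta=\mathbb C[\epsilon]$ with $\epsilon$ odd, $\epsilon^2=\zeta$, and $\mathcal H_\zeta=D_\zeta\otimes\mathrm{Mat}_{2^k}(\mathbb C)=\mathrm{End}_{D_\zeta}(D_\zeta\otimes\mathbb C^{2^k})$; let $C_1,\dots,C_{2k}\in \mathrm{Mat}_{2^k}(\mathbb C)$ be the matrices $c_1(a_1),\dots,c_1(a_{2k})$ of the even case with parameter $1$, $\Gamma=\sigma^{\otimes k}$, and $c_\zeta(a_1)=\epsilon\otimes\Gamma$, $c_\zeta(a_{j+1})=\epsilon\otimes(-i\,\Gamma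 C_j)$ for $1\le j\le 2k$. $\mathcal H$ denotes the underlying complex vector space of $\mathcal H_\zeta$, which does not depend on $\zeta$ (for odd $n$ it is $\mathrm{Mat}_{2^k}(\mathbb C)\oplus\epsilon\,\mathrm{Mat}_{2^k}(\mathbb C)$). In both cases $d\pi_\zeta:\mathfrak U(\mathfrak{hc})\to\mathcal H_\zeta$ is the unital algebra homomorphism with $d\pi_\zeta(a_j)=e^{i\pi/4}c_\zeta(a_j)$ and $d\pi_\zeta(z)=i\zeta$; $\pi_\zeta(u;x)=e^{i\zeta x}d\pi_\zeta(u)$. Pairing with $\pi_{-\zeta}$. Since $\pi_{-\zeta}$ is an even $\mathcal H$-valued function, the pairing carries no sign: $\langle U,\pi_{-\zeta}\rangle=\sum_I\langle U(a_I),x\mapsto e^{-i\zeta x}\rangle\,d\pi_{-\zeta}( *a_I)\in\mathcal H$. *)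

theory Defs
  imports
    "HOL-Analysis.Analysis"
    "HOL-Library.Poly_Mapping"
    "Jordan_Normal_Form.Matrix"
begin

section \<open>The enveloping algebra of the Heisenberg--Clifford Lie superalgebra\<close>

subsection \<open>Free algebras\<close>

text \<open>The free monoid, written additively so that finitely supported real functions on it
  form, with the convolution product of \<^theory>\<open>HOL-Library.Poly_Mapping\<close>, the free unital
  real algebra.\<close>

datatype 'a fword = FWord (letters: "'a list")

instantiation fword :: (type) monoid_add
begin

definition zero_fword :: "'a fword" where
  "0 = FWord []"

definition plus_fword :: "'a fword \<Rightarrow> 'a fword \<Rightarrow> 'a fword" where
  "v + w = FWord (letters v @ letters w)"

instance
  by standard (auto simp: zero_fword_def plus_fword_def)

end

lemma fword_add_eq_0_iff: "v + w = 0 \<longleftrightarrow> v = 0 \<and> w = (0 :: 'a fword)"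
  by (cases v; cases w) (auto simp: zero_fword_def plus_fword_def)

type_synonym 'a free_alg = "'a fword \<Rightarrow>\<^sub>0 real"

definition free_gen :: "'a \<Rightarrow> 'a free_alg" where
  "free_gen x = Poly_Mapping.single (FWord [x]) 1"

definition free_const :: "real \<Rightarrow> 'a free_alg" where
  "free_const r = Poly_Mapping.single 0 r"

lemma lookup_free_gen_0: "Poly_Mapping.lookup (free_gen x) 0 = 0"
  by (simp add: free_gen_def lookup_single zero_fword_def)

lemma free_const_add: "free_const (r + s) = free_const r + free_const s"
  by (simp add: free_const_def single_add)

lemma free_const_mult: "free_const (r * s) = free_const r * free_const s"
  by (simp add: free_const_def mult_single)

lemma free_const_1: "free_const 1 = 1"
  by (simp add: free_const_def)

lemma lookup_mult_Sum_any:
  fixes p q :: "'a free_alg"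
  shows "Poly_Mapping.lookup (p * q) w = Sum_any (\<lambda>l. Poly_Mapping.lookup p l *
    Sum_any (\<lambda>k. Poly_Mapping.lookup q k when w = l + k))"
  by (rule lookup_mult)

lemma lookup_const_mult:
  fixes p :: "'a free_alg"
  shows "Poly_Mapping.lookup (free_const r * p) w = r * Poly_Mapping.lookup p w"
proof -
  have "Poly_Mapping.lookup (free_const r * p) w
      = Sum_any (\<lambda>l. (r * Sum_any (\<lambda>q. Poly_Mapping.lookup p q when w = l + q)) when l = 0)"
    unfolding lookup_mult_Sum_any free_const_def
    by (rule Sum_any.cong) (auto simp: lookup_single when_def)
  also have "\<dots> = r * Sum_any (\<lambda>q. Poly_Mapping.lookup p q when w = q)"
    by (simp only: Sum_any_when_equal add_0_left)
  also have "\<dots> = r * Poly_Mapping.lookup p w"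
    by (simp only: Sum_any_when_equal')
  finally show ?thesis .
qed

lemma lookup_mult_const:
  fixes p :: "'a free_alg"
  shows "Poly_Mapping.lookup (p * free_const r) w = Poly_Mapping.lookup p w * r"
proof -
  have inner: "Sum_any (\<lambda>k. Poly_Mapping.lookup (free_const r) k when w = l + k) = (r when w = l)"
    for l :: "'a fword"
  proof -
    have "Sum_any (\<lambda>k. Poly_Mapping.lookup (free_const r) k when w = l + k)
        = Sum_any (\<lambda>k::'a fword. (r when w = l) when k = 0)"
      by (intro arg_cong[where f = Sum_any] ext)
         (auto simp: free_const_def lookup_single when_def)
    then show ?thesis by (simp only: Sum_any_when_equal)
  qed
  have "Poly_Mapping.lookup (p * free_const r) w
      = Sum_any (\<lambda>l. Poly_Mapping.lookup p l * r when w = l)"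
    unfolding lookup_mult_Sum_any inner by (rule Sum_any.cong) (auto simp: when_def)
  then show ?thesis by (simp only: Sum_any_when_equal')
qed

lemma free_const_commute: "free_const r * p = p * free_const r"
  by (rule poly_mapping_eqI) (simp add: lookup_const_mult lookup_mult_const)

lemma lookup_mult_0:
  fixes p q :: "'a free_alg"
  shows "Poly_Mapping.lookup (p * q) 0 = Poly_Mapping.lookup p 0 * Poly_Mapping.lookup q 0"
proof -
  have inner: "Sum_any (\<lambda>k. Poly_Mapping.lookup q k when 0 = l + k)
      = (Poly_Mapping.lookup q 0 when l = 0)" for l :: "'a fword"
  proof -
    have "Sum_any (\<lambda>k. Poly_Mapping.lookup q k when 0 = l + k)
        = Sum_any (\<lambda>k::'a fword. (Poly_Mapping.lookup q 0 when l = 0) when k = 0)"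
      by (intro arg_cong[where f = Sum_any] ext) (use fword_add_eq_0_iff[of l] in \<open>auto simp: when_def\<close>)
    then show ?thesis by (simp only: Sum_any_when_equal)
  qed
  have "Poly_Mapping.lookup (p * q) 0
      = Sum_any (\<lambda>l. Poly_Mapping.lookup p l * Poly_Mapping.lookup q 0 when l = 0)"
    unfolding lookup_mult_Sum_any inner by (rule Sum_any.cong) (auto simp: when_def)
  then show ?thesis by (simp only: Sum_any_when_equal)
qed

subsection \<open>The Lie superalgebra and its enveloping algebra\<close>

text \<open>The purely odd space \<open>V\<close> with its form \<open>\<beta>\<close> is a type \<open>'v\<close> with its inner product (a
  Euclidean space in the end); \<open>\<hh>\<cc> = V \<oplus> \<real>z\<close> is \<open>'v \<times> real\<close>, the pair \<open>(v, \<lambda>)\<close> standing for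
  \<open>v + \<lambda>z\<close>.\<close>

definition hc_bracket :: "'v::real_inner \<times> real \<Rightarrow> 'v \<times> real \<Rightarrow> 'v \<times> real" where
  "hc_bracket x y = (0, 2 * inner (fst x) (fst y))"

definition hc_homogeneous :: "nat \<Rightarrow> 'v::real_inner \<times> real \<Rightarrow> bool" where
  "hc_homogeneous p x \<longleftrightarrow> (if even p then fst x = 0 else snd x = 0)"

inductive_set hc_relators :: "('v::real_inner \<times> real) free_alg set" where
  add: "free_gen (x + y) - (free_gen x + free_gen y) \<in> hc_relators"
| scale: "free_gen (r *\<^sub>R x) - free_const r * free_gen x \<in> hc_relators"
| bracket: "hc_homogeneous p x \<Longrightarrow> hc_homogeneous q y \<Longrightarrow>
    free_gen x * free_gen y - (-1) ^ (p * q) * (free_gen y * free_gen x)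
      - free_gen (hc_bracket x y) \<in> hc_relators"

inductive_set hc_ideal :: "('v::real_inner \<times> real) free_alg set" where
  zero: "0 \<in> hc_ideal"
| add: "p \<in> hc_ideal \<Longrightarrow> q \<in> hc_ideal \<Longrightarrow> p + q \<in> hc_ideal"
| gen: "r \<in> hc_relators \<Longrightarrow> p * r * q \<in> hc_ideal"

lemma hc_ideal_mult_left: "p \<in> hc_ideal \<Longrightarrow> a * p \<in> hc_ideal"
  by (induction rule: hc_ideal.induct)
     (auto simp: distrib_left mult.assoc[symmetric] intro: hc_ideal.intros)

lemma hc_ideal_mult_right: "p \<in> hc_ideal \<Longrightarrow> p * a \<in> hc_ideal"
proof (induction rule: hc_ideal.induct)
  case (gen r p q)
  then show ?case using hc_ideal.gen[of r p "q * a"] by (simp add: mult.assoc)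
qed (auto simp: distrib_right intro: hc_ideal.intros)

lemma hc_ideal_uminus: "p \<in> hc_ideal \<Longrightarrow> - p \<in> hc_ideal"
  using hc_ideal_mult_left[of p "- 1"] by simp

lemma hc_ideal_diff: "p \<in> hc_ideal \<Longrightarrow> q \<in> hc_ideal \<Longrightarrow> p - q \<in> hc_ideal"
  using hc_ideal.add[of p "- q"] hc_ideal_uminus[of q] by simp

lemma hc_relators_augmentation: "p \<in> hc_relators \<Longrightarrow> Poly_Mapping.lookup p 0 = 0"
  by (induction rule: hc_relators.induct)
     (simp_all add: lookup_minus lookup_add lookup_mult_0 lookup_free_gen_0)

lemma hc_ideal_augmentation: "p \<in> hc_ideal \<Longrightarrow> Poly_Mapping.lookup p 0 = 0"
  by (induction rule: hc_ideal.induct)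
     (auto simp: lookup_add lookup_mult_0 hc_relators_augmentation)

definition hc_eq :: "('v::real_inner \<times> real) free_alg \<Rightarrow> ('v \<times> real) free_alg \<Rightarrow> bool" where
  "hc_eq p q \<longleftrightarrow> p - q \<in> hc_ideal"

lemma hc_eq_equivp: "equivp hc_eq"
proof (rule equivpI)
  show "reflp hc_eq"
    by (auto simp: reflp_def hc_eq_def intro: hc_ideal.zero)
  show "symp hc_eq"
  proof (rule sympI)
    fix p q
    assume "hc_eq p q"
    then show "hc_eq q p"
      unfolding hc_eq_def using hc_ideal_uminus[of "p - q"] by simp
  qed
  show "transp hc_eq"
  proof (rule transpI)
    fix p q r
    assume "hc_eq p q" "hc_eq q r"
    then show "hc_eq p r"
      unfolding hc_eq_def using hc_ideal.add[of "p - q" "q - r"] by simp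
  qed
qed

quotient_type (overloaded) 'v hc_uea = "('v::real_inner \<times> real) free_alg" / hc_eq
  by (rule hc_eq_equivp)

instantiation hc_uea :: (real_inner) real_algebra_1
begin

lift_definition zero_hc_uea :: "'a hc_uea" is 0 .

lift_definition one_hc_uea :: "'a hc_uea" is 1 .

lift_definition plus_hc_uea :: "'a hc_uea \<Rightarrow> 'a hc_uea \<Rightarrow> 'a hc_uea" is "(+)"
proof -
  fix p p' q q' :: "('a \<times> real) free_alg"
  assume "hc_eq p p'" "hc_eq q q'"
  moreover have "(p + q) - (p' + q') = (p - p') + (q - q')" by simp
  ultimately show "hc_eq (p + q) (p' + q')"
    unfolding hc_eq_def by (simp only: hc_ideal.add)
qed

lift_definition uminus_hc_uea :: "'a hc_uea \<Rightarrow> 'a hc_uea" is uminus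
proof -
  fix p p' :: "('a \<times> real) free_alg"
  assume "hc_eq p p'"
  moreover have "- p - - p' = - (p - p')" by simp
  ultimately show "hc_eq (- p) (- p')"
    unfolding hc_eq_def by (simp only: hc_ideal_uminus)
qed

lift_definition minus_hc_uea :: "'a hc_uea \<Rightarrow> 'a hc_uea \<Rightarrow> 'a hc_uea" is "(-)"
proof -
  fix p p' q q' :: "('a \<times> real) free_alg"
  assume "hc_eq p p'" "hc_eq q q'"
  moreover have "(p - q) - (p' - q') = (p - p') - (q - q')" by simp
  ultimately show "hc_eq (p - q) (p' - q')"
    unfolding hc_eq_def by (simp only: hc_ideal_diff)
qed

lift_definition times_hc_uea :: "'a hc_uea \<Rightarrow> 'a hc_uea \<Rightarrow> 'a hc_uea" is "(*)"
proof -
  fix p p' q q' :: "('a \<times> real) free_alg"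
  assume "hc_eq p p'" "hc_eq q q'"
  moreover have "p * q - p' * q' = (p - p') * q + p' * (q - q')"
    by (simp add: algebra_simps)
  ultimately show "hc_eq (p * q) (p' * q')"
    unfolding hc_eq_def by (simp only: hc_ideal.add hc_ideal_mult_left hc_ideal_mult_right)
qed

lift_definition scaleR_hc_uea :: "real \<Rightarrow> 'a hc_uea \<Rightarrow> 'a hc_uea" is "\<lambda>r p. free_const r * p"
  unfolding hc_eq_def by (simp only: right_diff_distrib[symmetric] hc_ideal_mult_left)

instance
proof
  have refl: "p = q \<Longrightarrow> hc_eq p q" for p q :: "('a \<times> real) free_alg"
    by (simp add: hc_eq_def hc_ideal.zero)
  fix a b c :: "'a hc_uea" and r s :: real
  show "a + b + c = a + (b + c)" by transfer (rule refl, simp)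
  show "a + b = b + a" by transfer (rule refl, simp)
  show "0 + a = a" by transfer (rule refl, simp)
  show "- a + a = 0" by transfer (rule refl, simp)
  show "a - b = a + - b" by transfer (rule refl, simp)
  show "a * b * c = a * (b * c)" by transfer (rule refl, simp add: mult.assoc)
  show "(a + b) * c = a * c + b * c" by transfer (rule refl, simp add: distrib_right)
  show "a * (b + c) = a * b + a * c" by transfer (rule refl, simp add: distrib_left)
  show "1 * a = a" by transfer (rule refl, simp)
  show "a * 1 = a" by transfer (rule refl, simp)
  show "r *\<^sub>R (a + b) = r *\<^sub>R a + r *\<^sub>R b" by transfer (rule refl, simp add: distrib_left)
  show "(r + s) *\<^sub>R a = r *\<^sub>R a + s *\<^sub>R a"
    by transfer (rule refl, simp add: free_const_add distrib_right)
  show "r *\<^sub>R s *\<^sub>R a = (r * s) *\<^sub>R a"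
    by transfer (rule refl, simp add: free_const_mult mult.assoc)
  show "1 *\<^sub>R a = a" by transfer (rule refl, simp add: free_const_1)
  show "r *\<^sub>R a * b = r *\<^sub>R (a * b)" by transfer (rule refl, simp add: mult.assoc)
  show "a * r *\<^sub>R b = r *\<^sub>R (a * b)"
  proof (transfer, rule refl)
    fix p q :: "('a \<times> real) free_alg" and r :: real
    have "p * (free_const r * q) = (p * free_const r) * q" by (simp only: mult.assoc)
    also have "\<dots> = free_const r * (p * q)"
      by (simp only: free_const_commute[symmetric] mult.assoc)
    finally show "p * (free_const r * q) = free_const r * (p * q)" .
  qed
  show "(0 :: 'a hc_uea) \<noteq> 1"
  proof (transfer, rule notI)
    assume "hc_eq 0 (1 :: ('a \<times> real) free_alg)"
    then have "Poly_Mapping.lookup (0 - 1 :: ('a \<times> real) free_alg) 0 = 0"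
      unfolding hc_eq_def by (rule hc_ideal_augmentation)
    then show False
      by (simp add: lookup_minus lookup_one)
  qed
qed

end

lift_definition hc_odd :: "'v::real_inner \<Rightarrow> 'v hc_uea" is "\<lambda>v. free_gen (v, 0)" .

lift_definition hc_z :: "'v::real_inner hc_uea" is "free_gen (0, 1)" .

lemma hc_odd_anticommute:
  "hc_odd u * hc_odd v + hc_odd v * hc_odd u = (2 * inner u v) *\<^sub>R hc_z"
proof (transfer fixing: u v)
  let ?c = "2 * inner u v"
  have "free_gen (u, 0) * free_gen (v, 0)
      - (-1) ^ (1 * 1) * (free_gen (v, 0) * free_gen (u, 0))
      - free_gen (hc_bracket (u, 0) (v, 0)) \<in> hc_relators"
    by (rule hc_relators.bracket) (auto simp: hc_homogeneous_def)
  then have 1: "free_gen (u, 0) * free_gen (v, 0) + free_gen (v, 0) * free_gen (u, 0)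
      - free_gen (0, ?c) \<in> hc_ideal"
    using hc_ideal.gen[of _ 1 1] by (simp add: hc_bracket_def)
  have "free_gen (?c *\<^sub>R (0, 1)) - free_const ?c * free_gen (0, 1) \<in> hc_relators"
    by (rule hc_relators.scale)
  then have 2: "free_gen (0, ?c) - free_const ?c * free_gen (0, 1) \<in> hc_ideal"
    using hc_ideal.gen[of _ 1 1] by simp
  show "hc_eq (free_gen (u, 0) * free_gen (v, 0) + free_gen (v, 0) * free_gen (u, 0))
      (free_const ?c * free_gen (0, 1))"
    unfolding hc_eq_def using hc_ideal.add[OF 1 2] by simp
qed

lemma hc_z_commute_odd: "hc_z * hc_odd v = hc_odd v * hc_z"
proof (transfer fixing: v)
  have "free_gen (0, 1) * free_gen (v, 0)
      - (-1) ^ (0 * 1) * (free_gen (v, 0) * free_gen (0, 1))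
      - free_gen (hc_bracket (0, 1) (v, 0)) \<in> hc_relators"
    by (rule hc_relators.bracket) (auto simp: hc_homogeneous_def)
  then have 1: "free_gen (0, 1) * free_gen (v, 0) - free_gen (v, 0) * free_gen (0, 1)
      - free_gen (0, 0) \<in> hc_ideal"
    using hc_ideal.gen[of _ 1 1] by (simp add: hc_bracket_def)
  have "free_gen (0 *\<^sub>R (0, 0)) - free_const 0 * free_gen (0, 0) \<in> hc_relators"
    by (rule hc_relators.scale)
  then have 2: "free_gen (0, 0) \<in> hc_ideal"
    using hc_ideal.gen[of _ 1 1] by (simp add: free_const_def)
  show "hc_eq (free_gen (0, 1) * free_gen (v, 0)) (free_gen (v, 0) * free_gen (0, 1))"
    unfolding hc_eq_def using hc_ideal.add[OF 1 2] by simp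
qed

subsection \<open>The monomials of an orthonormal basis\<close>

definition orthonormal_seq :: "(nat \<Rightarrow> 'v::euclidean_space) \<Rightarrow> bool" where
  "orthonormal_seq a \<longleftrightarrow>
    (\<forall>i\<in>{1..DIM('v)}. \<forall>j\<in>{1..DIM('v)}. inner (a i) (a j) = (if i = j then 1 else 0))"

definition hc_monom :: "(nat \<Rightarrow> 'v::euclidean_space) \<Rightarrow> nat set \<Rightarrow> 'v hc_uea" where
  "hc_monom a I = prod_list (map (\<lambda>i. hc_odd (a i)) (sorted_list_of_set I))"

definition hc_star :: "(nat \<Rightarrow> 'v::euclidean_space) \<Rightarrow> nat set \<Rightarrow> 'v hc_uea" where
  "hc_star a I = (THE w. w \<in> {hc_monom a ({1..DIM('v)} - I), - hc_monom a ({1..DIM('v)} - I)}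
                        \<and> hc_monom a I * w = hc_monom a {1..DIM('v)})"

section \<open>Smooth functions and distributions\<close>

subsection \<open>The real line\<close>

definition vderiv :: "(real \<Rightarrow> complex) \<Rightarrow> real \<Rightarrow> complex" where
  "vderiv f = (\<lambda>x. vector_derivative f (at x))"

definition Cinf :: "(real \<Rightarrow> complex) set" where
  "Cinf = {f. \<forall>k x. (vderiv ^^ k) f differentiable (at x)}"

definition Cinf_nhd :: "(real \<Rightarrow> complex) \<Rightarrow> nat \<Rightarrow> real \<Rightarrow> (real \<Rightarrow> complex) set" where
  "Cinf_nhd f m e = {g \<in> Cinf. \<forall>k\<le>m. \<forall>x\<in>{- real m..real m}.
      cmod ((vderiv ^^ k) g x - (vderiv ^^ k) f x) < e}"

definition Cinf_top :: "(real \<Rightarrow> complex) topology" where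
  "Cinf_top = topology (\<lambda>S. S \<subseteq> Cinf \<and> (\<forall>f\<in>S. \<exists>m. \<exists>e>0. Cinf_nhd f m e \<subseteq> S))"

lemma openin_Cinf_top:
  "openin Cinf_top S \<longleftrightarrow> S \<subseteq> Cinf \<and> (\<forall>f\<in>S. \<exists>m. \<exists>e>0. Cinf_nhd f m e \<subseteq> S)"
proof -
  have mono: "Cinf_nhd f (max m m') (min e e') \<subseteq> Cinf_nhd f m e \<inter> Cinf_nhd f m' e'"
    for f m m' e e'
  proof
    fix g assume g: "g \<in> Cinf_nhd f (max m m') (min e e')"
    have *: "cmod ((vderiv ^^ k) g x - (vderiv ^^ k) f x) < min e e'"
      if "k \<le> max m m'" "- real (max m m') \<le> x" "x \<le> real (max m m')" for k x
      using g that by (simp add: Cinf_nhd_def)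
    have "g \<in> Cinf" using g by (simp add: Cinf_nhd_def)
    moreover have "cmod ((vderiv ^^ k) g x - (vderiv ^^ k) f x) < e"
      if "k \<le> m" "- real m \<le> x" "x \<le> real m" for k x
      using *[of k x] that by simp
    moreover have "cmod ((vderiv ^^ k) g x - (vderiv ^^ k) f x) < e'"
      if "k \<le> m'" "- real m' \<le> x" "x \<le> real m'" for k x
      using *[of k x] that by simp
    ultimately show "g \<in> Cinf_nhd f m e \<inter> Cinf_nhd f m' e'"
      by (simp add: Cinf_nhd_def)
  qed
  have "istopology (\<lambda>S. S \<subseteq> Cinf \<and> (\<forall>f\<in>S. \<exists>m. \<exists>e>0. Cinf_nhd f m e \<subseteq> S))"
    unfolding istopology_def
  proof (intro conjI allI impI)
    fix S T
    assume S: "S \<subseteq> Cinf \<and> (\<forall>f\<in>S. \<exists>m. \<exists>e>0. Cinf_nhd f m e \<subseteq> S)"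
      and T: "T \<subseteq> Cinf \<and> (\<forall>f\<in>T. \<exists>m. \<exists>e>0. Cinf_nhd f m e \<subseteq> T)"
    show "S \<inter> T \<subseteq> Cinf" using S by blast
    show "\<forall>f\<in>S \<inter> T. \<exists>m. \<exists>e>0. Cinf_nhd f m e \<subseteq> S \<inter> T"
    proof
      fix f assume "f \<in> S \<inter> T"
      then obtain m e m' e' where "e > 0" "Cinf_nhd f m e \<subseteq> S" "e' > 0" "Cinf_nhd f m' e' \<subseteq> T"
        using S T by blast
      then have "min e e' > 0" "Cinf_nhd f (max m m') (min e e') \<subseteq> S \<inter> T"
        using mono[of f m m' e e'] by auto
      then show "\<exists>m. \<exists>e>0. Cinf_nhd f m e \<subseteq> S \<inter> T" by blast
    qed
  next
    fix K
    assume K: "\<forall>S\<in>K. S \<subseteq> Cinf \<and> (\<forall>f\<in>S. \<exists>m. \<exists>e>0. Cinf_nhd f m e \<subseteq> S)"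
    show "\<Union>K \<subseteq> Cinf" using K by blast
    show "\<forall>f\<in>\<Union>K. \<exists>m. \<exists>e>0. Cinf_nhd f m e \<subseteq> \<Union>K" using K by (meson UnionE Union_upper order_trans)
  qed
  then show ?thesis
    by (simp add: Cinf_top_def topology_inverse')
qed

lemma topspace_Cinf_top: "topspace Cinf_top = Cinf"
proof -
  have "openin Cinf_top Cinf"
    unfolding openin_Cinf_top
    by (intro conjI ballI subset_refl exI[of _ 0] exI[of _ "1::real"]) (auto simp: Cinf_nhd_def)
  then show ?thesis
    by (meson openin_Cinf_top openin_subset openin_topspace subset_antisym)
qed

definition E_real :: "((real \<Rightarrow> complex) \<Rightarrow> complex) set" where
  "E_real = {T. (\<forall>f\<in>Cinf. \<forall>g\<in>Cinf. T (\<lambda>x. f x + g x) = T f + T g)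
              \<and> (\<forall>c. \<forall>f\<in>Cinf. T (\<lambda>x. c * f x) = c * T f)
              \<and> continuous_map Cinf_top euclidean T}"

subsection \<open>The supergroup \<open>HC\<close>\<close>

definition Cinf_HC :: "('v::euclidean_space hc_uea \<Rightarrow> real \<Rightarrow> complex) set" where
  "Cinf_HC = {F. (\<forall>x. linear (\<lambda>u. F u x)) \<and> (\<forall>u. F u \<in> Cinf) \<and> (\<forall>u. F (hc_z * u) = vderiv (F u))}"

definition Cinf_HC_top ::
    "(nat \<Rightarrow> 'v::euclidean_space) \<Rightarrow> ('v hc_uea \<Rightarrow> real \<Rightarrow> complex) topology" where
  "Cinf_HC_top a = pullback_topology Cinf_HC (\<lambda>F. \<lambda>I\<in>Pow {1..DIM('v)}. F (hc_monom a I))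
     (product_topology (\<lambda>I. Cinf_top) (Pow {1..DIM('v)}))"

definition E_HC ::
    "(nat \<Rightarrow> 'v::euclidean_space) \<Rightarrow> (('v hc_uea \<Rightarrow> real \<Rightarrow> complex) \<Rightarrow> complex) set" where
  "E_HC a = {U. (\<forall>F\<in>Cinf_HC. \<forall>G\<in>Cinf_HC. U (\<lambda>u x. F u x + G u x) = U F + U G)
              \<and> (\<forall>c. \<forall>F\<in>Cinf_HC. U (\<lambda>u x. c * F u x) = c * U F)
              \<and> continuous_map (Cinf_HC_top a) euclidean U}"

text \<open>The components \<open>U(a\<^sub>I)\<close>. They are unique as functionals on \<^const>\<open>Cinf\<close>; the values off
  \<^const>\<open>Cinf\<close>, on which the choice depends, are never used.\<close>

definition hc_components ::
    "(nat \<Rightarrow> 'v::euclidean_space) \<Rightarrow> (('v hc_uea \<Rightarrow> real \<Rightarrow> complex) \<Rightarrow> complex)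
      \<Rightarrow> nat set \<Rightarrow> (real \<Rightarrow> complex) \<Rightarrow> complex" where
  "hc_components a U = (SOME T. (\<forall>I\<in>Pow {1..DIM('v)}. T I \<in> E_real) \<and>
     (\<forall>\<Phi>\<in>Cinf_HC. U \<Phi> = (\<Sum>I\<in>Pow {1..DIM('v)}.
        (-1) ^ (card I * (DIM('v) - card I)) * T I (\<Phi> (hc_star a I)))))"

section \<open>The representations\<close>

subsection \<open>Matrices\<close>

definition kron :: "complex mat \<Rightarrow> complex mat \<Rightarrow> complex mat" where
  "kron A B = Matrix.mat (dim_row A * dim_row B) (dim_col A * dim_col B)
     (\<lambda>(i, j). A $$ (i div dim_row B, j div dim_col B) * B $$ (i mod dim_row B, j mod dim_col B))"

definition kron_list :: "complex mat list \<Rightarrow> complex mat" where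
  "kron_list Ms = foldr kron Ms (1\<^sub>m 1)"

definition sigma_mat :: "complex mat" where
  "sigma_mat = mat_of_rows_list 2 [[1, 0], [0, - 1]]"

definition X_mat :: "complex \<Rightarrow> complex mat" where
  "X_mat \<zeta> = mat_of_rows_list 2 [[0, \<zeta>], [1, 0]]"

definition Y_mat :: "complex \<Rightarrow> complex mat" where
  "Y_mat \<zeta> = mat_of_rows_list 2 [[0, \<i> * \<zeta>], [- \<i>, 0]]"

text \<open>The matrix \<open>c\<^sub>\<zeta>(a\<^sub>m)\<close>, \<open>1 \<le> m \<le> 2k\<close>, of the even-dimensional case; here \<open>m = 2j - 1\<close> or
  \<open>m = 2j\<close> with \<open>j = (m + 1) div 2\<close>.\<close>

definition c_even :: "nat \<Rightarrow> complex \<Rightarrow> nat \<Rightarrow> complex mat" where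
  "c_even k \<zeta> m = (let j = (m + 1) div 2 in
     kron_list (replicate (j - 1) sigma_mat @ [if odd m then X_mat \<zeta> else Y_mat \<zeta>]
       @ replicate (k - j) (1\<^sub>m 2)))"

definition Gamma_mat :: "nat \<Rightarrow> complex mat" where
  "Gamma_mat k = kron_list (replicate k sigma_mat)"

subsection \<open>The algebras \<open>\<H>\<^sub>\<zeta>\<close>\<close>

text \<open>The pair \<open>(A, B)\<close> stands for \<open>A + \<epsilon> B\<close>. For even \<open>n\<close> there is no \<open>\<epsilon>\<close>, and a matrix \<open>A\<close> is
  represented by \<open>(A, 0)\<close>. For odd \<open>n\<close> the matrix factor is purely even, so that \<open>\<epsilon>\<close> commutes
  with matrices.\<close>

type_synonym hc_mats = "complex mat \<times> complex mat"

definition hc_H :: "nat \<Rightarrow> hc_mats set" where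
  "hc_H n = (let N = 2 ^ (n div 2) in
     carrier_mat N N \<times> (if even n then {0\<^sub>m N N} else carrier_mat N N))"

definition H_one :: "nat \<Rightarrow> hc_mats" where
  "H_one n = (let N = 2 ^ (n div 2) in (1\<^sub>m N, 0\<^sub>m N N))"

definition H_add :: "hc_mats \<Rightarrow> hc_mats \<Rightarrow> hc_mats" where
  "H_add P Q = (fst P + fst Q, snd P + snd Q)"

definition H_scale :: "complex \<Rightarrow> hc_mats \<Rightarrow> hc_mats" where
  "H_scale c P = (c \<cdot>\<^sub>m fst P, c \<cdot>\<^sub>m snd P)"

definition H_mult :: "complex \<Rightarrow> hc_mats \<Rightarrow> hc_mats \<Rightarrow> hc_mats" where
  "H_mult \<zeta> P Q = (fst P * fst Q + \<zeta> \<cdot>\<^sub>m (snd P * snd Q), fst P * snd Q + snd P * fst Q)"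

definition H_sum :: "nat \<Rightarrow> ('i \<Rightarrow> hc_mats) \<Rightarrow> 'i set \<Rightarrow> hc_mats" where
  "H_sum n f S = (let N = 2 ^ (n div 2) in
     (Matrix.mat N N (\<lambda>ij. \<Sum>s\<in>S. fst (f s) $$ ij), Matrix.mat N N (\<lambda>ij. \<Sum>s\<in>S. snd (f s) $$ ij)))"

text \<open>Holomorphy of a function with values in the finite-dimensional space \<open>\<H>\<close> is holomorphy of
  its matrix entries.\<close>

definition H_entire :: "nat \<Rightarrow> (complex \<Rightarrow> hc_mats) \<Rightarrow> bool" where
  "H_entire n G \<longleftrightarrow> (\<forall>\<zeta>. G \<zeta> \<in> hc_H n) \<and>
     (\<forall>i<2 ^ (n div 2). \<forall>j<2 ^ (n div 2).
        (\<lambda>\<zeta>. fst (G \<zeta>) $$ (i, j)) holomorphic_on UNIV \<and>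
        (\<lambda>\<zeta>. snd (G \<zeta>) $$ (i, j)) holomorphic_on UNIV)"

subsection \<open>The homomorphisms \<open>d\<pi>\<^sub>\<zeta>\<close>\<close>

definition c_rep :: "nat \<Rightarrow> complex \<Rightarrow> nat \<Rightarrow> hc_mats" where
  "c_rep n \<zeta> m = (let k = n div 2; N = 2 ^ k in
     if even n then (c_even k \<zeta> m, 0\<^sub>m N N)
     else if m = 1 then (0\<^sub>m N N, Gamma_mat k)
     else (0\<^sub>m N N, (- \<i>) \<cdot>\<^sub>m (Gamma_mat k * c_even k 1 (m - 1))))"

definition H_alg_hom :: "complex \<Rightarrow> ('v::euclidean_space hc_uea \<Rightarrow> hc_mats) \<Rightarrow> bool" where
  "H_alg_hom \<zeta> h \<longleftrightarrow>
     (\<forall>u. h u \<in> hc_H (DIM('v))) \<and>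
     (\<forall>u v. h (u + v) = H_add (h u) (h v)) \<and>
     (\<forall>r u. h (r *\<^sub>R u) = H_scale (complex_of_real r) (h u)) \<and>
     (\<forall>u v. h (u * v) = H_mult \<zeta> (h u) (h v)) \<and>
     h 1 = H_one (DIM('v))"

definition dpi :: "(nat \<Rightarrow> 'v::euclidean_space) \<Rightarrow> complex \<Rightarrow> 'v hc_uea \<Rightarrow> hc_mats" where
  "dpi a \<zeta> = (THE h. H_alg_hom \<zeta> h \<and>
     (\<forall>j\<in>{1..DIM('v)}. h (hc_odd (a j)) = H_scale (exp (\<i> * pi / 4)) (c_rep (DIM('v)) \<zeta> j)) \<and>
     h hc_z = H_scale (\<i> * \<zeta>) (H_one (DIM('v))))"

text \<open>\<open>\<langle>U, \<pi>\<^sub>\<zeta>\<rangle>\<close>, where \<open>\<pi>\<^sub>\<zeta>(u; x) = exp(i \<zeta> x) d\<pi>\<^sub>\<zeta>(u)\<close>.\<close>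

definition pairing_pi ::
    "(nat \<Rightarrow> 'v::euclidean_space) \<Rightarrow> (('v hc_uea \<Rightarrow> real \<Rightarrow> complex) \<Rightarrow> complex)
      \<Rightarrow> complex \<Rightarrow> hc_mats" where
  "pairing_pi a U \<zeta> = H_sum (DIM('v))
     (\<lambda>I. H_scale (hc_components a U I (\<lambda>x. exp (\<i> * \<zeta> * complex_of_real x)))
                  (dpi a \<zeta> (hc_star a I)))
     (Pow {1..DIM('v)})"

end

theory Submission
  imports Defs
begin

text \<open>Distributions of one real variable are continuous on smooth functions, so applying one to the
  exponential series \<open>exp (w x) = \<Sum> w\<^sup>k x\<^sup>k / k!\<close>, which converges with all derivatives on compacta,
  gives an everywhere convergent power series in \<open>w\<close>. The matrix entries of \<open>d\<pi>\<^sub>\<zeta>(*a\<^sub>I)\<close> are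
  polynomials in \<open>\<zeta>\<close>, because up to sign \<open>*a\<^sub>I\<close> is a product of generators.

  What remains is that the objects defined by choice exist. Operators satisfying the Clifford
  relations on a space \<open>S\<close> of functions turn every \<open>f\<^sub>0 \<in> S\<close> into a module map \<open>u \<mapsto> u f\<^sub>0\<close> on the
  enveloping algebra. Applied to families of smooth functions indexed by the monomials \<open>a\<^sub>I\<close>, this
  produces \<open>F\<close> with prescribed values \<open>F(a\<^sub>I)\<close>, hence the components \<open>U(a\<^sub>I)\<close> and the nonvanishing
  of the monomials; applied to \<open>\<H>\<^sub>\<zeta>\<close> acting on itself from the left, it produces \<open>d\<pi>\<^sub>\<zeta>\<close>.\<close>

section \<open>Distributions on the real line\<close>

text \<open>The components, \<open>hc_star\<close> and \<open>dpi\<close> come from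
  \<open>SOME\<close> and \<open>THE\<close>, so nothing can be read off them before existence, and
  for \<open>THE\<close> also uniqueness, is known. The enveloping algebra is a bare quotient of a
  free algebra, in which even \<gamma> \<noteq> -\<gamma>, on which the star rests, is not evident.
  The two halves of a Poincare-Birkhoff-Witt theorem are therefore split: spanning by the z^k a_I
  gives uniqueness statements, concrete modules give existence statements. Maps out of the algebra
  are built as orbit maps of a vector, because operators such as differentiation are linear only on
  a subset of a function type. A second obstacle is that \<open>dpi a \<zeta>\<close> is chosen for
  each \<zeta> separately, with a multiplication on the target that itself varies with \<zeta>. The
  dependence on \<zeta> becomes visible only on products of the explicit generators.\<close>

lemma Cinf_differentiable: "f \<in> Cinf \<Longrightarrow> (vderiv ^^ k) f differentiable (at x)"
  by (simp add: Cinf_def)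

lemma Cinf_has_vderiv:
  assumes "f \<in> Cinf"
  shows "((vderiv ^^ k) f has_vector_derivative (vderiv ^^ Suc k) f x) (at x)"
  using Cinf_differentiable[OF assms, of k x]
  by (simp add: vderiv_def vector_derivative_works)

lemma vderiv_eqI: "(\<And>x. (f has_vector_derivative f' x) (at x)) \<Longrightarrow> vderiv f = f'"
  by (auto simp: vderiv_def fun_eq_iff intro: vector_derivative_at)

text \<open>Each closure property of \<open>Cinf\<close> comes from an explicit tower of functions,
  every one the derivative of its predecessor. Such a tower settles smoothness and the iterated
  derivatives together.\<close>

lemma Cinf_derivs:
  assumes "\<And>k x. (g k has_vector_derivative g (Suc k) x) (at x)"
  shows "(vderiv ^^ k) (g 0) = g k" and "g 0 \<in> Cinf"
proof -
  show *: "(vderiv ^^ k) (g 0) = g k" for k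
    by (induction k) (auto intro!: vderiv_eqI assms)
  show "g 0 \<in> Cinf"
    using assms by (auto simp: Cinf_def * intro: differentiableI_vector)
qed

lemma vderiv_in_Cinf: "f \<in> Cinf \<Longrightarrow> vderiv f \<in> Cinf"
  using Cinf_derivs(2)[of "\<lambda>k. (vderiv ^^ Suc k) f"] Cinf_has_vderiv[of f "Suc _"] by auto

lemma
  assumes "f \<in> Cinf" "g \<in> Cinf"
  shows Cinf_add: "(\<lambda>x. f x + g x) \<in> Cinf"
    and vderivs_add: "(vderiv ^^ k) (\<lambda>x. f x + g x) = (\<lambda>x. (vderiv ^^ k) f x + (vderiv ^^ k) g x)"
  using Cinf_derivs[of "\<lambda>k x. (vderiv ^^ k) f x + (vderiv ^^ k) g x"]
    has_vector_derivative_add[OF Cinf_has_vderiv[OF assms(1)] Cinf_has_vderiv[OF assms(2)]]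
  by auto

lemma
  assumes "f \<in> Cinf"
  shows Cinf_cmult: "(\<lambda>x. c * f x) \<in> Cinf"
    and vderivs_cmult: "(vderiv ^^ k) (\<lambda>x. c * f x) = (\<lambda>x. c * (vderiv ^^ k) f x)"
  using Cinf_derivs[of "\<lambda>k x. c * (vderiv ^^ k) f x"]
    has_vector_derivative_mult_right[OF Cinf_has_vderiv[OF assms]]
  by auto

lemma Cinf_const: "(\<lambda>x. c) \<in> Cinf"
  using Cinf_derivs(2)[of "\<lambda>k x. if k = 0 then c else 0"] by simp

lemma Cinf_scaleR: "f \<in> Cinf \<Longrightarrow> (\<lambda>x. r *\<^sub>R f x) \<in> Cinf"
  by (simp add: scaleR_conv_of_real Cinf_cmult)

lemma vderiv_add: "f \<in> Cinf \<Longrightarrow> g \<in> Cinf \<Longrightarrow> vderiv (\<lambda>x. f x + g x) = (\<lambda>x. vderiv f x + vderiv g x)"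
  using vderivs_add[of f g 1] by simp

lemma vderiv_cmult: "f \<in> Cinf \<Longrightarrow> vderiv (\<lambda>x. c * f x) = (\<lambda>x. c * vderiv f x)"
  using vderivs_cmult[of f 1] by simp

lemma vderiv_scaleR: "f \<in> Cinf \<Longrightarrow> vderiv (\<lambda>x. r *\<^sub>R f x) = (\<lambda>x. r *\<^sub>R vderiv f x)"
  by (simp add: scaleR_conv_of_real vderiv_cmult)

section \<open>Tails of the exponential series\<close>

definition exp_remainder :: "complex \<Rightarrow> nat \<Rightarrow> real \<Rightarrow> complex" where
  "exp_remainder w N x = exp (w * of_real x) - (\<Sum>k<N. (w * of_real x) ^ k / fact k)"

text \<open>Tails, unlike partial sums alone, include exp itself (\<open>N = 0\<close>), and
  differentiation only lowers the truncation index. Truncated subtraction makes the formula right at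
  \<open>N = 0\<close> as well, where exp(w x) has derivative w exp(w x).\<close>

lemma exp_remainder_derivative:
  "(exp_remainder w N has_vector_derivative w * exp_remainder w (N - 1) x) (at x)"
proof -
  have "((\<lambda>z. exp (w * z) - (\<Sum>k<N. (w * z) ^ k / fact k)) has_field_derivative
      w * (exp (w * z) - (\<Sum>k<N - 1. (w * z) ^ k / fact k))) (at z)" for z
  proof -
    have "(\<Sum>k<N. w * (of_nat k * (w * z) ^ (k - 1)) / fact k)
        = w * (\<Sum>k<N - 1. (w * z) ^ k / fact k)"
    proof (cases N)
      case (Suc M)
      have "w * (of_nat (Suc k) * (w * z) ^ k) / fact (Suc k) = w * ((w * z) ^ k / fact k)" for k
        by (simp add: field_simps del: of_nat_Suc)
      then show ?thesis
        by (simp only: Suc sum.lessThan_Suc_shift sum_distrib_left diff_Suc_1) simp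
    qed simp
    then show ?thesis
      by (auto intro!: derivative_eq_intros simp: right_diff_distrib mult_ac)
  qed
  from has_vector_derivative_real_field[OF this[of "of_real x"]] show ?thesis
    by (simp add: exp_remainder_def[abs_def])
qed

lemma exp_remainder_vderivs: "(vderiv ^^ k) (exp_remainder w N) = (\<lambda>x. w ^ k * exp_remainder w (N - k) x)"
  and exp_remainder_Cinf: "exp_remainder w N \<in> Cinf"
proof -
  have *: "((\<lambda>x. w ^ k * exp_remainder w (N - k) x) has_vector_derivative
      w ^ Suc k * exp_remainder w (N - Suc k) x) (at x)" for k x
    using has_vector_derivative_mult_right[OF exp_remainder_derivative[of w "N - k" x], of "w ^ k"]
    by (simp add: mult_ac)
  show "(vderiv ^^ k) (exp_remainder w N) = (\<lambda>x. w ^ k * exp_remainder w (N - k) x)"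
      and "exp_remainder w N \<in> Cinf"
    using Cinf_derivs[of "\<lambda>k x. w ^ k * exp_remainder w (N - k) x", OF *] by simp_all
qed

lemma exp_remainder_uniform:
  "uniform_limit {-R..R} (exp_remainder w) (\<lambda>x. 0) sequentially"
proof -
  \<comment> \<open>The majorant for the Weierstrass test; the absolute value of R bounds every x in
    the interval without a sign condition on R.\<close>
  have "(\<lambda>n. (norm w * \<bar>R\<bar>) ^ n / fact n) sums exp (norm w * \<bar>R\<bar>)"
    using exp_converges[of "norm w * \<bar>R\<bar>"] by (simp add: field_simps)
  then have "uniform_limit {-R..R} (\<lambda>N x. \<Sum>k<N. (w * of_real x) ^ k / fact k)
      (\<lambda>x. suminf (\<lambda>k. (w * of_real x) ^ k / fact k)) sequentially"
    by (intro Weierstrass_m_test[of _ _ "\<lambda>n. (norm w * \<bar>R\<bar>) ^ n / fact n"])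
       (auto simp: sums_iff norm_divide norm_power norm_mult
         intro!: divide_right_mono power_mono mult_left_mono)
  moreover have "suminf (\<lambda>k. z ^ k / fact k) = exp z" for z :: complex
    using exp_converges[of z] by (simp add: sums_iff scaleR_conv_of_real field_simps)
  ultimately have "uniform_limit {-R..R} (\<lambda>N x. exp (w * of_real x) - (\<Sum>k<N. (w * of_real x) ^ k / fact k))
      (\<lambda>x. exp (w * of_real x) - exp (w * of_real x)) sequentially"
    by (intro uniform_limit_intros) simp
  then show ?thesis by (simp add: exp_remainder_def[abs_def])
qed

text \<open>Two consecutive tails at w = 1 differ by x^k / k!, so powers inherit smoothness from the
  tails.\<close>

lemma power_Cinf: "(\<lambda>x. of_real x ^ k :: complex) \<in> Cinf"
proof -
  have "(\<lambda>x. (exp_remainder 1 k x + (- 1) * exp_remainder 1 (Suc k) x)) \<in> Cinf"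
    by (intro Cinf_add Cinf_cmult exp_remainder_Cinf)
  then have "(\<lambda>x. fact k * (exp_remainder 1 k x + (- 1) * exp_remainder 1 (Suc k) x)) \<in> Cinf"
    by (rule Cinf_cmult)
  then show ?thesis by (simp add: exp_remainder_def)
qed

lemma exp_Cinf: "(\<lambda>x. exp (w * of_real x)) \<in> Cinf"
  using exp_remainder_Cinf[of w 0] by (simp add: exp_remainder_def[abs_def])

section \<open>Distributions applied to exponentials\<close>

lemma E_real_add: "T \<in> E_real \<Longrightarrow> f \<in> Cinf \<Longrightarrow> g \<in> Cinf \<Longrightarrow> T (\<lambda>x. f x + g x) = T f + T g"
  and E_real_cmult: "T \<in> E_real \<Longrightarrow> f \<in> Cinf \<Longrightarrow> T (\<lambda>x. c * f x) = c * T f"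
  by (auto simp: E_real_def)

lemma E_real_sum:
  assumes T: "T \<in> E_real" and "finite J" "\<And>j. j \<in> J \<Longrightarrow> f j \<in> Cinf"
  shows "(\<lambda>x. \<Sum>j\<in>J. c j * f j x) \<in> Cinf \<and> T (\<lambda>x. \<Sum>j\<in>J. c j * f j x) = (\<Sum>j\<in>J. c j * T (f j))"
  using assms(2,3)
proof (induction J rule: finite_induct)
  case empty
  then show ?case using E_real_cmult[OF T Cinf_const[of 0], of 0] by (simp add: Cinf_const)
next
  case (insert j J)
  then show ?case by (simp add: E_real_add[OF T] E_real_cmult[OF T] Cinf_add Cinf_cmult)
qed

text \<open>Continuity of \<open>T\<close> moves it inside the series as soon as the partial sums
  converge to the exponential in \<open>Cinf_top\<close>, that is, with all derivatives uniformly on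
  compacta. The error is exactly \<open>exp_remainder\<close>.\<close>

lemma E_real_exp_sums:
  assumes T: "T \<in> E_real"
  shows "(\<lambda>k. T (\<lambda>x. of_real x ^ k) / fact k * w ^ k) sums T (\<lambda>x. exp (w * of_real x))"
proof -
  let ?e = "\<lambda>x. exp (w * complex_of_real x)"
  let ?S = "\<lambda>N x. \<Sum>k<N. (w ^ k / fact k) * complex_of_real x ^ k"
  have S: "?S N \<in> Cinf \<and> T (?S N) = (\<Sum>k<N. (w ^ k / fact k) * T (\<lambda>x. of_real x ^ k))" for N
    by (rule E_real_sum[OF T]) (auto intro: power_Cinf)
  have S_remainder: "?e = (\<lambda>x. ?S N x + exp_remainder w N x)" for N
    by (simp add: exp_remainder_def power_mult_distrib)
  have "(\<lambda>N. T (?S N)) \<longlonglongrightarrow> T ?e"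
  proof (rule tendstoI)
    fix d :: real assume "d > 0"
    \<comment> \<open>Continuity is available through open sets, not seminorm bounds: the preimage
      of a ball contains a basic neighbourhood, which leaves finitely many derivatives on one
      compact interval to control.\<close>
    have "openin Cinf_top {f \<in> topspace Cinf_top. T f \<in> ball (T ?e) d}"
      using T by (intro openin_continuous_map_preimage[of _ euclidean]) (auto simp: E_real_def)
    then obtain m e where e: "e > 0" "Cinf_nhd ?e m e \<subseteq> {f \<in> topspace Cinf_top. T f \<in> ball (T ?e) d}"
      unfolding openin_Cinf_top using \<open>d > 0\<close> exp_Cinf[of w]
      by (auto simp: topspace_Cinf_top)
    have "\<forall>\<^sub>F N in sequentially. \<forall>k\<in>{..m}. \<forall>x\<in>{- real m..real m}. cmod (w ^ k * exp_remainder w (N - k) x) < e"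
    proof (rule eventually_ball_finite, simp, rule ballI)
      fix k
      \<comment> \<open>Chosen to absorb the factor w^k of the k-th derivative; the added 1 covers w
        = 0 and makes the final inequality strict.\<close>
      define c where "c = e / (norm w ^ k + 1)"
      have c: "c > 0" using e(1) by (simp add: c_def add_nonneg_pos)
      have "\<forall>\<^sub>F N in sequentially. \<forall>x\<in>{- real m..real m}. cmod (exp_remainder w N x) < c"
        using uniform_limitD[OF exp_remainder_uniform c] by simp
      \<comment> \<open>For fixed k the shifted index N - k still tends to infinity.\<close>
      then have "\<forall>\<^sub>F N in sequentially. \<forall>x\<in>{- real m..real m}. cmod (exp_remainder w (N - k) x) < c"
        by (rule eventually_compose_filterlim[OF _ filterlim_minus_const_nat_at_top])
      then show "\<forall>\<^sub>F N in sequentially. \<forall>x\<in>{- real m..real m}. cmod (w ^ k * exp_remainder w (N - k) x) < e"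
      proof (rule eventually_mono, intro ballI)
        fix N x
        assume "\<forall>x\<in>{- real m..real m}. cmod (exp_remainder w (N - k) x) < c" "x \<in> {- real m..real m}"
        then have "cmod (exp_remainder w (N - k) x) < c" by blast
        then have "norm w ^ k * cmod (exp_remainder w (N - k) x) \<le> norm w ^ k * c"
          by (intro mult_left_mono) auto
        also have "\<dots> < (norm w ^ k + 1) * c" using c by (simp add: algebra_simps)
        also have "\<dots> = e" by (simp add: c_def add_nonneg_eq_0_iff)
        finally show "cmod (w ^ k * exp_remainder w (N - k) x) < e"
          by (simp add: norm_mult norm_power)
      qed
    qed
    then show "\<forall>\<^sub>F N in sequentially. dist (T (?S N)) (T ?e) < d"
    proof (rule eventually_mono)
      fix N
      assume *: "\<forall>k\<in>{..m}. \<forall>x\<in>{- real m..real m}. cmod (w ^ k * exp_remainder w (N - k) x) < e"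
      have "(vderiv ^^ k) (?S N) x - (vderiv ^^ k) ?e x = - (w ^ k * exp_remainder w (N - k) x)" for k x
        unfolding S_remainder[of N] using S[of N]
        by (simp add: vderivs_add exp_remainder_Cinf exp_remainder_vderivs)
      then have "?S N \<in> Cinf_nhd ?e m e"
        using * S[of N] by (simp add: Cinf_nhd_def norm_minus_cancel)
      then show "dist (T (?S N)) (T ?e) < d" using e(2) by (auto simp: dist_commute)
    qed
  qed
  then show ?thesis using S by (simp add: sums_def mult_ac)
qed

text \<open>A power series that converges at every point may be differentiated termwise everywhere.
  The moments of \<open>T\<close> enter only as its coefficients.\<close>

lemma E_real_exp_holomorphic:
  assumes T: "T \<in> E_real"
  shows "(\<lambda>w. T (\<lambda>x. exp (w * of_real x))) holomorphic_on UNIV"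
proof -
  let ?c = "\<lambda>k. T (\<lambda>x. of_real x ^ k) / fact k"
  have s: "(\<lambda>k. ?c k * w ^ k) sums T (\<lambda>x. exp (w * of_real x))" for w
    by (rule E_real_exp_sums[OF T])
  have "(\<lambda>w. T (\<lambda>x. exp (w * of_real x))) = (\<lambda>w. suminf (\<lambda>k. ?c k * w ^ k))"
    using s by (simp add: sums_iff fun_eq_iff)
  moreover have "((\<lambda>w. suminf (\<lambda>k. ?c k * w ^ k)) has_field_derivative (suminf (\<lambda>k. diffs ?c k * w ^ k))) (at w)" for w
    by (rule termdiffs_strong_converges_everywhere) (use s in \<open>auto simp: sums_iff\<close>)
  ultimately show ?thesis
    by (auto simp: holomorphic_on_def field_differentiable_def)
qed

section \<open>Module maps out of the enveloping algebra\<close>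

lemma free_alg_induct [case_names single add]:
  fixes p :: "'a free_alg"
  assumes single: "\<And>w r. Q (Poly_Mapping.single w r)" and add: "\<And>p q. Q p \<Longrightarrow> Q q \<Longrightarrow> Q (p + q)"
  shows "Q p"
proof (induction p rule: Poly_Mapping.update_induct)
  case const
  then show ?case using single[of 0 0] by simp
next
  case (update f a b)
  have "Poly_Mapping.update a b f = Poly_Mapping.single a b + f"
    using update(1)
    by (intro poly_mapping_eqI) (auto simp: lookup_update lookup_add lookup_single in_keys_iff when_def)
  then show ?case using update(3) by (simp add: single add)
qed


definition lin_ext :: "('a fword \<Rightarrow> 'c::real_vector) \<Rightarrow> 'a free_alg \<Rightarrow> 'c" where
  "lin_ext \<phi> p = (\<Sum>w\<in>Poly_Mapping.keys p. Poly_Mapping.lookup p w *\<^sub>R \<phi> w)"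

lemma lin_ext_superset:
  assumes "finite B" "Poly_Mapping.keys p \<subseteq> B"
  shows "lin_ext \<phi> p = (\<Sum>w\<in>B. Poly_Mapping.lookup p w *\<^sub>R \<phi> w)"
  unfolding lin_ext_def
  by (rule sum.mono_neutral_left) (use assms in \<open>auto simp: in_keys_iff\<close>)

lemma lin_ext_add: "lin_ext \<phi> (p + q) = lin_ext \<phi> p + lin_ext \<phi> q"
proof -
  let ?B = "Poly_Mapping.keys p \<union> Poly_Mapping.keys q"
  have "lin_ext \<phi> (p + q) = (\<Sum>w\<in>?B. Poly_Mapping.lookup (p + q) w *\<^sub>R \<phi> w)"
    by (rule lin_ext_superset) (auto simp: Poly_Mapping.keys_add)
  moreover have "lin_ext \<phi> p = (\<Sum>w\<in>?B. Poly_Mapping.lookup p w *\<^sub>R \<phi> w)"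
    by (rule lin_ext_superset) auto
  moreover have "lin_ext \<phi> q = (\<Sum>w\<in>?B. Poly_Mapping.lookup q w *\<^sub>R \<phi> w)"
    by (rule lin_ext_superset) auto
  ultimately show ?thesis by (simp add: lookup_add scaleR_add_left sum.distrib)
qed

lemma lin_ext_0: "lin_ext \<phi> 0 = 0"
  by (simp add: lin_ext_def)

lemma lin_ext_single: "lin_ext \<phi> (Poly_Mapping.single w r) = r *\<^sub>R \<phi> w"
  by (cases "r = 0") (simp_all add: lin_ext_def)

lemma lin_ext_const_mult: "lin_ext \<phi> (free_const r * p) = r *\<^sub>R lin_ext \<phi> p"
proof -
  have "Poly_Mapping.keys (free_const r * p) \<subseteq> Poly_Mapping.keys p"
    by (auto simp: in_keys_iff lookup_const_mult)
  then have "lin_ext \<phi> (free_const r * p) = (\<Sum>w\<in>Poly_Mapping.keys p. Poly_Mapping.lookup (free_const r * p) w *\<^sub>R \<phi> w)"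
    by (intro lin_ext_superset) auto
  then show ?thesis by (simp add: lin_ext_def lookup_const_mult scaleR_sum_right)
qed

lemma lin_ext_diff: "lin_ext \<phi> (p - q) = lin_ext \<phi> p - lin_ext \<phi> q"
  using lin_ext_add[of \<phi> "p - q" q] by simp

lemma lin_ext_fun_add: "lin_ext (\<lambda>w. \<phi> w + \<psi> w) p = lin_ext \<phi> p + lin_ext \<psi> p"
  by (simp add: lin_ext_def scaleR_add_right sum.distrib)

text \<open>Since \<open>\<phi>\<close> is an arbitrary function on words, the extension is not
  multiplicative. A product is instead expanded one factor at a time, with the words of the other
  factor kept as context.\<close>

lemma lin_ext_mult: "lin_ext \<phi> (p * q) = lin_ext (\<lambda>v. lin_ext (\<lambda>w. \<phi> (v + w)) q) p"
proof (induction p rule: free_alg_induct)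
  case (single v r)
  show ?case
  proof (induction q rule: free_alg_induct)
    case (single w s)
    show ?case by (simp add: mult_single lin_ext_single)
  next
    case (add f g)
    then show ?case by (simp add: distrib_left lin_ext_add lin_ext_fun_add)
  qed
next
  case (add f g)
  then show ?case by (simp add: distrib_right lin_ext_add)
qed

lemma lin_ext_gen: "lin_ext \<phi> (free_gen x) = \<phi> (FWord [x])"
  by (simp add: free_gen_def lin_ext_single)

lemma fword_plus: "FWord xs + FWord ys = FWord (xs @ ys)"
  by (simp add: plus_fword_def)

lemma lin_ext_gen2: "lin_ext \<phi> (free_gen x * free_gen y) = \<phi> (FWord [x, y])"
  by (simp add: free_gen_def mult_single fword_plus lin_ext_single)

text \<open>Expanding the outer factors of \<open>p * r * q\<close> into words leaves a single
  relator \<open>r\<close> between fixed words \<open>u\<close> and \<open>w\<close>; the three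
  hypotheses match the three kinds of relators in such a context.\<close>

lemma lin_ext_ideal:
  fixes \<phi> :: "('v::real_inner \<times> real) fword \<Rightarrow> 'c::real_vector"
  assumes add: "\<And>u w x y. \<phi> (u + FWord [x + y] + w) = \<phi> (u + FWord [x] + w) + \<phi> (u + FWord [y] + w)"
    and scale: "\<And>u w r x. \<phi> (u + FWord [r *\<^sub>R x] + w) = r *\<^sub>R \<phi> (u + FWord [x] + w)"
    and bracket: "\<And>u w p q x y. hc_homogeneous p x \<Longrightarrow> hc_homogeneous q y \<Longrightarrow>
      \<phi> (u + FWord [x, y] + w) - (-1) ^ (p * q) *\<^sub>R \<phi> (u + FWord [y, x] + w)
        = \<phi> (u + FWord [hc_bracket x y] + w)"
    and "p \<in> hc_ideal"
  shows "lin_ext \<phi> p = 0"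
  using \<open>p \<in> hc_ideal\<close>
proof induction
  case (gen r p q)
  have "lin_ext (\<lambda>v. \<phi> (u + v + w)) r = 0" for u w
    using gen
  proof cases
    case (add x y)
    then show ?thesis by (simp add: lin_ext_diff lin_ext_add lin_ext_gen assms(1))
  next
    case (scale s x)
    then show ?thesis by (simp add: lin_ext_diff lin_ext_const_mult lin_ext_gen assms(2))
  next
    case (bracket p x q y)
    \<comment> \<open>The sign of the bracket relator is a power of -1 in the free algebra; it must
      be recognised as a constant before linearity applies to it.\<close>
    have "free_const (- 1) = (- 1 :: ('v \<times> real) free_alg)"
      unfolding free_const_def single_uminus single_one ..
    then have eq: "(-1) ^ (p * q) * (free_gen y * free_gen x)
        = free_const ((-1) ^ (p * q)) * (free_gen y * free_gen x)"
      by (cases "even (p * q)") (simp_all add: free_const_1)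
    show ?thesis using assms(3)[OF bracket(2,3), of u w]
      by (simp add: bracket eq lin_ext_diff lin_ext_const_mult lin_ext_gen lin_ext_gen2)
  qed
  \<comment> \<open>The extension over the middle factor \<open>r\<close> is brought innermost,
    where it vanishes because both contexts are fixed.\<close>
  moreover have "lin_ext (\<lambda>u. lin_ext (\<lambda>v. lin_ext (\<lambda>w. \<phi> (u + v + w)) q) r) p
      = lin_ext (\<lambda>u. lin_ext (\<lambda>w. lin_ext (\<lambda>v. \<phi> (u + v + w)) r) q) p"
    (is "lin_ext ?f p = lin_ext ?g p")
  proof -
    have "?f = ?g"
      unfolding lin_ext_def scaleR_sum_right
      by (rule ext, subst sum.swap) (simp add: mult.commute)
    then show ?thesis by simp
  qed
  ultimately show ?case
    by (simp add: lin_ext_mult mult.assoc add.assoc) (simp add: lin_ext_def)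
qed (simp_all add: lin_ext_0 lin_ext_add)

section \<open>Generators and induction in the enveloping algebra\<close>

lift_definition hc_gen :: "'v::real_inner \<times> real \<Rightarrow> 'v hc_uea" is free_gen .

lemma hc_odd_gen: "hc_odd v = hc_gen (v, 0)"
  by transfer (simp add: hc_eq_def hc_ideal.zero)

lemma hc_z_gen: "hc_z = hc_gen (0, 1)"
  by transfer (simp add: hc_eq_def hc_ideal.zero)

lemma hc_relators_ideal: "r \<in> hc_relators \<Longrightarrow> r \<in> hc_ideal"
  using hc_ideal.gen[of r 1 1] by simp

lemma linear_hc_gen: "linear hc_gen"
proof
  show "hc_gen (x + y) = hc_gen x + hc_gen y" for x y :: "'a \<times> real"
    by transfer (simp only: hc_eq_def hc_relators_ideal hc_relators.add)
  show "hc_gen (r *\<^sub>R x) = r *\<^sub>R hc_gen x" for r and x :: "'a \<times> real"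
    by transfer (simp only: hc_eq_def hc_relators_ideal hc_relators.scale)
qed

text \<open>Orthonormality makes the sequence injective on its index range, so its image is an
  independent set with as many elements as the dimension, hence spanning.\<close>

lemma orthonormal_seq_expand:
  fixes a :: "nat \<Rightarrow> 'v::euclidean_space"
  assumes "orthonormal_seq a"
  shows "(\<Sum>j\<in>{1..DIM('v)}. inner v (a j) *\<^sub>R a j) = v"
proof -
  have o: "inner (a i) (a j) = (if i = j then 1 else 0)" if "i \<in> {1..DIM('v)}" "j \<in> {1..DIM('v)}" for i j
    using assms that by (auto simp: orthonormal_seq_def)
  let ?B = "a ` {1..DIM('v)}"
  have inj: "inj_on a {1..DIM('v)}"
    by (rule inj_onI) (metis o zero_neq_one)
  have po: "pairwise Linear_Algebra.orthogonal ?B"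
    using o by (auto simp: pairwise_def Linear_Algebra.orthogonal_def)
  have nz: "0 \<notin> ?B" using o by force
  have "independent ?B" by (rule pairwise_orthogonal_independent[OF po nz])
  then have "span ?B = UNIV"
    using card_ge_dim_independent[of ?B UNIV] card_image[OF inj] by (simp add: top.extremum_unique)
  then have "(\<Sum>b\<in>?B. inner v b *\<^sub>R b) = v"
    by (intro orthonormal_basis_expand po) (use o in \<open>auto simp: norm_eq_1\<close>)
  then show ?thesis by (simp only: sum.reindex[OF inj] comp_def)
qed

lemma orthonormal_seq_inner:
  fixes a :: "nat \<Rightarrow> 'v::euclidean_space"
  assumes "orthonormal_seq a"
  shows "inner u v = (\<Sum>j\<in>{1..DIM('v)}. inner u (a j) * inner v (a j))"
proof -
  have "inner u v = inner u (\<Sum>j\<in>{1..DIM('v)}. inner v (a j) *\<^sub>R a j)"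
    by (simp only: orthonormal_seq_expand[OF assms])
  then show ?thesis by (simp add: inner_sum_right mult.commute)
qed

lemma hc_gen_expand:
  fixes a :: "nat \<Rightarrow> 'v::euclidean_space"
  assumes "orthonormal_seq a"
  shows "hc_gen (v, r) = (\<Sum>j\<in>{1..DIM('v)}. inner v (a j) *\<^sub>R hc_odd (a j)) + r *\<^sub>R hc_z"
proof -
  have "(v, r) = (\<Sum>j\<in>{1..DIM('v)}. inner v (a j) *\<^sub>R (a j, 0)) + r *\<^sub>R (0, 1)"
    by (simp add: prod_eq_iff fst_sum snd_sum orthonormal_seq_expand[OF assms, of v, simplified])
  then show ?thesis
    by (simp add: linear_add[OF linear_hc_gen] linear_sum[OF linear_hc_gen]
        linear_scale[OF linear_hc_gen] hc_odd_gen hc_z_gen del: scaleR_Pair)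
qed

text \<open>Every class is represented by a linear combination of words, and a word arises from the
  unit by multiplying generators on the left.\<close>

lemma hc_uea_free_induct [case_names one add scale gen]:
  assumes one: "Q 1" and plus: "\<And>u v. Q u \<Longrightarrow> Q v \<Longrightarrow> Q (u + v)"
    and scale: "\<And>r u. Q u \<Longrightarrow> Q (r *\<^sub>R u)" and gen: "\<And>x u. Q u \<Longrightarrow> Q (hc_gen x * u)"
  shows "Q u"
proof -
  have word: "Q (abs_hc_uea (Poly_Mapping.single (FWord xs) 1))" for xs
  proof (induction xs)
    case Nil
    have "Poly_Mapping.single (FWord []) 1 = (1 :: ('a \<times> real) free_alg)"
      by (simp flip: zero_fword_def)
    then show ?case using one by (simp add: one_hc_uea.abs_eq)
  next
    case (Cons x xs)
    have "Poly_Mapping.single (FWord (x # xs)) (1::real)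
        = free_gen x * Poly_Mapping.single (FWord xs) 1"
      by (simp add: free_gen_def mult_single fword_plus)
    then show ?case using gen[OF Cons, of x] by (simp add: hc_gen.abs_eq times_hc_uea.abs_eq)
  qed
  have "Q (abs_hc_uea p)" for p
  proof (induction p rule: free_alg_induct)
    case (single w r)
    have "Poly_Mapping.single w r = free_const r * Poly_Mapping.single w 1"
      by (simp add: free_const_def mult_single)
    then show ?case
      using scale[OF word[of "letters w"], of r] by (simp add: scaleR_hc_uea.abs_eq)
  next
    case (add f g)
    then show ?case using plus by (simp flip: plus_hc_uea.abs_eq)
  qed
  then show ?thesis by (metis Quotient_abs_rep[OF Quotient_hc_uea])
qed

text \<open>Expanding a generator in the orthonormal basis leaves only the \<open>a j\<close> and z.
  The rule serves three ends: spanning by monomials, multiplicativity of the constructed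
  representation, and its uniqueness.\<close>

lemma hc_uea_induct [consumes 1, case_names one add scale odd z]:
  fixes a :: "nat \<Rightarrow> 'v::euclidean_space"
  assumes "orthonormal_seq a" and one: "Q 1" and add: "\<And>u v. Q u \<Longrightarrow> Q v \<Longrightarrow> Q (u + v)"
    and scale: "\<And>r u. Q u \<Longrightarrow> Q (r *\<^sub>R u)"
    and odd: "\<And>j u. j \<in> {1..DIM('v)} \<Longrightarrow> Q u \<Longrightarrow> Q (hc_odd (a j) * u)"
    and z: "\<And>u. Q u \<Longrightarrow> Q (hc_z * u)"
  shows "Q u"
proof (induction u rule: hc_uea_free_induct)
  case (gen x u)
  obtain v r where x: "x = (v, r)" by fastforce
  have "Q 0" using scale[OF one, of 0] by simp
  have "Q (\<Sum>j\<in>J. inner v (a j) *\<^sub>R (hc_odd (a j) * u))" if "J \<subseteq> {1..DIM('v)}" for J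
    using finite_subset[OF that finite_atLeastAtMost] that
    by (induction J rule: finite_induct) (auto intro!: \<open>Q 0\<close> add scale odd gen)
  from add[OF this[OF subset_refl] scale[OF z[OF gen], of r]] show ?case
    by (simp add: x hc_gen_expand[OF assms(1)] distrib_right sum_distrib_right)
qed (fact one, fact add, fact scale)

section \<open>Modules given by Clifford operators\<close>

definition linear_op :: "('k \<Rightarrow> complex) set \<Rightarrow> (('k \<Rightarrow> complex) \<Rightarrow> 'k \<Rightarrow> complex) \<Rightarrow> bool" where
  "linear_op S T \<longleftrightarrow> (\<forall>f\<in>S. T f \<in> S) \<and>
     (\<forall>f\<in>S. \<forall>g\<in>S. T (\<lambda>k. f k + g k) = (\<lambda>k. T f k + T g k)) \<and>
     (\<forall>r. \<forall>f\<in>S. T (\<lambda>k. r *\<^sub>R f k) = (\<lambda>k. r *\<^sub>R T f k))"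

lemma linear_opD:
  assumes "linear_op S T"
  shows "f \<in> S \<Longrightarrow> T f \<in> S"
    and "f \<in> S \<Longrightarrow> g \<in> S \<Longrightarrow> T (\<lambda>k. f k + g k) = (\<lambda>k. T f k + T g k)"
    and "f \<in> S \<Longrightarrow> T (\<lambda>k. r *\<^sub>R f k) = (\<lambda>k. r *\<^sub>R T f k)"
  using assms by (simp_all add: linear_op_def)

text \<open>A real subspace given as a set: smoothness and the dimension-dependent size of the
  matrices are conditions on functions, and operators such as \<open>vderiv\<close> are linear only
  where these hold.\<close>

locale fun_space =
  fixes S :: "('k \<Rightarrow> complex) set"
  assumes S_0: "(\<lambda>k. 0) \<in> S"
    and S_add: "f \<in> S \<Longrightarrow> g \<in> S \<Longrightarrow> (\<lambda>k. f k + g k) \<in> S"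
    and S_scale: "f \<in> S \<Longrightarrow> (\<lambda>k. r *\<^sub>R f k) \<in> S"
begin

lemma S_sum:
  assumes "finite J" "\<And>j. j \<in> J \<Longrightarrow> g j \<in> S"
  shows "(\<lambda>k. \<Sum>j\<in>J. c j *\<^sub>R g j k) \<in> S"
  using assms by (induction J rule: finite_induct) (simp_all add: S_0 S_add S_scale)

lemma linear_op_sum:
  assumes T: "linear_op S T" and "finite J" "\<And>j. j \<in> J \<Longrightarrow> g j \<in> S"
  shows "T (\<lambda>k. \<Sum>j\<in>J. c j *\<^sub>R g j k) = (\<lambda>k. \<Sum>j\<in>J. c j *\<^sub>R T (g j) k)"
  using assms(2,3)
proof (induction J rule: finite_induct)
  case empty
  have "T (\<lambda>k. 0 *\<^sub>R 0) = (\<lambda>k. 0 *\<^sub>R T (\<lambda>k. 0) k)"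
    by (rule linear_opD(3)[OF T S_0])
  then show ?case by simp
next
  case (insert x F)
  let ?h = "\<lambda>k. \<Sum>j\<in>F. c j *\<^sub>R g j k"
  have "?h \<in> S" "g x \<in> S" "(\<lambda>k. c x *\<^sub>R g x k) \<in> S"
    using insert by (auto intro!: S_sum S_scale)
  then have "T (\<lambda>k. c x *\<^sub>R g x k + ?h k) = (\<lambda>k. c x *\<^sub>R T (g x) k + T ?h k)"
    by (simp only: linear_opD(2,3)[OF T])
  then show ?case using insert by simp
qed

lemma linear_op_comp: "linear_op S T \<Longrightarrow> linear_op S T' \<Longrightarrow> linear_op S (\<lambda>f. T (T' f))"
  by (auto simp: linear_op_def)

lemma linear_op_foldr: "(\<And>x. linear_op S (\<rho> x)) \<Longrightarrow> linear_op S (foldr \<rho> xs)"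
proof (induction xs)
  case Nil
  then show ?case by (simp add: linear_op_def)
next
  case (Cons x xs)
  then show ?case using linear_op_comp[of "\<rho> x" "foldr \<rho> xs"] by (simp add: comp_def)
qed

lemma linear_op_combination:
  assumes "finite J" "\<And>j. j \<in> J \<Longrightarrow> linear_op S (T j)"
  shows "linear_op S (\<lambda>f k. \<Sum>j\<in>J. c j *\<^sub>R T j f k)"
  using assms unfolding linear_op_def
  by (auto intro!: S_sum simp: scaleR_add_right sum.distrib scaleR_sum_right mult.commute)

end

text \<open>Relations are required for basis vectors only; bilinearity extends them to all of
  \<open>'v \<times> real\<close> in \<open>rho_bracket\<close>.\<close>

locale clifford_module = fun_space S for S :: "('k \<Rightarrow> complex) set" +
  fixes a :: "nat \<Rightarrow> 'v::euclidean_space"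
    and A :: "nat \<Rightarrow> ('k \<Rightarrow> complex) \<Rightarrow> 'k \<Rightarrow> complex"
    and Z :: "('k \<Rightarrow> complex) \<Rightarrow> 'k \<Rightarrow> complex"
  assumes orthonormal: "orthonormal_seq a"
    and A_linear: "j \<in> {1..DIM('v)} \<Longrightarrow> linear_op S (A j)"
    and Z_linear: "linear_op S Z"
    and clifford: "i \<in> {1..DIM('v)} \<Longrightarrow> j \<in> {1..DIM('v)} \<Longrightarrow> f \<in> S \<Longrightarrow>
      A i (A j f) k + A j (A i f) k = (if i = j then 2 * Z f k else 0)"
    and central: "j \<in> {1..DIM('v)} \<Longrightarrow> f \<in> S \<Longrightarrow> Z (A j f) = A j (Z f)"
begin

text \<open>The basis is numbered from 1, so index 0 is free for z, and a general element acts
  through one sum over 0..n.\<close>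

abbreviation coord :: "'v \<times> real \<Rightarrow> nat \<Rightarrow> real" where
  "coord x j \<equiv> (if j = 0 then snd x else inner (fst x) (a j))"

abbreviation op :: "nat \<Rightarrow> ('k \<Rightarrow> complex) \<Rightarrow> 'k \<Rightarrow> complex" where
  "op j \<equiv> (if j = 0 then Z else A j)"

definition rho :: "'v \<times> real \<Rightarrow> ('k \<Rightarrow> complex) \<Rightarrow> 'k \<Rightarrow> complex" where
  "rho x f = (\<lambda>k. \<Sum>j\<in>{0..DIM('v)}. coord x j *\<^sub>R op j f k)"

lemma op_linear: "j \<in> {0..DIM('v)} \<Longrightarrow> linear_op S (op j)"
  using A_linear Z_linear by auto

lemma op_closed: "j \<in> {0..DIM('v)} \<Longrightarrow> f \<in> S \<Longrightarrow> op j f \<in> S"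
  by (rule linear_opD(1)[OF op_linear])

lemma rho_linear: "linear_op S (rho x)"
  unfolding rho_def by (intro linear_op_combination op_linear) auto

lemma rho_closed: "f \<in> S \<Longrightarrow> rho x f \<in> S"
  using rho_linear by (simp add: linear_op_def)

lemma rho_split: "rho x f k = snd x *\<^sub>R Z f k + (\<Sum>j\<in>{1..DIM('v)}. inner (fst x) (a j) *\<^sub>R A j f k)"
  by (simp add: rho_def sum.atLeast_Suc_atMost)

lemma rho_rho:
  assumes "f \<in> S"
  shows "rho x (rho y f) k
    = (\<Sum>i\<in>{0..DIM('v)}. \<Sum>j\<in>{0..DIM('v)}. (coord x i * coord y j) *\<^sub>R op i (op j f) k)"
proof -
  have "op i (rho y f) k = (\<Sum>j\<in>{0..DIM('v)}. coord y j *\<^sub>R op i (op j f) k)"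
    if "i \<in> {0..DIM('v)}" for i
    unfolding rho_def
    by (rule fun_cong[OF linear_op_sum[OF op_linear[OF that] finite_atLeastAtMost op_closed[OF _ assms]]])
  then show ?thesis
    by (subst rho_def) (simp add: scaleR_sum_right)
qed

text \<open>For two odd elements the symmetrised double sum collapses to its diagonal by the
  Clifford relations, and Parseval's identity turns the diagonal into the inner product. Otherwise
  one element is a multiple of z: its operator commutes with the others and the bracket is
  zero.\<close>

lemma rho_bracket:
  assumes f: "f \<in> S" and x: "hc_homogeneous p x" and y: "hc_homogeneous q y"
  shows "rho x (rho y f) k - (-1) ^ (p * q) *\<^sub>R rho y (rho x f) k = rho (hc_bracket x y) f k"
proof (cases "odd p \<and> odd q")
  case True
  let ?D = "{1..DIM('v)}"
  have xy: "snd x = 0" "snd y = 0" using x y True by (auto simp: hc_homogeneous_def)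
  let ?c = "\<lambda>i j. inner (fst x) (a i) * inner (fst y) (a j)"
  have 1: "rho u (rho v f) k = (\<Sum>i\<in>?D. \<Sum>j\<in>?D. (inner (fst u) (a i) * inner (fst v) (a j)) *\<^sub>R A i (A j f) k)"
    if "snd u = 0" "snd v = 0" for u v
    unfolding rho_rho[OF f] by (simp add: sum.atLeast_Suc_atMost that)
  have "rho x (rho y f) k + rho y (rho x f) k
      = (\<Sum>i\<in>?D. \<Sum>j\<in>?D. ?c i j *\<^sub>R A i (A j f) k) + (\<Sum>i\<in>?D. \<Sum>j\<in>?D. ?c i j *\<^sub>R A j (A i f) k)"
    unfolding 1[OF xy] 1[OF xy(2,1)] by (subst (4) sum.swap) (simp add: mult.commute)
  also have "\<dots> = (\<Sum>i\<in>?D. \<Sum>j\<in>?D. ?c i j *\<^sub>R (if i = j then 2 * Z f k else 0))"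
    unfolding sum.distrib[symmetric] scaleR_add_right[symmetric]
    by (intro sum.cong refl) (simp only: clifford[OF _ _ f])
  also have "\<dots> = (\<Sum>i\<in>?D. ?c i i *\<^sub>R (2 * Z f k))"
    by (intro sum.cong refl) (simp add: if_distrib[of "(*\<^sub>R) _"] cong: if_cong)
  also have "\<dots> = (2 * inner (fst x) (fst y)) *\<^sub>R Z f k"
    by (simp add: orthonormal_seq_inner[OF orthonormal, of "fst x" "fst y"] scaleR_sum_left
        scaleR_conv_of_real sum_distrib_left sum_distrib_right mult_ac)
  also have "\<dots> = rho (hc_bracket x y) f k"
    by (simp add: rho_split hc_bracket_def)
  finally show ?thesis using True by simp
next
  case False
  have *: "rho u (rho v f) k = rho v (rho u f) k" if "fst u = 0" for u v
    using that unfolding rho_rho[OF f]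
    by (simp add: sum.atLeast_Suc_atMost[of 0] central[OF _ f] mult.commute)
  have "rho x (rho y f) k = rho y (rho x f) k" "fst x = 0 \<or> fst y = 0"
    using False x y *[of x y] *[of y x] by (auto simp: hc_homogeneous_def split: if_splits)
  then show ?thesis using False
    by (auto simp: rho_split hc_bracket_def)
qed

text \<open>The orbit map of \<open>f0\<close>. It is defined on words, extended linearly to the
  free algebra, and descends to the quotient because the operators respect every relator inside
  every word.\<close>

theorem module_map:
  assumes f0: "f0 \<in> S"
  obtains \<Psi> :: "'v hc_uea \<Rightarrow> 'k \<Rightarrow> complex"
  where "\<And>k. linear (\<lambda>u. \<Psi> u k)" "\<And>u. \<Psi> u \<in> S" "\<Psi> 1 = f0"
    "\<And>j u. j \<in> {1..DIM('v)} \<Longrightarrow> \<Psi> (hc_odd (a j) * u) = A j (\<Psi> u)"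
    "\<And>u. \<Psi> (hc_z * u) = Z (\<Psi> u)"
proof -
  \<comment> \<open>The first letter of a word is applied last, so that prefixing a letter
    corresponds to applying its operator.\<close>
  define \<phi> where "\<phi> w = foldr rho (letters w) f0" for w :: "('v \<times> real) fword"
  have closed: "foldr rho xs f0 \<in> S" for xs
    by (induction xs) (simp_all add: f0 rho_closed)
  have \<phi>S: "\<phi> w \<in> S" for w by (simp add: \<phi>_def closed)
  have fold: "linear_op S (foldr rho xs)" for xs
    by (rule linear_op_foldr) (rule rho_linear)
  have ctx: "\<phi> (u + v + w) = foldr rho (letters u) (foldr rho (letters v) (\<phi> w))" for u v w
    by (simp add: \<phi>_def plus_fword_def)
  have ideal: "lin_ext (\<lambda>w. \<phi> w k) p = 0" if "p \<in> hc_ideal" for p k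
  proof (rule lin_ext_ideal[OF _ _ _ that])
    fix u w :: "('v \<times> real) fword" and x y :: "'v \<times> real" and r :: real and p q :: nat
    \<comment> \<open>One statement on two-term combinations serves all relators: additivity takes
      coefficients 1 and 1, scaling takes r and 0, the bracket takes 1 and minus the sign.\<close>
    have fold2: "foldr rho (letters u) (\<lambda>k. r *\<^sub>R f k + s *\<^sub>R g k) k
        = r *\<^sub>R foldr rho (letters u) f k + s *\<^sub>R foldr rho (letters u) g k"
      if "f \<in> S" "g \<in> S" for f g r s k
    proof -
      have "(\<lambda>k. r *\<^sub>R f k) \<in> S" "(\<lambda>k. s *\<^sub>R g k) \<in> S" using that S_scale by auto
      then show ?thesis by (simp only: linear_opD[OF fold] that)
    qed
    have "rho (x + y) (\<phi> w) = (\<lambda>k. 1 *\<^sub>R rho x (\<phi> w) k + 1 *\<^sub>R rho y (\<phi> w) k)"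
      by (rule ext) (simp add: rho_split inner_add_left scaleR_add_left sum.distrib)
    then show "\<phi> (u + FWord [x + y] + w) k = \<phi> (u + FWord [x] + w) k + \<phi> (u + FWord [y] + w) k"
      unfolding ctx using fold2[OF rho_closed[OF \<phi>S[of w], of x] rho_closed[OF \<phi>S[of w], of y], of 1 1]
      by simp
    have "rho (r *\<^sub>R x) (\<phi> w) = (\<lambda>k. r *\<^sub>R rho x (\<phi> w) k + 0 *\<^sub>R rho x (\<phi> w) k)"
      by (rule ext) (simp add: rho_split scaleR_add_right scaleR_sum_right)
    then show "\<phi> (u + FWord [r *\<^sub>R x] + w) k = r *\<^sub>R \<phi> (u + FWord [x] + w) k"
      unfolding ctx using fold2[OF rho_closed[OF \<phi>S[of w], of x] rho_closed[OF \<phi>S[of w], of x], of r 0]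
      by simp
    assume hom: "hc_homogeneous p x" "hc_homogeneous q y"
    have "rho (hc_bracket x y) (\<phi> w)
        = (\<lambda>k. 1 *\<^sub>R rho x (rho y (\<phi> w)) k + (- ((-1) ^ (p * q))) *\<^sub>R rho y (rho x (\<phi> w)) k)"
      using rho_bracket[OF \<phi>S hom] by (simp add: fun_eq_iff)
    then show "\<phi> (u + FWord [x, y] + w) k - (-1) ^ (p * q) *\<^sub>R \<phi> (u + FWord [y, x] + w) k
        = \<phi> (u + FWord [hc_bracket x y] + w) k"
      unfolding ctx
      using fold2[OF rho_closed[OF rho_closed[OF \<phi>S[of w], of y], of x]
          rho_closed[OF rho_closed[OF \<phi>S[of w], of x], of y], of 1 "- ((-1) ^ (p * q))"]
      by simp
  qed
  \<comment> \<open>Any representative gives the same value, since two of them differ by an element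
    of the ideal.\<close>
  define \<Psi> where "\<Psi> u k = lin_ext (\<lambda>w. \<phi> w k) (rep_hc_uea u)" for u k
  have \<Psi>: "\<Psi> (abs_hc_uea p) k = lin_ext (\<lambda>w. \<phi> w k) p" for p k
  proof -
    have "hc_eq (rep_hc_uea (abs_hc_uea p)) p"
      by (rule Quotient_rep_abs[OF Quotient_hc_uea]) (simp add: hc_eq_def hc_ideal.zero)
    then show ?thesis
      using ideal[of "rep_hc_uea (abs_hc_uea p) - p" k] by (simp add: \<Psi>_def hc_eq_def lin_ext_diff)
  qed
  have ex: "\<exists>p. u = abs_hc_uea p" for u :: "'v hc_uea"
    by (metis Quotient_abs_rep[OF Quotient_hc_uea])
  have lin: "linear (\<lambda>u. \<Psi> u k)" for k
  proof
    show "\<Psi> (u + v) k = \<Psi> u k + \<Psi> v k" for u v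
      using ex[of u] ex[of v] by (auto simp: plus_hc_uea.abs_eq \<Psi> lin_ext_add)
    show "\<Psi> (r *\<^sub>R u) k = r *\<^sub>R \<Psi> u k" for r u
      using ex[of u] by (auto simp: scaleR_hc_uea.abs_eq \<Psi> lin_ext_const_mult)
  qed
  have S: "\<Psi> u \<in> S" for u
  proof -
    have "\<Psi> u = (\<lambda>k. \<Sum>w\<in>Poly_Mapping.keys (rep_hc_uea u). Poly_Mapping.lookup (rep_hc_uea u) w *\<^sub>R \<phi> w k)"
      by (simp add: fun_eq_iff \<Psi>_def lin_ext_def)
    then show ?thesis using S_sum[OF finite_keys \<phi>S] by simp
  qed
  have one: "\<Psi> 1 = f0"
  proof
    show "\<Psi> 1 k = f0 k" for k
      by (simp add: one_hc_uea.abs_eq \<Psi> single_one[symmetric] lin_ext_single \<phi>_def zero_fword_def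
          del: single_one)
  qed
  have gen: "\<Psi> (hc_gen x * u) = rho x (\<Psi> u)" for x u
  proof
    fix k
    obtain p where u: "u = abs_hc_uea p" using ex by blast
    have "\<Psi> (hc_gen x * u) k = lin_ext (\<lambda>w. rho x (\<phi> w) k) p"
      by (simp add: u hc_gen.abs_eq times_hc_uea.abs_eq \<Psi> lin_ext_mult lin_ext_gen)
         (simp add: \<phi>_def plus_fword_def)
    also have "\<dots> = rho x (\<lambda>k. lin_ext (\<lambda>w. \<phi> w k) p) k"
      unfolding lin_ext_def linear_op_sum[OF rho_linear finite_keys \<phi>S] ..
    finally show "\<Psi> (hc_gen x * u) k = rho x (\<Psi> u) k"
      by (simp add: u \<Psi>[abs_def])
  qed
  show ?thesis
  proof (rule that[OF lin S one])
    show "\<Psi> (hc_z * u) = Z (\<Psi> u)" for u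
      by (rule ext) (simp add: hc_z_gen gen rho_split)
    fix j u
    assume j: "j \<in> {1..DIM('v)}"
    have "(\<Sum>i\<in>{1..DIM('v)}. inner (a j) (a i) *\<^sub>R A i (\<Psi> u) k)
        = (\<Sum>i\<in>{1..DIM('v)}. if i = j then A j (\<Psi> u) k else 0)" for k
      using orthonormal j by (intro sum.cong) (auto simp: orthonormal_seq_def)
    then show "\<Psi> (hc_odd (a j) * u) = A j (\<Psi> u)"
      using j by (simp add: fun_eq_iff hc_odd_gen gen rho_split)
  qed
qed

end

section \<open>Monomials and the components of a distribution\<close>

lemma vderiv_minus: "f \<in> Cinf \<Longrightarrow> vderiv (\<lambda>x. - f x) = (\<lambda>x. - vderiv f x)"
  using vderiv_cmult[of f "- 1"] by simp

text \<open>The sign of moving a_j from the right end of the monomial a_I leftwards past the factors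
  of larger index.\<close>

definition flip_sign :: "nat \<Rightarrow> nat \<Rightarrow> nat set \<Rightarrow> real" where
  "flip_sign n j I = (\<Prod>i\<in>{j<..n}. if i \<in> I then - 1 else 1)"

lemma flip_sign_square: "flip_sign n j I * flip_sign n j I = 1"
  unfolding flip_sign_def prod.distrib[symmetric] by (rule prod.neutral) simp

text \<open>The sign at j ignores changes at indices up to j, while by
  \<open>flip_sign_greater\<close> it is reversed by a change at a larger one. For i < j exactly one
  of the two signs therefore reacts to the other index, which is why the operators
  anticommute.\<close>

lemma flip_sign_le: "i \<le> j \<Longrightarrow> flip_sign n j (insert i I) = flip_sign n j I"
  "i \<le> j \<Longrightarrow> flip_sign n j (I - {i}) = flip_sign n j I"
  unfolding flip_sign_def by (auto intro!: prod.cong)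

lemma flip_sign_greater:
  assumes "j < i" "i \<le> n"
  shows "i \<notin> I \<Longrightarrow> flip_sign n j (insert i I) = - flip_sign n j I"
    and "i \<in> I \<Longrightarrow> flip_sign n j (I - {i}) = - flip_sign n j I"
proof -
  define r where "r J = (\<Prod>l\<in>{j<..n} - {i}. if l \<in> J then - 1 else 1 :: real)" for J
  have *: "flip_sign n j J = (if i \<in> J then - 1 else 1) * r (J - {i})" for J
  proof -
    have "flip_sign n j J = (if i \<in> J then - 1 else 1) * r J"
      unfolding flip_sign_def r_def by (rule prod.remove) (use assms in auto)
    moreover have "r J = r (J - {i})" unfolding r_def by (rule prod.cong) auto
    ultimately show ?thesis by simp
  qed
  show "i \<notin> I \<Longrightarrow> flip_sign n j (insert i I) = - flip_sign n j I"
    and "i \<in> I \<Longrightarrow> flip_sign n j (I - {i}) = - flip_sign n j I"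
    by (simp_all add: *[of I] *[of "insert i I"] *[of "I - {i}"])
qed

lemma flip_sign_above: "(\<And>i. i \<in> I \<Longrightarrow> i < j) \<Longrightarrow> flip_sign n j I = 1"
  unfolding flip_sign_def by (rule prod.neutral) force

text \<open>Uncurried to fit \<open>fun_space\<close>. The index runs over all sets of naturals, so
  inserting or removing an index never leaves the domain.\<close>

definition smooth_families :: "(nat set \<times> real \<Rightarrow> complex) set" where
  "smooth_families = {f. \<forall>I. (\<lambda>x. f (I, x)) \<in> Cinf}"

text \<open>If \<open>f (I, x) = F a\<^sub>I x\<close> for \<open>F\<close> in \<^const>\<open>Cinf_HC\<close>, then \<open>cliff_op n j f\<close> is the family
  belonging to the right translate \<open>u \<mapsto> F (u a\<^sub>j)\<close>.\<close>

definition cliff_op :: "nat \<Rightarrow> nat \<Rightarrow> (nat set \<times> real \<Rightarrow> complex) \<Rightarrow> nat set \<times> real \<Rightarrow> complex" where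
  "cliff_op n j f = (\<lambda>(I, x). flip_sign n j I *\<^sub>R
     (if j \<in> I then vderiv (\<lambda>y. f (I - {j}, y)) x else f (insert j I, x)))"

definition cliff_z :: "(nat set \<times> real \<Rightarrow> complex) \<Rightarrow> nat set \<times> real \<Rightarrow> complex" where
  "cliff_z f = (\<lambda>(I, x). vderiv (\<lambda>y. f (I, y)) x)"

lemma cliff_op_slice: "cliff_op n j f (I, x) = flip_sign n j I *\<^sub>R
     (if j \<in> I then vderiv (\<lambda>y. f (I - {j}, y)) x else f (insert j I, x))"
  by (simp add: cliff_op_def)

lemma smooth_familiesD: "f \<in> smooth_families \<Longrightarrow> (\<lambda>x. f (I, x)) \<in> Cinf"
  by (simp add: smooth_families_def)

lemma linear_cliff_op: "linear_op smooth_families (cliff_op n j)"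
  unfolding linear_op_def
proof (intro conjI ballI allI ext)
  fix f g :: "nat set \<times> real \<Rightarrow> complex" and r and k :: "nat set \<times> real"
  assume f: "f \<in> smooth_families"
  obtain I x where k: "k = (I, x)" by fastforce
  show "cliff_op n j f \<in> smooth_families"
    unfolding smooth_families_def
  proof (intro CollectI allI)
    fix I
    show "(\<lambda>x. cliff_op n j f (I, x)) \<in> Cinf"
      using smooth_familiesD[OF f] by (cases "j \<in> I") (simp_all add: cliff_op_slice Cinf_scaleR vderiv_in_Cinf)
  qed
  show "cliff_op n j (\<lambda>k. r *\<^sub>R f k) k = r *\<^sub>R cliff_op n j f k"
    using f by (simp add: k cliff_op_slice vderiv_scaleR smooth_familiesD)
  assume g: "g \<in> smooth_families"
  show "cliff_op n j (\<lambda>k. f k + g k) k = cliff_op n j f k + cliff_op n j g k"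
    using f g by (simp add: k cliff_op_slice vderiv_add smooth_familiesD scaleR_add_right)
qed

lemma linear_cliff_z: "linear_op smooth_families cliff_z"
  unfolding linear_op_def cliff_z_def
proof (intro conjI ballI allI ext)
  fix f g :: "nat set \<times> real \<Rightarrow> complex" and r and k :: "nat set \<times> real"
  assume f: "f \<in> smooth_families"
  show "(\<lambda>(I, x). vderiv (\<lambda>y. f (I, y)) x) \<in> smooth_families"
    using f by (auto simp: smooth_families_def intro!: vderiv_in_Cinf)
  show "(\<lambda>(I, x). vderiv (\<lambda>y. r *\<^sub>R f (I, y)) x) k = r *\<^sub>R (\<lambda>(I, x). vderiv (\<lambda>y. f (I, y)) x) k"
    using f by (cases k) (simp add: vderiv_scaleR smooth_familiesD)
  assume g: "g \<in> smooth_families"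
  show "(\<lambda>(I, x). vderiv (\<lambda>y. f (I, y) + g (I, y)) x) k
      = (\<lambda>(I, x). vderiv (\<lambda>y. f (I, y)) x) k + (\<lambda>(I, x). vderiv (\<lambda>y. g (I, y)) x) k"
    using f g by (cases k) (simp add: vderiv_add smooth_familiesD)
qed

text \<open>Of the two applications one inserts j and the other removes it with a derivative. Both
  carry the same sign, which therefore cancels.\<close>

lemma cliff_op_square:
  assumes f: "f \<in> smooth_families"
  shows "cliff_op n j (cliff_op n j f) k = cliff_z f k"
  using f flip_sign_square[of n j]
  by (cases k) (auto simp: cliff_op_slice cliff_z_def vderiv_scaleR smooth_familiesD flip_sign_le
      insert_absorb)

lemma cliff_op_anticommute:
  assumes f: "f \<in> smooth_families" and ij: "i < j" "j \<le> n"
  shows "cliff_op n i (cliff_op n j f) k + cliff_op n j (cliff_op n i f) k = 0"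
proof -
  obtain I x where k: "k = (I, x)" by fastforce
  have [simp]: "i \<noteq> j" "j \<noteq> i" using ij by auto
  have "I - {j} - {i} = I - {i} - {j}" by auto
  then show ?thesis
    using flip_sign_le[of i j n] flip_sign_greater[OF ij] ij
    by (simp add: k cliff_op_slice vderiv_scaleR vderiv_minus smooth_familiesD[OF f] vderiv_in_Cinf Cinf_scaleR
        insert_commute insert_Diff_if mult.commute)
qed

context
  fixes a :: "nat \<Rightarrow> 'v::euclidean_space"
  assumes orthonormal: "orthonormal_seq a"
begin

lemma clifford_module_families:
  "clifford_module smooth_families a (cliff_op DIM('v)) cliff_z"
proof
  show "(\<lambda>k. 0) \<in> smooth_families"
    by (simp add: smooth_families_def Cinf_const)
  show "(\<lambda>k. f k + g k) \<in> smooth_families" if "f \<in> smooth_families" "g \<in> smooth_families" for f g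
    using that by (simp add: smooth_families_def Cinf_add)
  show "(\<lambda>k. r *\<^sub>R f k) \<in> smooth_families" if "f \<in> smooth_families" for r f
    using that by (simp add: smooth_families_def Cinf_scaleR)
  show "cliff_op DIM('v) i (cliff_op DIM('v) j f) k + cliff_op DIM('v) j (cliff_op DIM('v) i f) k
      = (if i = j then 2 * cliff_z f k else 0)"
    if "i \<in> {1..DIM('v)}" "j \<in> {1..DIM('v)}" "f \<in> smooth_families" for i j f k
    using that cliff_op_square[of f "DIM('v)" j k] cliff_op_anticommute[of f i j "DIM('v)" k]
      cliff_op_anticommute[of f j i "DIM('v)" k]
    by (cases i j rule: linorder_cases) (simp_all add: add.commute)
  show "cliff_z (cliff_op DIM('v) j f) = cliff_op DIM('v) j (cliff_z f)"
    if "f \<in> smooth_families" for j f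
    using that by (auto simp: fun_eq_iff cliff_z_def cliff_op_slice vderiv_scaleR smooth_familiesD
        vderiv_in_Cinf)
qed (simp_all add: orthonormal linear_cliff_op linear_cliff_z)

section \<open>Monomials in the enveloping algebra\<close>

lemma hc_monom_empty: "hc_monom a {} = 1"
  by (simp add: hc_monom_def)

lemma hc_monom_insert_min:
  assumes "finite I" "\<forall>i\<in>I. j < i"
  shows "hc_monom a (insert j I) = hc_odd (a j) * hc_monom a I"
proof -
  have "j \<notin> I" using assms(2) by auto
  then have "sorted_list_of_set (insert j I) = j # sorted_list_of_set I"
    using assms by (simp add: sorted_list_of_set_insert insort_is_Cons less_imp_le)
  then show ?thesis by (simp add: hc_monom_def)
qed

text \<open>In the module of families, \<open>\<Psi> u (I, x)\<close> plays the role of F(a_I u)(x),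
  so F is recovered as the slice at the empty set. This is the independence half of a
  Poincare-Birkhoff-Witt theorem.\<close>

lemma Cinf_HC_extension:
  assumes f: "\<And>I. f I \<in> Cinf"
  obtains F where "F \<in> Cinf_HC" "\<And>I. I \<subseteq> {1..DIM('v)} \<Longrightarrow> F (hc_monom a I) = f I"
proof -
  interpret clifford_module smooth_families a "cliff_op DIM('v)" cliff_z
    by (rule clifford_module_families)
  have "(\<lambda>(I, x). f I x) \<in> smooth_families"
    using f by (simp add: smooth_families_def)
  from module_map[OF this] obtain \<Psi> :: "'v hc_uea \<Rightarrow> nat set \<times> real \<Rightarrow> complex"
    where \<Psi>: "\<And>k. linear (\<lambda>u. \<Psi> u k)" "\<And>u. \<Psi> u \<in> smooth_families" "\<Psi> 1 = (\<lambda>(I, x). f I x)"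
      "\<And>j u. j \<in> {1..DIM('v)} \<Longrightarrow> \<Psi> (hc_odd (a j) * u) = cliff_op DIM('v) j (\<Psi> u)"
      "\<And>u. \<Psi> (hc_z * u) = cliff_z (\<Psi> u)"
    by metis
  \<comment> \<open>The letters of the monomial are absorbed into the index set from the smallest
    on; since J lies below I, each is appended at the right end of a_J and every sign is 1.\<close>
  have monom: "\<Psi> (hc_monom a I) (J, x) = f (J \<union> I) x"
    if "finite I" "I \<subseteq> {1..DIM('v)}" "\<forall>j\<in>J. \<forall>i\<in>I. j < i" for I J x
    using that
  proof (induction I arbitrary: J rule: finite_linorder_min_induct)
    case empty
    then show ?case by (simp add: hc_monom_empty \<Psi>)
  next
    case (insert b A)
    have b: "b \<in> {1..DIM('v)}" "b \<notin> J" "flip_sign DIM('v) b J = 1"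
      using insert.prems by (auto intro!: flip_sign_above)
    have "\<Psi> (hc_monom a A) (insert b J, x) = f (insert b J \<union> A) x"
      using insert by auto
    then show ?case
      using insert b by (simp add: hc_monom_insert_min \<Psi>(4) cliff_op_slice)
  qed
  show ?thesis
  proof (rule that[of "\<lambda>u x. \<Psi> u ({}, x)"])
    show "(\<lambda>u x. \<Psi> u ({}, x)) \<in> Cinf_HC"
      unfolding Cinf_HC_def using \<Psi>(1) smooth_familiesD[OF \<Psi>(2)]
      by (auto simp: \<Psi>(5) cliff_z_def)
    show "(\<lambda>x. \<Psi> (hc_monom a I) ({}, x)) = f I" if "I \<subseteq> {1..DIM('v)}" for I
      using monom[of I "{}"] that by (auto intro: finite_subset)
  qed
qed

lemma hc_odd_square: "j \<in> {1..DIM('v)} \<Longrightarrow> hc_odd (a j) * hc_odd (a j) = hc_z"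
proof -
  assume "j \<in> {1..DIM('v)}"
  then have "2 *\<^sub>R (hc_odd (a j) * hc_odd (a j)) = 2 *\<^sub>R (hc_z :: 'v hc_uea)"
    using hc_odd_anticommute[of "a j" "a j"] orthonormal by (simp add: orthonormal_seq_def scaleR_2)
  then show ?thesis by (simp only: scaleR_cancel_left) simp
qed

lemma hc_odd_swap:
  assumes "i \<in> {1..DIM('v)}" "j \<in> {1..DIM('v)}" "i \<noteq> j"
  shows "hc_odd (a i) * hc_odd (a j) = - (hc_odd (a j) * hc_odd (a i))"
proof -
  have "inner (a i) (a j) = 0" using orthonormal assms by (simp add: orthonormal_seq_def)
  then show ?thesis using hc_odd_anticommute[of "a i" "a j"] by (simp add: eq_neg_iff_add_eq_0)
qed

text \<open>The factor a_j moves right past the smaller indices, with one sign each, until it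
  reaches its place or meets its own copy and squares to z. The total sign is left open, because
  only membership up to sign is used later.\<close>

lemma hc_odd_mult_monom:
  assumes j: "j \<in> {1..DIM('v)}" and "finite I" "I \<subseteq> {1..DIM('v)}"
  shows "if j \<in> I
    then hc_odd (a j) * hc_monom a I \<in> {hc_z * hc_monom a (I - {j}), - (hc_z * hc_monom a (I - {j}))}
    else hc_odd (a j) * hc_monom a I \<in> {hc_monom a (insert j I), - hc_monom a (insert j I)}"
  using assms(2,3)
proof (induction I rule: finite_linorder_min_induct)
  case empty
  then show ?case using hc_monom_insert_min[of "{}" j] by simp
next
  case (insert b A)
  have bA: "hc_monom a (insert b A) = hc_odd (a b) * hc_monom a A" "b \<notin> A"
    using insert by (auto simp: hc_monom_insert_min)
  consider "j < b" | "j = b" | "b < j" by linarith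
  then show ?case
  proof cases
    case 1
    then have "j \<notin> insert b A" using insert by auto
    moreover have "hc_monom a (insert j (insert b A)) = hc_odd (a j) * hc_monom a (insert b A)"
      by (rule hc_monom_insert_min) (use 1 insert in auto)
    ultimately show ?thesis by simp
  next
    case 2
    then have "hc_odd (a j) * hc_monom a (insert b A) = hc_z * hc_monom a A"
      using hc_odd_square[OF j] by (simp add: bA flip: mult.assoc)
    then show ?thesis using 2 bA by simp
  next
    case 3
    have "hc_odd (a j) * hc_monom a (insert b A) = - (hc_odd (a b) * (hc_odd (a j) * hc_monom a A))"
      using hc_odd_swap[of j b] insert.prems j 3 by (simp add: bA flip: mult.assoc)
    moreover have "hc_monom a (insert j (insert b A)) = hc_odd (a b) * hc_monom a (insert j A)"
      using hc_monom_insert_min[of "insert j A" b] insert 3 by (simp add: insert_commute)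
    moreover have "hc_z * hc_monom a (insert b A - {j}) = hc_odd (a b) * (hc_z * hc_monom a (A - {j}))"
      using hc_monom_insert_min[of "A - {j}" b] insert 3
      by (simp add: insert_Diff_if hc_z_commute_odd flip: mult.assoc)
    ultimately show ?thesis using insert 3 by (auto split: if_splits)
  qed
qed

lemma hc_monom_mult_disjoint:
  assumes "finite I" "I \<subseteq> {1..DIM('v)}" "J \<subseteq> {1..DIM('v)}" "I \<inter> J = {}"
  shows "hc_monom a I * hc_monom a J \<in> {hc_monom a (I \<union> J), - hc_monom a (I \<union> J)}"
  using assms
proof (induction I rule: finite_linorder_min_induct)
  case empty
  then show ?case by (simp add: hc_monom_empty)
next
  case (insert b A)
  have "hc_monom a (insert b A) * hc_monom a J = hc_odd (a b) * (hc_monom a A * hc_monom a J)"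
    using insert by (simp add: hc_monom_insert_min mult.assoc)
  moreover have "hc_monom a A * hc_monom a J \<in> {hc_monom a (A \<union> J), - hc_monom a (A \<union> J)}"
    using insert by simp
  moreover have "hc_odd (a b) * hc_monom a (A \<union> J)
      \<in> {hc_monom a (insert b (A \<union> J)), - hc_monom a (insert b (A \<union> J))}"
    using hc_odd_mult_monom[of b "A \<union> J"] insert by (auto simp: finite_subset[of J])
  ultimately show ?case by auto
qed

lemma Cinf_HC_linear: "F \<in> Cinf_HC \<Longrightarrow> linear (\<lambda>u. F u x)"
  by (simp add: Cinf_HC_def)

text \<open>Some F in \<open>Cinf_HC\<close> equals 1 on all monomials, whereas linearity forces it
  to vanish at 0.\<close>

lemma hc_monom_nonzero:
  assumes "I \<subseteq> {1..DIM('v)}"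
  shows "hc_monom a I \<noteq> 0"
proof
  assume "hc_monom a I = 0"
  moreover obtain F :: "'v hc_uea \<Rightarrow> real \<Rightarrow> complex"
    where "F \<in> Cinf_HC" "\<And>I. I \<subseteq> {1..DIM('v)} \<Longrightarrow> F (hc_monom a I) = (\<lambda>x. 1)"
    using Cinf_HC_extension[of "\<lambda>I x. 1"] Cinf_const by blast
  moreover have "F 0 0 = 0" using linear_0[OF Cinf_HC_linear] calculation by blast
  ultimately show False using assms by (metis zero_neq_one)
qed

text \<open>The description in \<open>hc_star\<close> is proper: one of the two candidates has
  product \<gamma> with a_I, and if both had, then 2\<gamma> = 0, against the nonvanishing of
  monomials.\<close>

lemma hc_star_cases:
  assumes "I \<subseteq> {1..DIM('v)}"
  shows "hc_star a I \<in> {hc_monom a ({1..DIM('v)} - I), - hc_monom a ({1..DIM('v)} - I)}"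
proof -
  let ?w = "hc_monom a ({1..DIM('v)} - I)" and ?g = "hc_monom a {1..DIM('v)}"
  have "I \<union> ({1..DIM('v)} - I) = {1..DIM('v)}" using assms by auto
  then have "hc_monom a I * ?w \<in> {?g, - ?g}"
    using hc_monom_mult_disjoint[of I "{1..DIM('v)} - I"] assms by (auto simp: finite_subset)
  moreover have "?g \<noteq> - ?g"
  proof
    assume "?g = - ?g"
    then have "?g + ?g = 0" using eq_neg_iff_add_eq_0 by blast
    then have "2 *\<^sub>R ?g = 0" by (simp add: scaleR_2)
    then show False using hc_monom_nonzero[OF subset_refl] by simp
  qed
  ultimately have "\<exists>!w. w \<in> {?w, - ?w} \<and> hc_monom a I * w = ?g"
    by (auto simp: minus_equation_iff[of _ ?g])
  from theI'[OF this] show ?thesis unfolding hc_star_def by blast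
qed

lemma hc_z_power_commute_odd: "hc_z ^ k * hc_odd v = hc_odd v * hc_z ^ k"
  by (rule power_commuting_commutes) (rule hc_z_commute_odd)

text \<open>The spanning half of a Poincare-Birkhoff-Witt theorem: the span contains the unit and is
  stable under left multiplication by z and, by \<open>hc_odd_mult_monom\<close>, by the
  a_j.\<close>

lemma hc_uea_span: "u \<in> span {hc_z ^ k * hc_monom a I |k I. I \<subseteq> {1..DIM('v)}}"
  using orthonormal
proof (induction u rule: hc_uea_induct)
  case one
  show ?case by (rule span_base, rule CollectI, rule exI[of _ 0], rule exI[of _ "{}"]) (simp add: hc_monom_empty)
next
  case (odd j u)
  let ?B = "{hc_z ^ k * hc_monom a I |k I. I \<subseteq> {1..DIM('v)}}"
  show ?case using odd(2)
  proof (induction rule: span_induct)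
    case base
    show ?case
      by (rule subspaceI) (auto simp: distrib_left intro: span_zero span_add span_scale)
  next
    case (step x)
    then obtain k I where x: "x = hc_z ^ k * hc_monom a I" and I: "I \<subseteq> {1..DIM('v)}" by blast
    have B: "hc_z ^ k * hc_monom a I \<in> span ?B" if "I \<subseteq> {1..DIM('v)}" for k I
      by (rule span_base) (use that in blast)
    have "I - {j} \<subseteq> {1..DIM('v)}" "insert j I \<subseteq> {1..DIM('v)}" using I odd by auto
    note this[THEN B]
    then have "hc_z ^ k * (hc_z * hc_monom a (I - {j})) \<in> span ?B" "hc_z ^ k * hc_monom a (insert j I) \<in> span ?B"
      using B[of "I - {j}" "Suc k"] I by (auto simp: power_commutes mult.assoc[symmetric])
    moreover have "hc_odd (a j) * x = hc_z ^ k * (hc_odd (a j) * hc_monom a I)"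
      by (simp add: x hc_z_power_commute_odd flip: mult.assoc)
    ultimately show ?case
      using hc_odd_mult_monom[OF odd(1) _ I] I
      by (auto simp: finite_subset[OF I] intro!: span_neg split: if_splits)
  qed
next
  case (z u)
  show ?case using z
  proof (induction rule: span_induct)
    case base
    show ?case
      by (rule subspaceI) (auto simp: distrib_left intro: span_zero span_add span_scale)
  next
    case (step x)
    then obtain k I where "x = hc_z ^ k * hc_monom a I" and "I \<subseteq> {1..DIM('v)}" by blast
    then have "hc_z * x = hc_z ^ Suc k * hc_monom a I" "I \<subseteq> {1..DIM('v)}" by (simp_all add: mult.assoc)
    then show ?case by (intro span_base) blast
  qed
qed (auto intro: span_add span_scale)

lemma Cinf_HC_z_power: "F \<in> Cinf_HC \<Longrightarrow> F (hc_z ^ k * u) = (vderiv ^^ k) (F u)"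
  by (induction k) (simp_all add: Cinf_HC_def mult.assoc)

text \<open>On z^k a_I the value is the k-th derivative of the value on a_I, so agreement on
  monomials spreads to a spanning set.\<close>

lemma Cinf_HC_eqI:
  assumes "F \<in> Cinf_HC" "G \<in> Cinf_HC"
    and "\<And>I. I \<subseteq> {1..DIM('v)} \<Longrightarrow> F (hc_monom a I) = G (hc_monom a I)"
  shows "F = G"
proof (intro ext)
  fix u x
  show "F u x = G u x"
    by (rule linear_eq_on_span[OF Cinf_HC_linear[OF assms(1)] Cinf_HC_linear[OF assms(2)] _ hc_uea_span[of u]])
       (auto simp: Cinf_HC_z_power assms)
qed

end

section \<open>Decomposition of a compactly supported distribution\<close>

lemma Cinf_HC_add:
  assumes "F \<in> Cinf_HC" "G \<in> Cinf_HC"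
  shows "(\<lambda>u x. F u x + G u x) \<in> Cinf_HC"
  using assms by (auto simp: Cinf_HC_def vderiv_add intro: Cinf_add linear_compose_add)

lemma Cinf_HC_cmult:
  assumes "F \<in> Cinf_HC"
  shows "(\<lambda>u x. c * F u x) \<in> Cinf_HC"
proof -
  have "linear (\<lambda>u. c * F u x)" for x
  proof -
    have lin: "linear (\<lambda>u. F u x)" using assms by (simp add: Cinf_HC_def)
    show ?thesis
      by (rule linearI) (simp_all add: linear_add[OF lin] linear_scale[OF lin] distrib_left)
  qed
  then show ?thesis using assms by (simp add: Cinf_HC_def vderiv_cmult Cinf_cmult)
qed

lemma E_HC_sum:
  assumes U: "U \<in> E_HC a" and "finite J" "\<And>j. j \<in> J \<Longrightarrow> F j \<in> Cinf_HC"
  shows "(\<lambda>u x. \<Sum>j\<in>J. F j u x) \<in> Cinf_HC \<and> U (\<lambda>u x. \<Sum>j\<in>J. F j u x) = (\<Sum>j\<in>J. U (F j))"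
  using assms(2,3)
proof (induction J rule: finite_induct)
  case empty
  have "(\<lambda>u x. 0) \<in> Cinf_HC"
    using vderiv_eqI[of "\<lambda>x. 0" "\<lambda>x. 0"] by (auto simp: Cinf_HC_def Cinf_const linear_zero)
  moreover have "U (\<lambda>u x. c * F u x) = c * U F" if "F \<in> Cinf_HC" for c F
    using U that by (simp add: E_HC_def)
  from this[of "\<lambda>u x. 0" 0] calculation have "U (\<lambda>u x. 0) = 0" by simp
  ultimately show ?case by simp
next
  case (insert j J)
  then have "U (\<lambda>u x. F j u x + (\<Sum>j\<in>J. F j u x)) = U (F j) + U (\<lambda>u x. \<Sum>j\<in>J. F j u x)"
    using U unfolding E_HC_def by simp
  then show ?case using insert Cinf_HC_add[of "F j"] by simp
qed

lemma E_real_scale: "T \<in> E_real \<Longrightarrow> (\<lambda>f. c * T f) \<in> E_real"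
proof -
  assume T: "T \<in> E_real"
  then have "continuous_map Cinf_top euclidean ((\<lambda>z. c * z) \<circ> T)"
    by (intro continuous_map_compose[of _ euclidean]) (auto simp: E_real_def intro!: continuous_intros)
  then show ?thesis using T by (simp add: E_real_def comp_def distrib_left mult_ac)
qed

text \<open>\<open>Cinf_HC\<close> is a finite direct sum of copies of \<open>Cinf\<close>.
  Composing \<open>U\<close> with the inclusion of each summand gives the components, up to a sign
  and passage to the complementary index set.\<close>

lemma hc_components_exist:
  fixes a :: "nat \<Rightarrow> 'v::euclidean_space"
  assumes a: "orthonormal_seq a" and U: "U \<in> E_HC a"
  shows "\<exists>T. (\<forall>I\<in>Pow {1..DIM('v)}. T I \<in> E_real) \<and>
     (\<forall>\<Phi>\<in>Cinf_HC. U \<Phi> = (\<Sum>I\<in>Pow {1..DIM('v)}.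
        (-1) ^ (card I * (DIM('v) - card I)) * T I (\<Phi> (hc_star a I))))"
proof -
  let ?D = "{1..DIM('v)}"
  \<comment> \<open>\<open>E J\<close> is the inclusion of the summand at a_J. Although picked by
    \<open>SOME\<close>, its value is determined by \<open>Cinf_HC_eqI\<close>, and this is what
    makes it linear in f.\<close>
  let ?P = "\<lambda>J f F. F \<in> Cinf_HC \<and> (\<forall>I\<subseteq>?D. F (hc_monom a I) = (if I = J then f else (\<lambda>x. 0)))"
  define E where "E J f = (SOME F. ?P J f F)" for J f
  have "?P J f (E J f)" if f: "f \<in> Cinf" for J f
    unfolding E_def
  proof (rule someI_ex[of "?P J f"])
    have "(if I = J then f else (\<lambda>x. 0)) \<in> Cinf" for I
      using f Cinf_const[of 0] by simp
    then show "\<exists>F. ?P J f F"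
      by (rule Cinf_HC_extension[OF a, where f = "\<lambda>I. if I = J then f else (\<lambda>x. 0)"]) blast
  qed
  then have E: "\<And>J f. f \<in> Cinf \<Longrightarrow> E J f \<in> Cinf_HC"
    "\<And>J f I. f \<in> Cinf \<Longrightarrow> I \<subseteq> ?D \<Longrightarrow> E J f (hc_monom a I) = (if I = J then f else (\<lambda>x. 0))"
    by blast+
  have E_add: "E J (\<lambda>x. f x + g x) = (\<lambda>u x. E J f u x + E J g u x)" if "f \<in> Cinf" "g \<in> Cinf" for J f g
    using that by (intro Cinf_HC_eqI[OF a]) (simp_all add: E Cinf_add Cinf_HC_add)
  have E_cmult: "E J (\<lambda>x. c * f x) = (\<lambda>u x. c * E J f u x)" if "f \<in> Cinf" for J f c
    using that by (intro Cinf_HC_eqI[OF a]) (simp_all add: E Cinf_cmult Cinf_HC_cmult)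
  have V: "(\<lambda>f. U (E J f)) \<in> E_real" for J
  proof -
    \<comment> \<open>The target carries the pullback of a product topology, so coordinates suffice;
      each is the identity or the constant 0.\<close>
    have "continuous_map Cinf_top (Cinf_HC_top a) (E J)"
      unfolding Cinf_HC_top_def
    proof (rule continuous_map_pullback')
      let ?R = "\<lambda>f. \<lambda>I\<in>Pow ?D. if I = J then f else (\<lambda>x. 0)"
      have comp: "continuous_map Cinf_top Cinf_top (\<lambda>f. if I = J then f else (\<lambda>x. 0))" for I
        using Cinf_const[of 0] by (cases "I = J") (auto simp: topspace_Cinf_top)
      have "continuous_map Cinf_top (product_topology (\<lambda>I. Cinf_top) (Pow ?D)) ?R"
        unfolding continuous_map_componentwise using comp by (auto simp del: split_paired_All)
      then show "continuous_map Cinf_top (product_topology (\<lambda>I. Cinf_top) (Pow ?D))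
          ((\<lambda>F. \<lambda>I\<in>Pow ?D. F (hc_monom a I)) \<circ> E J)"
        by (rule continuous_map_eq) (auto simp: topspace_Cinf_top E fun_eq_iff restrict_def)
      show "topspace Cinf_top \<subseteq> E J -` Cinf_HC"
        by (auto simp: topspace_Cinf_top E)
    qed
    then have "continuous_map Cinf_top euclidean (U \<circ> E J)"
      by (rule continuous_map_compose) (use U in \<open>simp add: E_HC_def\<close>)
    then show ?thesis
      using U unfolding E_HC_def E_real_def by (simp add: E_add E_cmult E(1) comp_def)
  qed
  have decompose: "U \<Phi> = (\<Sum>J\<in>Pow ?D. U (E J (\<Phi> (hc_monom a J))))" if \<Phi>: "\<Phi> \<in> Cinf_HC" for \<Phi>
  proof -
    have C: "\<Phi> u \<in> Cinf" for u using \<Phi> by (simp add: Cinf_HC_def)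
    have sum: "(\<lambda>u x. \<Sum>J\<in>Pow ?D. E J (\<Phi> (hc_monom a J)) u x) \<in> Cinf_HC \<and>
        U (\<lambda>u x. \<Sum>J\<in>Pow ?D. E J (\<Phi> (hc_monom a J)) u x) = (\<Sum>J\<in>Pow ?D. U (E J (\<Phi> (hc_monom a J))))"
      by (rule E_HC_sum[OF U]) (simp_all add: E C)
    have "\<Phi> = (\<lambda>u x. \<Sum>J\<in>Pow ?D. E J (\<Phi> (hc_monom a J)) u x)"
    proof (rule Cinf_HC_eqI[OF a \<Phi> conjunct1[OF sum]])
      fix I assume I: "I \<subseteq> ?D"
      have "(\<Sum>J\<in>Pow ?D. E J (\<Phi> (hc_monom a J)) (hc_monom a I) x)
          = (\<Sum>J\<in>Pow ?D. if J = I then \<Phi> (hc_monom a I) x else 0)" for x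
        by (rule sum.cong) (simp_all add: E(2)[OF C I])
      then show "\<Phi> (hc_monom a I) = (\<lambda>x. \<Sum>J\<in>Pow ?D. E J (\<Phi> (hc_monom a J)) (hc_monom a I) x)"
        using I by simp
    qed
    then show ?thesis using sum by simp
  qed
  \<comment> \<open>\<open>s I\<close> is the sign relating \<open>*a_I\<close> to the complementary
    monomial; its square being 1 lets it be shifted to the distribution.\<close>
  have "\<forall>I. \<exists>s::real. I \<subseteq> ?D \<longrightarrow> s * s = 1 \<and> hc_star a I = s *\<^sub>R hc_monom a (?D - I)"
    using hc_star_cases[OF a]
    by (intro allI, rule_tac x = "if hc_star a I = hc_monom a (?D - I) then 1 else - 1" in exI) auto
  then obtain s :: "nat set \<Rightarrow> real"
    where s: "\<And>I. I \<subseteq> ?D \<Longrightarrow> s I * s I = 1 \<and> hc_star a I = s I *\<^sub>R hc_monom a (?D - I)" by metis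
  \<comment> \<open>Both signs are built in so that they cancel against the prescribed sign and the
    one hidden in \<open>hc_star\<close>.\<close>
  define T where "T I f = ((-1) ^ (card I * (DIM('v) - card I)) * of_real (s I)) * U (E (?D - I) f)" for I f
  show ?thesis
  proof (intro exI[of _ T] conjI ballI)
    show "T I \<in> E_real" for I
      unfolding T_def[abs_def] by (rule E_real_scale) (rule V)
    fix \<Phi> :: "'v hc_uea \<Rightarrow> real \<Rightarrow> complex"
    assume \<Phi>: "\<Phi> \<in> Cinf_HC"
    have C: "\<Phi> u \<in> Cinf" for u using \<Phi> by (simp add: Cinf_HC_def)
    have "U \<Phi> = (\<Sum>J\<in>Pow ?D. U (E J (\<Phi> (hc_monom a J))))"
      by (rule decompose[OF \<Phi>])
    also have "\<dots> = (\<Sum>I\<in>Pow ?D. U (E (?D - I) (\<Phi> (hc_monom a (?D - I)))))"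
      by (rule sum.reindex_bij_witness[of _ "\<lambda>I. ?D - I" "\<lambda>I. ?D - I"]) (auto simp: double_diff)
    also have "\<dots> = (\<Sum>I\<in>Pow ?D. (-1) ^ (card I * (DIM('v) - card I)) * T I (\<Phi> (hc_star a I)))"
    proof (rule sum.cong[OF refl])
      fix I assume "I \<in> Pow ?D"
      then have I: "s I * s I = 1" "hc_star a I = s I *\<^sub>R hc_monom a (?D - I)" using s by auto
      have "\<Phi> (hc_star a I) = (\<lambda>x. of_real (s I) * \<Phi> (hc_monom a (?D - I)) x)"
        using linear_scale[OF Cinf_HC_linear[OF a \<Phi>]] by (auto simp: I(2) scaleR_conv_of_real)
      then have "T I (\<Phi> (hc_star a I)) = (-1) ^ (card I * (DIM('v) - card I))
          * of_real (s I * s I) * U (E (?D - I) (\<Phi> (hc_monom a (?D - I))))"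
        using E_real_cmult[OF V C] by (simp add: T_def)
      then show "U (E (?D - I) (\<Phi> (hc_monom a (?D - I)))) =
          (-1) ^ (card I * (DIM('v) - card I)) * T I (\<Phi> (hc_star a I))"
        by (simp add: I(1) flip: power_add mult.assoc mult_2)
    qed
    finally show "U \<Phi> = (\<Sum>I\<in>Pow ?D. (-1) ^ (card I * (DIM('v) - card I)) * T I (\<Phi> (hc_star a I)))" .
  qed
qed

lemma hc_components_E_real:
  fixes a :: "nat \<Rightarrow> 'v::euclidean_space"
  assumes "orthonormal_seq a" "U \<in> E_HC a" "I \<subseteq> {1..DIM('v)}"
  shows "hc_components a U I \<in> E_real"
  using someI_ex[OF hc_components_exist[OF assms(1,2)]] assms(3)
  unfolding hc_components_def by blast

section \<open>The Clifford matrices\<close>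

lemma sum_div_mod_mult:
  fixes f g :: "nat \<Rightarrow> 'a::comm_semiring_0"
  shows "(\<Sum>l<m * s. f (l div s) * g (l mod s)) = (\<Sum>a<m. f a) * (\<Sum>b<s. g b)"
proof -
  have "(\<Sum>l<m * s. f (l div s) * g (l mod s)) = (\<Sum>a<m. \<Sum>l\<in>{a * s..<a * s + s}. f (l div s) * g (l mod s))"
    by (rule sum.nat_group[symmetric])
  also have "\<dots> = (\<Sum>a<m. \<Sum>b<s. f a * g b)"
  proof (rule sum.cong[OF refl])
    fix a
    have "(\<Sum>l\<in>{0 + a * s..<s + a * s}. f (l div s) * g (l mod s))
        = (\<Sum>b\<in>{0..<s}. f ((b + a * s) div s) * g ((b + a * s) mod s))"
      by (rule sum.shift_bounds_nat_ivl)
    also have "\<dots> = (\<Sum>b<s. f a * g b)"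
      by (rule sum.cong) auto
    finally show "(\<Sum>l\<in>{a * s..<a * s + s}. f (l div s) * g (l mod s)) = (\<Sum>b<s. f a * g b)"
      by (simp add: add.commute)
  qed
  finally show ?thesis by (simp add: sum_product)
qed

lemma kron_carrier:
  "A \<in> carrier_mat n m \<Longrightarrow> B \<in> carrier_mat r s \<Longrightarrow> kron A B \<in> carrier_mat (n * r) (m * s)"
  by (auto simp: kron_def)

lemma kron_index:
  assumes "A \<in> carrier_mat n m" "B \<in> carrier_mat r s" "i < n * r" "j < m * s"
  shows "kron A B $$ (i, j) = A $$ (i div r, j div s) * B $$ (i mod r, j mod s)"
  using assms by (auto simp: kron_def)

lemma div_mod_less:
  assumes "i < n * (r::nat)"
  shows "i div r < n" "i mod r < r"
  using assms by (auto simp: less_mult_imp_div_less intro!: mod_less_divisor gr0I)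

text \<open>The inner index l encodes the pair (l div s, l mod s), and in these coordinates the sum
  over l factors into the two matrix products.\<close>

lemma kron_mult:
  assumes "A \<in> carrier_mat n m" "B \<in> carrier_mat r s" "C \<in> carrier_mat m p" "D \<in> carrier_mat s t"
  shows "kron A B * kron C D = kron (A * C) (B * D)"
proof (rule eq_matI)
  note K = kron_carrier[OF assms(1,2)] kron_carrier[OF assms(3,4)]
  have AC: "A * C \<in> carrier_mat n p" "B * D \<in> carrier_mat r t" using assms by auto
  note K' = kron_carrier[OF AC]
  show "dim_row (kron A B * kron C D) = dim_row (kron (A * C) (B * D))"
    "dim_col (kron A B * kron C D) = dim_col (kron (A * C) (B * D))"
    using K K' by auto
  fix i j
  assume "i < dim_row (kron (A * C) (B * D))" "j < dim_col (kron (A * C) (B * D))"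
  then have ij: "i < n * r" "j < p * t" using K' by auto
  note ij' = div_mod_less[OF ij(1)] div_mod_less[OF ij(2)]
  have "(kron A B * kron C D) $$ (i, j) = (\<Sum>l<m * s. kron A B $$ (i, l) * kron C D $$ (l, j))"
    using K ij by (simp add: scalar_prod_def lessThan_atLeast0)
  also have "\<dots> = (\<Sum>l<m * s. (A $$ (i div r, l div s) * C $$ (l div s, j div t)) *
      (B $$ (i mod r, l mod s) * D $$ (l mod s, j mod t)))"
    by (rule sum.cong) (auto simp: kron_index[OF assms(1,2) ij(1)] kron_index[OF assms(3,4) _ ij(2)])
  also have "\<dots> = (\<Sum>l<m. A $$ (i div r, l) * C $$ (l, j div t)) * (\<Sum>l<s. B $$ (i mod r, l) * D $$ (l, j mod t))"
    by (rule sum_div_mod_mult)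
  also have "\<dots> = kron (A * C) (B * D) $$ (i, j)"
    using assms ij' by (simp add: kron_index[OF AC ij] scalar_prod_def lessThan_atLeast0)
  finally show "(kron A B * kron C D) $$ (i, j) = kron (A * C) (B * D) $$ (i, j)" .
qed

lemma kron_add_right:
  assumes "A \<in> carrier_mat n m" "B \<in> carrier_mat r s" "C \<in> carrier_mat r s"
  shows "kron A (B + C) = kron A B + kron A C"
proof (rule eq_matI)
  have BC: "B + C \<in> carrier_mat r s" using assms by auto
  note K = kron_carrier[OF assms(1,2)] kron_carrier[OF assms(1,3)] kron_carrier[OF assms(1) BC]
  show "dim_row (kron A (B + C)) = dim_row (kron A B + kron A C)"
    "dim_col (kron A (B + C)) = dim_col (kron A B + kron A C)"
    using K by auto
  fix i j
  assume "i < dim_row (kron A B + kron A C)" "j < dim_col (kron A B + kron A C)"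
  then have ij: "i < n * r" "j < m * s" using K by auto
  then show "kron A (B + C) $$ (i, j) = (kron A B + kron A C) $$ (i, j)"
    using K assms div_mod_less[OF ij(1)] div_mod_less[OF ij(2)]
    by (simp add: kron_index[OF assms(1,2)] kron_index[OF assms(1,3)] kron_index[OF assms(1) BC] distrib_left)
qed

lemma kron_smult_right: "kron A (c \<cdot>\<^sub>m B) = c \<cdot>\<^sub>m kron A B"
proof (rule eq_matI)
  fix i j
  assume "i < dim_row (c \<cdot>\<^sub>m kron A B)" "j < dim_col (c \<cdot>\<^sub>m kron A B)"
  then have "i < dim_row A * dim_row B" "j < dim_col A * dim_col B" by (auto simp: kron_def)
  then show "kron A (c \<cdot>\<^sub>m B) $$ (i, j) = (c \<cdot>\<^sub>m kron A B) $$ (i, j)"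
    using div_mod_less[of i "dim_row A" "dim_row B"] div_mod_less[of j "dim_col A" "dim_col B"]
    by (simp add: kron_def)
qed (simp_all add: kron_def)

lemma kron_smult_left: "kron (c \<cdot>\<^sub>m A) B = c \<cdot>\<^sub>m kron A B"
proof (rule eq_matI)
  fix i j
  assume "i < dim_row (c \<cdot>\<^sub>m kron A B)" "j < dim_col (c \<cdot>\<^sub>m kron A B)"
  then have "i < dim_row A * dim_row B" "j < dim_col A * dim_col B" by (auto simp: kron_def)
  then show "kron (c \<cdot>\<^sub>m A) B $$ (i, j) = (c \<cdot>\<^sub>m kron A B) $$ (i, j)"
    using div_mod_less[of i "dim_row A" "dim_row B"] div_mod_less[of j "dim_col A" "dim_col B"]
    by (simp add: kron_def)
qed (simp_all add: kron_def)

lemma kron_add_left: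
  assumes "A \<in> carrier_mat n m" "B \<in> carrier_mat n m" "C \<in> carrier_mat r s"
  shows "kron (A + B) C = kron A C + kron B C"
proof (rule eq_matI)
  have AB: "A + B \<in> carrier_mat n m" using assms by auto
  note K = kron_carrier[OF assms(1,3)] kron_carrier[OF assms(2,3)] kron_carrier[OF AB assms(3)]
  show "dim_row (kron (A + B) C) = dim_row (kron A C + kron B C)"
    "dim_col (kron (A + B) C) = dim_col (kron A C + kron B C)"
    using K by auto
  fix i j
  assume "i < dim_row (kron A C + kron B C)" "j < dim_col (kron A C + kron B C)"
  then have ij: "i < n * r" "j < m * s" using K by auto
  then show "kron (A + B) C $$ (i, j) = (kron A C + kron B C) $$ (i, j)"
    using K assms div_mod_less[OF ij(1)] div_mod_less[OF ij(2)]
    by (simp add: kron_index[OF assms(1,3)] kron_index[OF assms(2,3)] kron_index[OF AB assms(3)] distrib_right)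
qed

lemma kron_one: "kron (1\<^sub>m n) (1\<^sub>m m) = 1\<^sub>m (n * m)"
proof (rule eq_matI)
  fix i j
  assume "i < dim_row (1\<^sub>m (n * m))" "j < dim_col (1\<^sub>m (n * m))"
  then have ij: "i < n * m" "j < n * m" by auto
  have "i = j \<longleftrightarrow> i div m = j div m \<and> i mod m = j mod m"
    by (metis div_mult_mod_eq)
  then show "kron (1\<^sub>m n) (1\<^sub>m m) $$ (i, j) = 1\<^sub>m (n * m) $$ (i, j)"
    using ij div_mod_less[OF ij(1)] div_mod_less[OF ij(2)] by (auto simp: kron_def)
qed (simp_all add: kron_def)

section \<open>The two-by-two factors and their tensor products\<close>

lemma mat_2_eqI:
  assumes "A \<in> carrier_mat 2 2" "B \<in> carrier_mat 2 2"
    and "A $$ (0, 0) = B $$ (0, 0)" "A $$ (0, Suc 0) = B $$ (0, Suc 0)"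
    "A $$ (Suc 0, 0) = B $$ (Suc 0, 0)" "A $$ (Suc 0, Suc 0) = B $$ (Suc 0, Suc 0)"
  shows "A = B"
  by (rule eq_matI) (use assms in \<open>auto simp: numeral_2_eq_2 less_Suc_eq\<close>)

definition XY_mat :: "complex \<Rightarrow> nat \<Rightarrow> complex mat" where
  "XY_mat \<zeta> m = (if odd m then X_mat \<zeta> else Y_mat \<zeta>)"

lemma small_mats_carrier [simp]:
  "sigma_mat \<in> carrier_mat 2 2" "X_mat \<zeta> \<in> carrier_mat 2 2" "Y_mat \<zeta> \<in> carrier_mat 2 2"
  "XY_mat \<zeta> m \<in> carrier_mat 2 2"
  by (auto simp: sigma_mat_def X_mat_def Y_mat_def XY_mat_def mat_of_rows_list_def)

lemma small_mats_index:
  "sigma_mat $$ (0, 0) = 1" "sigma_mat $$ (0, Suc 0) = 0"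
  "sigma_mat $$ (Suc 0, 0) = 0" "sigma_mat $$ (Suc 0, Suc 0) = - 1"
  "X_mat \<zeta> $$ (0, 0) = 0" "X_mat \<zeta> $$ (0, Suc 0) = \<zeta>"
  "X_mat \<zeta> $$ (Suc 0, 0) = 1" "X_mat \<zeta> $$ (Suc 0, Suc 0) = 0"
  "Y_mat \<zeta> $$ (0, 0) = 0" "Y_mat \<zeta> $$ (0, Suc 0) = \<i> * \<zeta>"
  "Y_mat \<zeta> $$ (Suc 0, 0) = - \<i>" "Y_mat \<zeta> $$ (Suc 0, Suc 0) = 0"
  by (simp_all add: sigma_mat_def X_mat_def Y_mat_def mat_of_rows_list_def)

lemma mult_2_index:
  assumes "A \<in> carrier_mat 2 2" "B \<in> carrier_mat 2 2" "i < 2" "j < 2"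
  shows "(A * B) $$ (i, j) = A $$ (i, 0) * B $$ (0, j) + A $$ (i, Suc 0) * B $$ (Suc 0, j)"
  using assms by (simp add: scalar_prod_def numeral_2_eq_2)

lemma sigma_sigma: "sigma_mat * sigma_mat = 1\<^sub>m 2"
  by (rule mat_2_eqI[OF mult_carrier_mat[OF small_mats_carrier(1,1)]])
     (simp_all add: mult_2_index small_mats_index del: index_mult_mat)

lemma sigma_XY: "sigma_mat * XY_mat \<zeta> m = (- 1) \<cdot>\<^sub>m (XY_mat \<zeta> m * sigma_mat)"
proof -
  have c: "sigma_mat * XY_mat \<zeta> m \<in> carrier_mat 2 2" "XY_mat \<zeta> m * sigma_mat \<in> carrier_mat 2 2"
    by (auto intro: mult_carrier_mat[of _ 2 2 _ 2])
  have s: "((- 1) \<cdot>\<^sub>m (XY_mat \<zeta> m * sigma_mat)) $$ (i, j) = - (XY_mat \<zeta> m * sigma_mat) $$ (i, j)"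
    if "i < 2" "j < 2" for i j
    by (subst index_smult_mat(1)) (use carrier_matD[OF c(2)] that in simp_all)
  show ?thesis
    by (rule mat_2_eqI[OF c(1) smult_carrier_mat[OF c(2)]],
        simp_all add: s mult_2_index small_mats_index del: index_mult_mat index_smult_mat)
       (simp_all add: XY_mat_def small_mats_index)
qed

lemma anticommutator_2:
  assumes A: "A \<in> carrier_mat 2 2" and B: "B \<in> carrier_mat 2 2"
    and "\<And>i j. i < 2 \<Longrightarrow> j < 2 \<Longrightarrow> A $$ (i, 0) * B $$ (0, j) + A $$ (i, Suc 0) * B $$ (Suc 0, j)
      + (B $$ (i, 0) * A $$ (0, j) + B $$ (i, Suc 0) * A $$ (Suc 0, j)) = (if i = j then c else (0 :: complex))"
  shows "A * B + B * A = c \<cdot>\<^sub>m 1\<^sub>m 2"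
proof (rule eq_matI)
  have AB: "A * B \<in> carrier_mat 2 2" "B * A \<in> carrier_mat 2 2" using A B by auto
  show "dim_row (A * B + B * A) = dim_row (c \<cdot>\<^sub>m 1\<^sub>m 2)" "dim_col (A * B + B * A) = dim_col (c \<cdot>\<^sub>m 1\<^sub>m 2)"
    using AB by auto
  fix i j
  assume "i < dim_row (c \<cdot>\<^sub>m 1\<^sub>m 2)" "j < dim_col (c \<cdot>\<^sub>m 1\<^sub>m 2)"
  then have ij: "i < 2" "j < 2" by auto
  have "(A * B + B * A) $$ (i, j) = (A * B) $$ (i, j) + (B * A) $$ (i, j)"
    by (rule index_add_mat(1)) (use AB ij in auto)
  then show "(A * B + B * A) $$ (i, j) = (c \<cdot>\<^sub>m 1\<^sub>m 2) $$ (i, j)"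
    using assms(3)[OF ij] ij by (simp add: mult_2_index[OF A B ij] mult_2_index[OF B A ij])
qed

lemma XY_XY:
  assumes "l \<in> {1, 2}" "m \<in> {1, 2}"
  shows "XY_mat \<zeta> l * XY_mat \<zeta> m + XY_mat \<zeta> m * XY_mat \<zeta> l = (if l = m then 2 * \<zeta> else 0) \<cdot>\<^sub>m 1\<^sub>m 2"
  using assms
  by (intro anticommutator_2)
     (auto simp: XY_mat_def small_mats_index less_2_cases_iff)

lemma kron_list_replicate_one: "kron_list (replicate k (1\<^sub>m 2)) = 1\<^sub>m (2 ^ k)"
  by (induction k) (simp_all add: kron_list_def kron_one)

lemma kron_list_Cons: "kron_list (M # Ms) = kron M (kron_list Ms)"
  by (simp add: kron_list_def)

lemma c_even_first: "m \<in> {1, 2} \<Longrightarrow> c_even (Suc k) \<zeta> m = kron (XY_mat \<zeta> m) (1\<^sub>m (2 ^ k))"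
  by (auto simp: c_even_def kron_list_Cons kron_list_replicate_one XY_mat_def)

text \<open>With \<open>c_even_first\<close> this peels off the first tensor factor, the recursion
  in k behind all facts on these matrices. The bound on m makes (m + 1) div 2 positive, so that the
  truncated exponent \<open>j - 1\<close> really grows by one.\<close>

lemma c_even_shift:
  assumes "m \<ge> 1"
  shows "c_even (Suc k) \<zeta> (Suc (Suc m)) = kron sigma_mat (c_even k \<zeta> m)"
proof -
  have "(Suc (Suc m) + 1) div 2 = Suc ((m + 1) div 2)" "(m + 1) div 2 \<ge> 1" using assms by auto
  then have "replicate ((Suc (Suc m) + 1) div 2 - 1) sigma_mat = sigma_mat # replicate ((m + 1) div 2 - 1) sigma_mat"
    by (cases "(m + 1) div 2") auto
  then show ?thesis
    using \<open>(Suc (Suc m) + 1) div 2 = Suc ((m + 1) div 2)\<close>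
    by (simp add: c_even_def kron_list_Cons Let_def)
qed

lemma c_even_cases:
  assumes "m \<in> {1..2 * Suc k}"
  obtains "m \<in> {1, 2}" | m' where "m = Suc (Suc m')" "m' \<in> {1..2 * k}"
proof (cases "m \<le> 2")
  case True
  then have "m \<in> {1, 2}" using assms by auto
  then show ?thesis by (rule that(1))
next
  case False
  then show ?thesis using assms by (intro that(2)[of "m - 2"]) auto
qed

lemma c_even_carrier: "m \<in> {1..2 * k} \<Longrightarrow> c_even k \<zeta> m \<in> carrier_mat (2 ^ k) (2 ^ k)"
proof (induction k arbitrary: m)
  case (Suc k)
  from Suc.prems show ?case
    by (rule c_even_cases)
       (use Suc.IH in \<open>auto simp: c_even_first c_even_shift simp del: One_nat_def intro!: kron_carrier[where n = 2 and m = 2]\<close>)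
qed simp

lemma kron_2_carrier:
  "A \<in> carrier_mat 2 2 \<Longrightarrow> B \<in> carrier_mat (2 ^ k) (2 ^ k) \<Longrightarrow> kron A B \<in> carrier_mat (2 ^ Suc k) (2 ^ Suc k)"
  using kron_carrier[of A 2 2 B "2 ^ k" "2 ^ k"] by simp

lemma add_uminus_smult_mat:
  "A \<in> carrier_mat n m \<Longrightarrow> A + (- 1 :: complex) \<cdot>\<^sub>m A = 0\<^sub>m n m"
  "A \<in> carrier_mat n m \<Longrightarrow> (- 1 :: complex) \<cdot>\<^sub>m A + A = 0\<^sub>m n m"
  by (rule eq_matI; auto)+

lemma zero_smult_one: "(0 :: complex) \<cdot>\<^sub>m 1\<^sub>m n = 0\<^sub>m n n"
  by (rule eq_matI) auto

text \<open>Two matrices of the first pair reduce to the two-by-two relations. Two later ones share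
  the factor \<sigma>, whose square is 1, and reduce to k. A mixed pair anticommutes since \<sigma>
  anticommutes with X and Y.\<close>

lemma c_even_clifford:
  "l \<in> {1..2 * k} \<Longrightarrow> m \<in> {1..2 * k} \<Longrightarrow>
    c_even k \<zeta> l * c_even k \<zeta> m + c_even k \<zeta> m * c_even k \<zeta> l = (if l = m then 2 * \<zeta> else 0) \<cdot>\<^sub>m 1\<^sub>m (2 ^ k)"
proof (induction k arbitrary: l m)
  case (Suc k)
  let ?N = "2 ^ k :: nat"
  have one: "1\<^sub>m ?N \<in> carrier_mat ?N ?N" by simp
  note km = kron_mult[of _ 2 2 _ ?N ?N _ 2 _ ?N]
  have mixed: "c_even (Suc k) \<zeta> l * c_even (Suc k) \<zeta> m + c_even (Suc k) \<zeta> m * c_even (Suc k) \<zeta> l = 0\<^sub>m (2 ^ Suc k) (2 ^ Suc k)"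
    if "l \<in> {1, 2}" "m = Suc (Suc m')" "m' \<in> {1..2 * k}" for l m m'
  proof -
    have c: "c_even k \<zeta> m' \<in> carrier_mat ?N ?N" using that by (simp add: c_even_carrier)
    have X: "XY_mat \<zeta> l * sigma_mat \<in> carrier_mat 2 2" by (rule mult_carrier_mat[of _ 2 2]) simp_all
    have 1: "c_even (Suc k) \<zeta> l = kron (XY_mat \<zeta> l) (1\<^sub>m ?N)" "c_even (Suc k) \<zeta> m = kron sigma_mat (c_even k \<zeta> m')"
      using that by (simp_all only: c_even_first) (simp_all add: c_even_shift)
    have "c_even (Suc k) \<zeta> l * c_even (Suc k) \<zeta> m = kron (XY_mat \<zeta> l * sigma_mat) (c_even k \<zeta> m')"
      unfolding 1 using c by (subst km) auto
    moreover have "c_even (Suc k) \<zeta> m * c_even (Suc k) \<zeta> l = (- 1) \<cdot>\<^sub>m kron (XY_mat \<zeta> l * sigma_mat) (c_even k \<zeta> m')"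
      unfolding 1 using c by (subst km) (auto simp: sigma_XY kron_smult_left)
    ultimately show ?thesis
      using kron_2_carrier[OF X c] by (simp only: add_uminus_smult_mat)
  qed
  from Suc.prems(1) show ?case
  proof (cases rule: c_even_cases)
    case l: 1
    from Suc.prems(2) show ?thesis
    proof (cases rule: c_even_cases)
      case m: 1
      have X: "XY_mat \<zeta> l * XY_mat \<zeta> m \<in> carrier_mat 2 2" "XY_mat \<zeta> m * XY_mat \<zeta> l \<in> carrier_mat 2 2"
        by (auto intro: mult_carrier_mat[of _ 2 2 _ 2])
      have "c_even (Suc k) \<zeta> l * c_even (Suc k) \<zeta> m + c_even (Suc k) \<zeta> m * c_even (Suc k) \<zeta> l
          = kron (XY_mat \<zeta> l * XY_mat \<zeta> m + XY_mat \<zeta> m * XY_mat \<zeta> l) (1\<^sub>m ?N)"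
        unfolding c_even_first[OF l] c_even_first[OF m] kron_add_left[OF X one]
        by (simp add: km)
      then show ?thesis by (simp add: XY_XY[OF l m] kron_smult_left kron_one)
    next
      case m: (2 m')
      then have "l \<noteq> m" using l by auto
      then show ?thesis using mixed[OF l m] by (simp add: zero_smult_one)
    qed
  next
    case l: (2 l')
    from Suc.prems(2) show ?thesis
    proof (cases rule: c_even_cases)
      case m: 1
      have "c_even (Suc k) \<zeta> l \<in> carrier_mat (2 ^ Suc k) (2 ^ Suc k)"
        "c_even (Suc k) \<zeta> m \<in> carrier_mat (2 ^ Suc k) (2 ^ Suc k)"
        using Suc.prems by (simp_all only: c_even_carrier)
      then have "c_even (Suc k) \<zeta> l * c_even (Suc k) \<zeta> m + c_even (Suc k) \<zeta> m * c_even (Suc k) \<zeta> l = 0\<^sub>m (2 ^ Suc k) (2 ^ Suc k)"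
        using mixed[OF m l] comm_add_mat[OF mult_carrier_mat mult_carrier_mat] by metis
      moreover have "l \<noteq> m" using l m by auto
      ultimately show ?thesis by (simp add: zero_smult_one)
    next
      case m: (2 m')
      have c: "c_even k \<zeta> l' \<in> carrier_mat ?N ?N" "c_even k \<zeta> m' \<in> carrier_mat ?N ?N"
        using l m by (simp_all add: c_even_carrier)
      then have c': "c_even k \<zeta> l' * c_even k \<zeta> m' \<in> carrier_mat ?N ?N" "c_even k \<zeta> m' * c_even k \<zeta> l' \<in> carrier_mat ?N ?N"
        by auto
      have "c_even (Suc k) \<zeta> l * c_even (Suc k) \<zeta> m + c_even (Suc k) \<zeta> m * c_even (Suc k) \<zeta> l
          = kron (1\<^sub>m 2) (c_even k \<zeta> l' * c_even k \<zeta> m' + c_even k \<zeta> m' * c_even k \<zeta> l')"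
        using l m c unfolding kron_add_right[OF one_carrier_mat c']
        by (simp add: c_even_shift km sigma_sigma)
      then show ?thesis using Suc.IH[OF l(2) m(2)] l m by (simp add: kron_smult_right kron_one)
    qed
  qed
qed simp

section \<open>The chirality matrix\<close>

lemma Gamma_mat_Suc: "Gamma_mat (Suc k) = kron sigma_mat (Gamma_mat k)"
  by (simp add: Gamma_mat_def kron_list_Cons)

lemma Gamma_mat_carrier: "Gamma_mat k \<in> carrier_mat (2 ^ k) (2 ^ k)"
proof (induction k)
  case 0
  show ?case by (simp add: Gamma_mat_def kron_list_def)
next
  case (Suc k)
  then show ?case unfolding Gamma_mat_Suc by (intro kron_2_carrier) simp_all
qed

lemma Gamma_mat_square: "Gamma_mat k * Gamma_mat k = 1\<^sub>m (2 ^ k)"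
proof (induction k)
  case 0
  show ?case by (simp add: Gamma_mat_def kron_list_def)
next
  case (Suc k)
  then show ?case
    using kron_mult[OF small_mats_carrier(1) Gamma_mat_carrier small_mats_carrier(1) Gamma_mat_carrier]
    by (simp add: Gamma_mat_Suc sigma_sigma kron_one)
qed

lemma Gamma_mat_c_even:
  "m \<in> {1..2 * k} \<Longrightarrow> Gamma_mat k * c_even k \<zeta> m = (- 1) \<cdot>\<^sub>m (c_even k \<zeta> m * Gamma_mat k)"
proof (induction k arbitrary: m)
  case (Suc k)
  note km = kron_mult[of _ 2 2 _ "2 ^ k" "2 ^ k" _ 2 _ "2 ^ k"]
  from Suc.prems show ?case
  proof (cases rule: c_even_cases)
    case 1
    then show ?thesis using Gamma_mat_carrier[of k]
      by (simp only: Gamma_mat_Suc c_even_first) (simp add: km sigma_XY kron_smult_left)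
  next
    case (2 m')
    then show ?thesis using Gamma_mat_carrier[of k] c_even_carrier[of m' k \<zeta>] Suc.IH[of m']
      by (simp add: Gamma_mat_Suc c_even_shift km sigma_sigma kron_smult_right)
  qed
qed simp

section \<open>The representations and the Fourier transform\<close>

lemma hc_H_iff: "P \<in> hc_H n \<longleftrightarrow> fst P \<in> carrier_mat (2 ^ (n div 2)) (2 ^ (n div 2))
    \<and> snd P \<in> carrier_mat (2 ^ (n div 2)) (2 ^ (n div 2))
    \<and> (even n \<longrightarrow> snd P = 0\<^sub>m (2 ^ (n div 2)) (2 ^ (n div 2)))"
  by (cases P) (auto simp: hc_H_def Let_def)

lemma hc_H_carrier:
  assumes "P \<in> hc_H n"
  shows "fst P \<in> carrier_mat (2 ^ (n div 2)) (2 ^ (n div 2))" "snd P \<in> carrier_mat (2 ^ (n div 2)) (2 ^ (n div 2))"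
  using assms by (simp_all add: hc_H_iff)

lemma smult_zero_mat: "c \<cdot>\<^sub>m 0\<^sub>m n m = (0\<^sub>m n m :: complex mat)"
  by (rule eq_matI) auto

lemma smult_smult_mat: "c \<cdot>\<^sub>m (d \<cdot>\<^sub>m A) = (c * d) \<cdot>\<^sub>m (A :: complex mat)"
  by (rule eq_matI) auto

lemma H_one_closed: "H_one n \<in> hc_H n"
  by (simp add: hc_H_iff H_one_def Let_def)

lemma H_add_closed: "P \<in> hc_H n \<Longrightarrow> Q \<in> hc_H n \<Longrightarrow> H_add P Q \<in> hc_H n"
  by (simp add: hc_H_iff H_add_def)

lemma H_scale_closed: "P \<in> hc_H n \<Longrightarrow> H_scale c P \<in> hc_H n"
  by (simp add: hc_H_iff H_scale_def smult_zero_mat)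

lemma H_mult_closed: "P \<in> hc_H n \<Longrightarrow> Q \<in> hc_H n \<Longrightarrow> H_mult \<zeta> P Q \<in> hc_H n"
  by (auto simp: hc_H_iff H_mult_def intro!: add_carrier_mat mult_carrier_mat)

lemma H_mult_one: "P \<in> hc_H n \<Longrightarrow> H_mult \<zeta> (H_one n) P = P" "P \<in> hc_H n \<Longrightarrow> H_mult \<zeta> P (H_one n) = P"
  by (auto simp: hc_H_iff H_mult_def H_one_def Let_def prod_eq_iff smult_zero_mat
      left_add_zero_mat right_add_zero_mat)

lemma H_mult_add_left:
  assumes "P \<in> hc_H n" "Q \<in> hc_H n" "R \<in> hc_H n"
  shows "H_mult \<zeta> (H_add P Q) R = H_add (H_mult \<zeta> P R) (H_mult \<zeta> Q R)"
proof -
  note c = assms[THEN hc_H_carrier(1)] assms[THEN hc_H_carrier(2)]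
  show ?thesis
    unfolding H_mult_def H_add_def prod_eq_iff fst_conv snd_conv
    by (intro conjI; rule eq_matI)
       (use c in \<open>auto simp: add_mult_distrib_mat[of _ "2 ^ (n div 2)" "2 ^ (n div 2)" _ _ "2 ^ (n div 2)"] distrib_left\<close>)
qed

lemma H_mult_add_right:
  assumes "P \<in> hc_H n" "Q \<in> hc_H n" "R \<in> hc_H n"
  shows "H_mult \<zeta> R (H_add P Q) = H_add (H_mult \<zeta> R P) (H_mult \<zeta> R Q)"
proof -
  note c = assms[THEN hc_H_carrier(1)] assms[THEN hc_H_carrier(2)]
  show ?thesis
    unfolding H_mult_def H_add_def prod_eq_iff fst_conv snd_conv
    by (intro conjI; rule eq_matI)
       (use c in \<open>auto simp: mult_add_distrib_mat[of _ "2 ^ (n div 2)" "2 ^ (n div 2)" _ "2 ^ (n div 2)"] distrib_left\<close>)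
qed

lemma H_mult_scale:
  assumes "P \<in> hc_H n" "Q \<in> hc_H n"
  shows "H_mult \<zeta> (H_scale c P) Q = H_scale c (H_mult \<zeta> P Q)"
    and "H_mult \<zeta> P (H_scale c Q) = H_scale c (H_mult \<zeta> P Q)"
proof -
  note c = assms[THEN hc_H_carrier(1)] assms[THEN hc_H_carrier(2)]
  note m = mult_smult_assoc_mat[of _ "2 ^ (n div 2)" "2 ^ (n div 2)" _ "2 ^ (n div 2)"]
    mult_smult_distrib[of _ "2 ^ (n div 2)" "2 ^ (n div 2)" _ "2 ^ (n div 2)"]
  show "H_mult \<zeta> (H_scale c P) Q = H_scale c (H_mult \<zeta> P Q)"
    and "H_mult \<zeta> P (H_scale c Q) = H_scale c (H_mult \<zeta> P Q)"
    unfolding H_mult_def H_scale_def prod_eq_iff fst_conv snd_conv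
    by (intro conjI; rule eq_matI; use c in \<open>auto simp: m algebra_simps\<close>)+
qed

lemma H_mult_assoc:
  assumes "P \<in> hc_H n" "Q \<in> hc_H n" "R \<in> hc_H n"
  shows "H_mult \<zeta> (H_mult \<zeta> P Q) R = H_mult \<zeta> P (H_mult \<zeta> Q R)"
proof -
  let ?N = "2 ^ (n div 2) :: nat"
  note c = assms[THEN hc_H_carrier(1)] assms[THEN hc_H_carrier(2)]
  note m = mult_smult_assoc_mat[of _ ?N ?N _ ?N] mult_smult_distrib[of _ ?N ?N _ ?N]
    add_mult_distrib_mat[of _ ?N ?N _ _ ?N] mult_add_distrib_mat[of _ ?N ?N _ ?N]
    assoc_mult_mat[of _ ?N ?N _ ?N _ ?N]
  show ?thesis
    unfolding H_mult_def prod_eq_iff fst_conv snd_conv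
    by (intro conjI; rule eq_matI)
       (use c in \<open>auto simp: m mult_carrier_mat[of _ ?N ?N] algebra_simps simp del: index_mult_mat(1)\<close>)
qed

lemma H_scale_scale: "H_scale c (H_scale d P) = H_scale (c * d) P"
  by (auto simp: H_scale_def prod_eq_iff intro!: eq_matI)

lemma H_scale_add:
  assumes "P \<in> hc_H n" "Q \<in> hc_H n"
  shows "H_add (H_scale c P) (H_scale c Q) = H_scale c (H_add P Q)"
  using hc_H_carrier[OF assms(1)] hc_H_carrier[OF assms(2)]
  by (auto simp: H_scale_def H_add_def prod_eq_iff algebra_simps intro!: eq_matI)

section \<open>Clifford relations of the representing elements\<close>

lemma c_rep_closed:
  assumes "m \<in> {1..n}"
  shows "c_rep n \<zeta> m \<in> hc_H n"
proof (cases "even n")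
  case True
  then have "2 * (n div 2) = n" by simp
  then have "c_even (n div 2) \<zeta> m \<in> carrier_mat (2 ^ (n div 2)) (2 ^ (n div 2))"
    using assms by (intro c_even_carrier) simp
  then show ?thesis using True by (simp add: c_rep_def hc_H_iff Let_def)
next
  case False
  then have n: "n = 2 * (n div 2) + 1" using odd_two_times_div_two_succ by metis
  have "c_even (n div 2) 1 (m - 1) \<in> carrier_mat (2 ^ (n div 2)) (2 ^ (n div 2))" if "m \<noteq> 1"
    using assms that n by (intro c_even_carrier) auto
  then show ?thesis using False Gamma_mat_carrier[of "n div 2"]
    by (auto simp: c_rep_def hc_H_iff Let_def intro!: smult_carrier_mat mult_carrier_mat)
qed

text \<open>For odd n all generators are multiples of \<epsilon> with coefficients independent of
  \<zeta>; the parameter appears in their products through \<epsilon>^2 = \<zeta>.\<close>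

lemma H_mult_eps:
  assumes "A \<in> carrier_mat N N" "B \<in> carrier_mat N N"
  shows "H_mult \<zeta> (0\<^sub>m N N, A) (0\<^sub>m N N, B) = (\<zeta> \<cdot>\<^sub>m (A * B), 0\<^sub>m N N)"
proof -
  have "A * B \<in> carrier_mat N N" using assms by simp
  then show ?thesis using assms by (simp add: H_mult_def)
qed

lemma c_rep_clifford:
  assumes lm: "l \<in> {1..n}" "m \<in> {1..n}"
  shows "H_add (H_mult \<zeta> (c_rep n \<zeta> l) (c_rep n \<zeta> m)) (H_mult \<zeta> (c_rep n \<zeta> m) (c_rep n \<zeta> l))
    = H_scale (if l = m then 2 * \<zeta> else 0) (H_one n)"
proof (cases "even n")
  case True
  let ?N = "2 ^ (n div 2) :: nat"
  have "2 * (n div 2) = n" using True by simp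
  then have i: "l \<in> {1..2 * (n div 2)}" "m \<in> {1..2 * (n div 2)}" using lm by simp_all
  note c = i[THEN c_even_carrier, of \<zeta>]
  have c': "c_even (n div 2) \<zeta> l * c_even (n div 2) \<zeta> m \<in> carrier_mat ?N ?N"
    "c_even (n div 2) \<zeta> m * c_even (n div 2) \<zeta> l \<in> carrier_mat ?N ?N"
    using c by (auto intro: mult_carrier_mat)
  show ?thesis
    using c c' c_even_clifford[OF i, of \<zeta>] True
    by (simp add: c_rep_def H_add_def H_mult_def H_scale_def H_one_def Let_def smult_zero_mat)
next
  case False
  define k N where "k = n div 2" and "N = (2 ^ k :: nat)"
  define G where "G = Gamma_mat k"
  define C where "C j = c_even k 1 j" for j
  \<comment> \<open>The coefficients of \<epsilon>. As \<Gamma> anticommutes with each C_j,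
    (\<Gamma> C_j)^2 = -1; the factor -\<i> corrects this, so that all of them square to 1.\<close>
  define M where "M j = (if j = 1 then G else (- \<i>) \<cdot>\<^sub>m (G * C (j - 1)))" for j
  have n: "n = 2 * k + 1" using False by (simp add: k_def)
  have G: "G \<in> carrier_mat N N" "G * G = 1\<^sub>m N"
    by (simp_all add: G_def N_def Gamma_mat_carrier Gamma_mat_square)
  have C: "C j \<in> carrier_mat N N" "G * C j = (- 1) \<cdot>\<^sub>m (C j * G)" if "j \<in> {1..2 * k}" for j
    unfolding C_def G_def N_def using that by (rule c_even_carrier, rule Gamma_mat_c_even)
  have CC: "C i * C j + C j * C i = (if i = j then 2 else 0) \<cdot>\<^sub>m 1\<^sub>m N" if "i \<in> {1..2 * k}" "j \<in> {1..2 * k}" for i j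
    using c_even_clifford[OF that, of 1] by (simp add: C_def N_def)
  note as = assoc_mult_mat[of _ N N _ N _ N]
  note sm = mult_smult_assoc_mat[of _ N N _ N] mult_smult_distrib[of _ N N _ N]
  have range: "i - 1 \<in> {1..2 * k}" if "i \<in> {1..n}" "i \<noteq> 1" for i using that n by auto
  have MC: "M j \<in> carrier_mat N N" if "j \<in> {1..n}" for j
    using G(1) C(1)[OF range[OF that]] by (auto simp: M_def)
  have GCG: "G * (C j * G) = (- 1) \<cdot>\<^sub>m C j" "G * (G * C j) = C j" "C j * (G * G) = C j"
    "(G * C j) * G = (- 1) \<cdot>\<^sub>m C j"
    if "j \<in> {1..2 * k}" for j
  proof -
    note c = C(1)[OF that]
    show 1: "G * (G * C j) = C j" using as[OF G(1) G(1) c] c by (simp add: G(2))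
    show 2: "C j * (G * G) = C j" using c by (simp add: G(2))
    show 3: "(G * C j) * G = (- 1) \<cdot>\<^sub>m C j"
      using as[OF c G(1) G(1)] 2 c G(1) by (simp add: C(2)[OF that] sm mult_carrier_mat[of _ N N])
    show "G * (C j * G) = (- 1) \<cdot>\<^sub>m C j" using as[OF G(1) c G(1)] 3 by simp
  qed
  have rel: "M i * M j + M j * M i = (if i = j then 2 else 0) \<cdot>\<^sub>m 1\<^sub>m N" if "i \<in> {1..n}" "j \<in> {1..n}" for i j
  proof -
    have mixed: "G * ((- \<i>) \<cdot>\<^sub>m (G * C j)) = (- \<i>) \<cdot>\<^sub>m C j" "((- \<i>) \<cdot>\<^sub>m (G * C j)) * G = \<i> \<cdot>\<^sub>m C j"
      if "j \<in> {1..2 * k}" for j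
      using G(1) C(1)[OF that] GCG[OF that] by (simp_all add: sm smult_smult_mat mult_carrier_mat[of _ N N])
    have zero: "(- \<i>) \<cdot>\<^sub>m A + \<i> \<cdot>\<^sub>m A = 0\<^sub>m N N" "\<i> \<cdot>\<^sub>m A + (- \<i>) \<cdot>\<^sub>m A = 0\<^sub>m N N" if "A \<in> carrier_mat N N" for A
      using that by (auto intro!: eq_matI)
    \<comment> \<open>The sign from moving \<Gamma> past C_i cancels (-\<i>)^2 = -1, so these
      products are those of the even case.\<close>
    have CC': "((- \<i>) \<cdot>\<^sub>m (G * C i)) * ((- \<i>) \<cdot>\<^sub>m (G * C j)) = C i * C j"
      if "i \<in> {1..2 * k}" "j \<in> {1..2 * k}" for i j
    proof -
      note ci = C(1)[OF that(1)] and cj = C(1)[OF that(2)]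
      have "(G * C i) * (G * C j) = ((G * C i) * G) * C j"
        by (rule as[symmetric]) (use G ci cj in auto)
      also have "\<dots> = (- 1) \<cdot>\<^sub>m (C i * C j)"
        unfolding GCG(4)[OF that(1)] using ci cj by (simp add: sm)
      finally have *: "(G * C i) * (G * C j) = (- 1) \<cdot>\<^sub>m (C i * C j)" .
      have "((- \<i>) \<cdot>\<^sub>m (G * C i)) * ((- \<i>) \<cdot>\<^sub>m (G * C j)) = (- \<i>) \<cdot>\<^sub>m ((- \<i>) \<cdot>\<^sub>m ((G * C i) * (G * C j)))"
        using G(1) ci cj by (simp only: sm mult_carrier_mat[of _ N N] smult_carrier_mat)
      also have "\<dots> = C i * C j"
        unfolding * using ci cj by (auto intro!: eq_matI)
      finally show ?thesis .
    qed
    have two: "1\<^sub>m N + 1\<^sub>m N = (2 :: complex) \<cdot>\<^sub>m 1\<^sub>m N" by (rule eq_matI) auto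
    show ?thesis
    proof (cases "i = 1"; cases "j = 1")
      assume "i = 1" "j = 1"
      then show ?thesis by (simp add: M_def G two)
    next
      assume ij: "i = 1" "j \<noteq> 1"
      then show ?thesis
        using mixed[OF range[OF that(2) ij(2)]] zero[OF C(1)[OF range[OF that(2) ij(2)]]]
        by (simp add: M_def zero_smult_one)
    next
      assume ij: "i \<noteq> 1" "j = 1"
      then show ?thesis
        using mixed[OF range[OF that(1) ij(1)]] zero[OF C(1)[OF range[OF that(1) ij(1)]]]
        by (simp add: M_def zero_smult_one)
    next
      assume ij: "i \<noteq> 1" "j \<noteq> 1"
      have "i - 1 = j - 1 \<longleftrightarrow> i = j" using ij that by auto
      moreover note r = range[OF that(1) ij(1)] range[OF that(2) ij(2)]
      ultimately show ?thesis
        using CC[OF r] by (simp only: M_def ij if_False CC'[OF r] CC'[OF r(2,1)])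
    qed
  qed
  have c_rep: "c_rep n \<zeta> j = (0\<^sub>m N N, M j)" for j
    using False by (simp add: c_rep_def M_def G_def C_def N_def k_def Let_def)
  have MM: "M l * M m \<in> carrier_mat N N" "M m * M l \<in> carrier_mat N N"
    using MC[OF lm(1)] MC[OF lm(2)] by auto
  have "\<zeta> \<cdot>\<^sub>m (M l * M m) + \<zeta> \<cdot>\<^sub>m (M m * M l) = \<zeta> \<cdot>\<^sub>m (M l * M m + M m * M l)"
    by (rule add_smult_distrib_left_mat[symmetric, OF MM])
  also have "\<dots> = (if l = m then 2 * \<zeta> else 0) \<cdot>\<^sub>m 1\<^sub>m N"
    unfolding rel[OF lm] by (rule eq_matI) auto
  finally have "\<zeta> \<cdot>\<^sub>m (M l * M m) + \<zeta> \<cdot>\<^sub>m (M m * M l) = (if l = m then 2 * \<zeta> else 0) \<cdot>\<^sub>m 1\<^sub>m N" .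
  moreover have "H_one n = (1\<^sub>m N, 0\<^sub>m N N)" by (simp add: H_one_def N_def k_def Let_def)
  ultimately show ?thesis
    unfolding c_rep H_mult_eps[OF MC[OF lm(1)] MC[OF lm(2)]] H_mult_eps[OF MC[OF lm(2)] MC[OF lm(1)]]
    by (simp add: H_add_def H_scale_def smult_zero_mat)
qed

section \<open>Existence and uniqueness of the representation\<close>

definition H_coords :: "nat \<Rightarrow> hc_mats \<Rightarrow> bool \<times> nat \<times> nat \<Rightarrow> complex" where
  "H_coords n P = (\<lambda>(b, ij). if fst ij < 2 ^ (n div 2) \<and> snd ij < 2 ^ (n div 2)
     then (if b then fst P else snd P) $$ ij else 0)"

definition H_of_coords :: "nat \<Rightarrow> (bool \<times> nat \<times> nat \<Rightarrow> complex) \<Rightarrow> hc_mats" where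
  "H_of_coords n f = (let N = 2 ^ (n div 2) in
     (Matrix.mat N N (\<lambda>ij. f (True, ij)), Matrix.mat N N (\<lambda>ij. f (False, ij))))"

text \<open>Passing to entries turns matrix pairs into complex-valued functions, the form that
  \<open>module_map\<close> demands. Entries out of range are set to 0, so that sums and multiples
  are pointwise everywhere.\<close>

lemma H_of_coords_coords: "P \<in> hc_H n \<Longrightarrow> H_of_coords n (H_coords n P) = P"
  by (auto simp: H_of_coords_def H_coords_def hc_H_iff Let_def prod_eq_iff intro!: eq_matI)

lemma H_coords_add:
  "P \<in> hc_H n \<Longrightarrow> Q \<in> hc_H n \<Longrightarrow> H_coords n (H_add P Q) = (\<lambda>k. H_coords n P k + H_coords n Q k)"
  by (auto simp: H_coords_def H_add_def hc_H_iff fun_eq_iff)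

lemma H_coords_scale:
  "P \<in> hc_H n \<Longrightarrow> H_coords n (H_scale c P) = (\<lambda>k. c * H_coords n P k)"
  by (auto simp: H_coords_def H_scale_def hc_H_iff fun_eq_iff)

lemma H_coords_zero: "H_coords n (H_scale 0 (H_one n)) = (\<lambda>k. 0)"
  by (simp add: H_coords_scale H_one_closed)

definition dpi_gen :: "nat \<Rightarrow> complex \<Rightarrow> nat \<Rightarrow> hc_mats" where
  "dpi_gen n \<zeta> j = H_scale (exp (\<i> * pi / 4)) (c_rep n \<zeta> j)"

lemma dpi_gen_closed: "j \<in> {1..n} \<Longrightarrow> dpi_gen n \<zeta> j \<in> hc_H n"
  by (simp add: dpi_gen_def H_scale_closed c_rep_closed del: atLeastAtMost_iff)

text \<open>The scalar exp(\<i> pi / 4) has square \<i>, which turns \<zeta> into \<i> \<zeta>, the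
  image of z.\<close>

lemma dpi_gen_clifford:
  assumes "i \<in> {1..n}" "j \<in> {1..n}"
  shows "H_add (H_mult \<zeta> (dpi_gen n \<zeta> i) (dpi_gen n \<zeta> j)) (H_mult \<zeta> (dpi_gen n \<zeta> j) (dpi_gen n \<zeta> i))
    = H_scale (if i = j then 2 * (\<i> * \<zeta>) else 0) (H_one n)"
proof -
  note c = assms[THEN c_rep_closed, of \<zeta>]
  let ?e = "exp (\<i> * pi / 4)"
  have "?e * ?e = \<i>"
    using cis_mult[of "pi / 4" "pi / 4"] cis_pi_half by (simp add: cis_conv_exp mult_ac)
  moreover have "H_add (H_mult \<zeta> (dpi_gen n \<zeta> i) (dpi_gen n \<zeta> j)) (H_mult \<zeta> (dpi_gen n \<zeta> j) (dpi_gen n \<zeta> i))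
    = H_scale (?e * ?e) (H_add (H_mult \<zeta> (c_rep n \<zeta> i) (c_rep n \<zeta> j)) (H_mult \<zeta> (c_rep n \<zeta> j) (c_rep n \<zeta> i)))"
    using c by (simp add: dpi_gen_def H_mult_scale[of _ n] H_scale_closed H_scale_scale H_scale_add[of _ n] H_mult_closed)
  ultimately show ?thesis
    by (simp add: c_rep_clifford[OF assms] H_scale_scale) (auto simp: mult_ac)
qed

definition dpi_spec :: "(nat \<Rightarrow> 'v::euclidean_space) \<Rightarrow> complex \<Rightarrow> ('v hc_uea \<Rightarrow> hc_mats) \<Rightarrow> bool" where
  "dpi_spec a \<zeta> h \<longleftrightarrow> H_alg_hom \<zeta> h \<and>
    (\<forall>j\<in>{1..DIM('v)}. h (hc_odd (a j)) = dpi_gen DIM('v) \<zeta> j) \<and>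
    h hc_z = H_scale (\<i> * \<zeta>) (H_one DIM('v))"

text \<open>The generators act by left multiplication, and the orbit map of the unit is the required
  homomorphism.\<close>

lemma dpi_spec_exists:
  fixes a :: "nat \<Rightarrow> 'v::euclidean_space"
  assumes a: "orthonormal_seq a"
  shows "\<exists>h. dpi_spec a \<zeta> h"
proof -
  let ?n = "DIM('v)"
  define S where "S = H_coords ?n ` hc_H ?n"
  define A where "A j f = H_coords ?n (H_mult \<zeta> (dpi_gen ?n \<zeta> j) (H_of_coords ?n f))" for j f
  define Z where "Z f = H_coords ?n (H_scale (\<i> * \<zeta>) (H_of_coords ?n f))" for f
  have A: "A j (H_coords ?n P) = H_coords ?n (H_mult \<zeta> (dpi_gen ?n \<zeta> j) P)" if "P \<in> hc_H ?n" for j P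
    using that by (simp add: A_def H_of_coords_coords)
  have Z: "Z (H_coords ?n P) = H_coords ?n (H_scale (\<i> * \<zeta>) P)" if "P \<in> hc_H ?n" for P
    using that by (simp add: Z_def H_of_coords_coords)
  \<comment> \<open>Transports linearity of an operation \<open>L\<close> on matrix pairs to the
    corresponding operator on coordinates.\<close>
  have linear: "linear_op S T"
    if T: "\<And>P. P \<in> hc_H ?n \<Longrightarrow> T (H_coords ?n P) = H_coords ?n (L P)"
      and L: "\<And>P. P \<in> hc_H ?n \<Longrightarrow> L P \<in> hc_H ?n"
      "\<And>P Q. P \<in> hc_H ?n \<Longrightarrow> Q \<in> hc_H ?n \<Longrightarrow> L (H_add P Q) = H_add (L P) (L Q)"
      "\<And>P c. P \<in> hc_H ?n \<Longrightarrow> L (H_scale c P) = H_scale c (L P)" for T L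
    unfolding linear_op_def S_def
    using T L
    by (auto simp: H_coords_add[symmetric] H_coords_scale[symmetric] H_add_closed H_scale_closed scaleR_conv_of_real)
  interpret clifford_module S a A Z
  proof
    show "(\<lambda>k. 0) \<in> S"
      unfolding S_def H_coords_zero[of ?n, symmetric] by (intro imageI H_scale_closed H_one_closed)
    show "(\<lambda>k. f k + g k) \<in> S" if "f \<in> S" "g \<in> S" for f g
      using that by (auto simp: S_def H_coords_add[symmetric] H_add_closed)
    show "(\<lambda>k. r *\<^sub>R f k) \<in> S" if "f \<in> S" for r f
      using that by (auto simp: S_def H_coords_scale[symmetric] scaleR_conv_of_real H_scale_closed)
    show "orthonormal_seq a" by (rule a)
    show "linear_op S (A j)" if "j \<in> {1..?n}" for j
      using dpi_gen_closed[OF that, of \<zeta>]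
      by (intro linear[where L = "H_mult \<zeta> (dpi_gen ?n \<zeta> j)"])
         (simp_all add: A H_mult_closed H_mult_add_right[of _ ?n] H_mult_scale(2)[of _ ?n])
    show "linear_op S Z"
      by (intro linear[where L = "H_scale (\<i> * \<zeta>)"])
         (simp_all add: Z H_scale_closed H_scale_add[of _ ?n] H_scale_scale mult.commute)
    fix i j f
    assume j: "j \<in> {1..?n}" and "f \<in> S"
    then obtain P where P: "f = H_coords ?n P" "P \<in> hc_H ?n" unfolding S_def by blast
    note gj = dpi_gen_closed[OF j, of \<zeta>]
    show "Z (A j f) = A j (Z f)"
      using P gj by (simp add: A Z H_mult_closed H_scale_closed H_mult_scale(2)[of _ ?n])
    assume i: "i \<in> {1..?n}"
    note gi = dpi_gen_closed[OF i, of \<zeta>]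
    fix k
    have "A i (A j f) k + A j (A i f) k = H_coords ?n (H_mult \<zeta> (H_add
        (H_mult \<zeta> (dpi_gen ?n \<zeta> i) (dpi_gen ?n \<zeta> j)) (H_mult \<zeta> (dpi_gen ?n \<zeta> j) (dpi_gen ?n \<zeta> i))) P) k"
      using P gi gj by (simp add: A H_mult_closed H_mult_add_left[of _ ?n] H_coords_add H_mult_assoc[of _ ?n])
    also have "\<dots> = (if i = j then 2 * Z f k else 0)"
      unfolding dpi_gen_clifford[OF i j]
      using P by (simp add: Z H_mult_scale(1)[of _ ?n] H_one_closed H_mult_one H_coords_scale)
    finally show "A i (A j f) k + A j (A i f) k = (if i = j then 2 * Z f k else 0)" .
  qed
  have "H_coords ?n (H_one ?n) \<in> S" by (simp add: S_def H_one_closed)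
  from module_map[OF this] obtain \<Psi> :: "'v hc_uea \<Rightarrow> bool \<times> nat \<times> nat \<Rightarrow> complex"
    where \<Psi>: "\<And>k. linear (\<lambda>u. \<Psi> u k)" "\<And>u. \<Psi> u \<in> S" "\<Psi> 1 = H_coords ?n (H_one ?n)"
      "\<And>j u. j \<in> {1..?n} \<Longrightarrow> \<Psi> (hc_odd (a j) * u) = A j (\<Psi> u)"
      "\<And>u. \<Psi> (hc_z * u) = Z (\<Psi> u)"
    by metis
  define h where "h u = H_of_coords ?n (\<Psi> u)" for u
  have h: "h u \<in> hc_H ?n" "\<Psi> u = H_coords ?n (h u)" for u
    using \<Psi>(2)[of u] by (auto simp: S_def h_def H_of_coords_coords)
  have h_eqI: "h u = P" if "\<Psi> u = H_coords ?n P" "P \<in> hc_H ?n" for u P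
    using that by (simp add: h_def H_of_coords_coords)
  have add: "h (u + v) = H_add (h u) (h v)" for u v
    by (rule h_eqI) (simp_all add: H_add_closed h(1) H_coords_add h(2)[symmetric] fun_eq_iff linear_add[OF \<Psi>(1)])
  have scale: "h (r *\<^sub>R u) = H_scale (of_real r) (h u)" for r u
  proof (rule h_eqI)
    have "\<Psi> (r *\<^sub>R u) k = of_real r * \<Psi> u k" for k
      unfolding linear_scale[OF \<Psi>(1)] by (rule scaleR_conv_of_real)
    then show "\<Psi> (r *\<^sub>R u) = H_coords ?n (H_scale (of_real r) (h u))"
      by (simp add: h(1) H_coords_scale h(2)[symmetric] fun_eq_iff)
  qed (simp add: H_scale_closed h(1))
  have one: "h 1 = H_one ?n" by (rule h_eqI) (simp_all add: \<Psi>(3) H_one_closed)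
  have odd: "h (hc_odd (a j) * u) = H_mult \<zeta> (dpi_gen ?n \<zeta> j) (h u)" if "j \<in> {1..?n}" for j u
    using that dpi_gen_closed[OF that, of \<zeta>] h(1)[of u]
    by (intro h_eqI) (simp_all only: \<Psi>(4) h(2)[of u] A H_mult_closed)
  have z: "h (hc_z * u) = H_scale (\<i> * \<zeta>) (h u)" for u
    using h(1)[of u] by (intro h_eqI) (simp_all only: \<Psi>(5) h(2)[of u] Z H_scale_closed)
  \<comment> \<open>The module map controls only left multiplication by generators; induction on the
    left factor, with associativity in the target, extends this to all products.\<close>
  have mult: "h (u * v) = H_mult \<zeta> (h u) (h v)" for u v
    using a
  proof (induction u rule: hc_uea_induct)
    case one
    then show ?case using h by (simp add: \<open>h 1 = H_one ?n\<close> H_mult_one)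
  next
    case (add u u')
    then show ?case
      using h by (simp add: distrib_right \<open>\<And>u v. h (u + v) = H_add (h u) (h v)\<close> H_mult_add_left[of _ ?n])
  next
    case (scale r u)
    then show ?case
      using h by (simp add: \<open>\<And>r u. h (r *\<^sub>R u) = H_scale (of_real r) (h u)\<close> H_mult_scale[of _ ?n])
  next
    case (odd j u)
    then show ?case
      using h dpi_gen_closed[OF odd(1), of \<zeta>]
      by (simp only: mult.assoc \<open>\<And>j u. j \<in> {1..?n} \<Longrightarrow> h (hc_odd (a j) * u) = H_mult \<zeta> (dpi_gen ?n \<zeta> j) (h u)\<close>
          H_mult_assoc[of _ ?n])
  next
    case (z u)
    then show ?case
      using h by (simp add: mult.assoc \<open>\<And>u. h (hc_z * u) = H_scale (\<i> * \<zeta>) (h u)\<close> H_mult_scale[of _ ?n])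
  qed
  have "dpi_spec a \<zeta> h"
    unfolding dpi_spec_def H_alg_hom_def
    using odd[of _ 1] z[of 1] dpi_gen_closed[of _ ?n \<zeta>] by (auto simp: h(1) add scale mult one H_mult_one)
  then show ?thesis by (intro exI[of _ h])
qed

text \<open>A homomorphism is fixed by its values on the a_j and z, so the description defining
  \<open>dpi\<close> has a unique solution.\<close>

lemma dpi_spec_dpi:
  fixes a :: "nat \<Rightarrow> 'v::euclidean_space"
  assumes a: "orthonormal_seq a"
  shows "dpi_spec a \<zeta> (dpi a \<zeta>)"
proof -
  obtain h where h: "dpi_spec a \<zeta> h" using dpi_spec_exists[OF a] by blast
  have "h' = h" if h': "dpi_spec a \<zeta> h'" for h'
  proof
    fix u
    show "h' u = h u"
      using a by (induction u rule: hc_uea_induct) (use h h' in \<open>auto simp: dpi_spec_def H_alg_hom_def\<close>)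
  qed
  with h have "dpi_spec a \<zeta> (THE h. dpi_spec a \<zeta> h)" by (rule theI)
  then show ?thesis by (simp add: dpi_def dpi_spec_def dpi_gen_def)
qed

section \<open>Entire matrix-valued functions\<close>

definition mat_entire :: "nat \<Rightarrow> (complex \<Rightarrow> complex mat) \<Rightarrow> bool" where
  "mat_entire N M \<longleftrightarrow> (\<forall>\<zeta>. M \<zeta> \<in> carrier_mat N N) \<and>
     (\<forall>i<N. \<forall>j<N. (\<lambda>\<zeta>. M \<zeta> $$ (i, j)) holomorphic_on UNIV)"

lemma mat_entire_const: "A \<in> carrier_mat N N \<Longrightarrow> mat_entire N (\<lambda>\<zeta>. A)"
  by (simp add: mat_entire_def)

lemma mat_entire_dim: "mat_entire N A \<Longrightarrow> dim_row (A \<zeta>) = N" "mat_entire N A \<Longrightarrow> dim_col (A \<zeta>) = N"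
  unfolding mat_entire_def by (blast dest: carrier_matD)+

lemma mat_entire_index:
  "mat_entire N A \<Longrightarrow> i < N \<Longrightarrow> j < N \<Longrightarrow> (\<lambda>\<zeta>. A \<zeta> $$ (i, j)) holomorphic_on UNIV"
  by (simp add: mat_entire_def)

lemma mat_entireI:
  assumes "\<And>\<zeta>. dim_row (A \<zeta>) = N" "\<And>\<zeta>. dim_col (A \<zeta>) = N"
    and "\<And>i j. i < N \<Longrightarrow> j < N \<Longrightarrow> (\<lambda>\<zeta>. A \<zeta> $$ (i, j)) holomorphic_on UNIV"
  shows "mat_entire N A"
  unfolding mat_entire_def using assms(3) carrier_matI[OF assms(1,2)] by blast

lemma mat_entire_add:
  assumes "mat_entire N A" "mat_entire N B"
  shows "mat_entire N (\<lambda>\<zeta>. A \<zeta> + B \<zeta>)"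
  using assms[THEN mat_entire_index] assms[THEN mat_entire_dim(1)] assms[THEN mat_entire_dim(2)]
  by (intro mat_entireI) (simp_all add: holomorphic_intros)

lemma mat_entire_smult:
  assumes "c holomorphic_on UNIV" "mat_entire N A"
  shows "mat_entire N (\<lambda>\<zeta>. c \<zeta> \<cdot>\<^sub>m A \<zeta>)"
  using assms(1) assms(2)[THEN mat_entire_index] assms(2)[THEN mat_entire_dim(1)] assms(2)[THEN mat_entire_dim(2)]
  by (intro mat_entireI) (simp_all add: holomorphic_intros)

lemma mat_entire_mult:
  assumes "mat_entire N A" "mat_entire N B"
  shows "mat_entire N (\<lambda>\<zeta>. A \<zeta> * B \<zeta>)"
proof -
  note d = assms[THEN mat_entire_dim(1)] assms[THEN mat_entire_dim(2)]
  have "(A \<zeta> * B \<zeta>) $$ (i, j) = (\<Sum>l<N. A \<zeta> $$ (i, l) * B \<zeta> $$ (l, j))" if "i < N" "j < N" for i j \<zeta>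
    using that by (simp add: scalar_prod_def lessThan_atLeast0 d)
  moreover have "(\<lambda>\<zeta>. \<Sum>l<N. A \<zeta> $$ (i, l) * B \<zeta> $$ (l, j)) holomorphic_on UNIV" if "i < N" "j < N" for i j
    using assms that by (intro holomorphic_intros mat_entire_index) auto
  ultimately show ?thesis by (intro mat_entireI) (simp_all add: d)
qed

lemma mat_entire_kron:
  assumes "mat_entire N A" "mat_entire M B"
  shows "mat_entire (N * M) (\<lambda>\<zeta>. kron (A \<zeta>) (B \<zeta>))"
proof -
  have c: "A \<zeta> \<in> carrier_mat N N" "B \<zeta> \<in> carrier_mat M M" for \<zeta>
    using assms by (simp_all add: mat_entire_def)
  show ?thesis
    using assms unfolding mat_entire_def
    by (auto simp: kron_index[OF c] div_mod_less intro!: kron_carrier holomorphic_intros)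
qed

lemma mat_entire_c_even: "m \<in> {1..2 * k} \<Longrightarrow> mat_entire (2 ^ k) (\<lambda>\<zeta>. c_even k \<zeta> m)"
proof (induction k arbitrary: m)
  case (Suc k)
  have X: "mat_entire 2 (\<lambda>\<zeta>. XY_mat \<zeta> m)" for m
    unfolding mat_entire_def
    by (cases "odd m") (auto simp: less_2_cases_iff XY_mat_def small_mats_index intro!: holomorphic_intros)
  from Suc.prems show ?case
  proof (cases rule: c_even_cases)
    case 1
    then show ?thesis
      using mat_entire_kron[OF X mat_entire_const[of "1\<^sub>m (2 ^ k)" "2 ^ k"], of m]
      by (simp only: c_even_first) simp
  next
    case (2 m')
    then show ?thesis
      using mat_entire_kron[OF mat_entire_const[OF small_mats_carrier(1)] Suc.IH[of m']]
      by (simp add: c_even_shift)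
  qed
qed simp

section \<open>Entire functions into the algebras\<close>

lemma H_entire_iff: "H_entire n G \<longleftrightarrow> (\<forall>\<zeta>. G \<zeta> \<in> hc_H n) \<and>
    mat_entire (2 ^ (n div 2)) (\<lambda>\<zeta>. fst (G \<zeta>)) \<and> mat_entire (2 ^ (n div 2)) (\<lambda>\<zeta>. snd (G \<zeta>))"
  by (auto simp: H_entire_def mat_entire_def hc_H_iff)

lemma H_entire_scale: "c holomorphic_on UNIV \<Longrightarrow> H_entire n G \<Longrightarrow> H_entire n (\<lambda>\<zeta>. H_scale (c \<zeta>) (G \<zeta>))"
  by (simp add: H_entire_iff H_scale_closed) (simp add: H_scale_def mat_entire_smult)

text \<open>The multiplication varies with the point as well, but only through the entire factor
  \<zeta> = \<epsilon>^2.\<close>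

lemma H_entire_mult:
  assumes "H_entire n G" "H_entire n G'"
  shows "H_entire n (\<lambda>\<zeta>. H_mult \<zeta> (G \<zeta>) (G' \<zeta>))"
  using assms unfolding H_entire_iff
  by (simp add: H_mult_closed)
     (auto simp: H_mult_def intro!: mat_entire_add mat_entire_mult mat_entire_smult holomorphic_intros)

lemma H_entire_dpi_gen:
  assumes "j \<in> {1..n}"
  shows "H_entire n (\<lambda>\<zeta>. dpi_gen n \<zeta> j)"
  unfolding dpi_gen_def
proof (intro H_entire_scale)
  let ?N = "2 ^ (n div 2) :: nat"
  have "mat_entire ?N (\<lambda>\<zeta>. fst (c_rep n \<zeta> j)) \<and> mat_entire ?N (\<lambda>\<zeta>. snd (c_rep n \<zeta> j))"
  proof (cases "even n")
    case True
    then have "2 * (n div 2) = n" by simp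
    then show ?thesis
      using mat_entire_c_even[of j "n div 2"] assms True
      by (simp add: c_rep_def Let_def mat_entire_const)
  next
    case False
    \<comment> \<open>For odd n these elements are constant in \<zeta>; the value at 0 is an
      arbitrary reference.\<close>
    then have "c_rep n \<zeta> j = c_rep n 0 j" for \<zeta> by (simp add: c_rep_def)
    then show ?thesis
      using hc_H_carrier[OF c_rep_closed[OF assms, of 0]]
      by (metis (no_types, lifting) ext mat_entire_const)
  qed
  then show "H_entire n (\<lambda>\<zeta>. c_rep n \<zeta> j)"
    using c_rep_closed[OF assms] by (simp add: H_entire_iff)
qed simp

text \<open>The choices of \<open>dpi a \<zeta>\<close> for different \<zeta> are linked only
  through the generators; peeling off the smallest index writes the image of a monomial as a product
  of these.\<close>

lemma H_entire_dpi_monom: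
  fixes a :: "nat \<Rightarrow> 'v::euclidean_space"
  assumes a: "orthonormal_seq a" and "finite I" "I \<subseteq> {1..DIM('v)}"
  shows "H_entire DIM('v) (\<lambda>\<zeta>. dpi a \<zeta> (hc_monom a I))"
  using assms(2,3)
proof (induction I rule: finite_linorder_min_induct)
  case empty
  have "dpi a \<zeta> (hc_monom a {}) = H_one DIM('v)" for \<zeta>
    using dpi_spec_dpi[OF a, of \<zeta>] by (simp add: dpi_spec_def H_alg_hom_def hc_monom_empty[OF a])
  then show ?case
    using H_one_closed[of "DIM('v)"] hc_H_carrier[OF H_one_closed[of "DIM('v)"]]
    by (simp add: H_entire_iff mat_entire_const)
next
  case (insert b A)
  then have b: "b \<in> {1..DIM('v)}" by simp
  have "dpi a \<zeta> (hc_monom a (insert b A)) = H_mult \<zeta> (dpi_gen DIM('v) \<zeta> b) (dpi a \<zeta> (hc_monom a A))" for \<zeta>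
    using dpi_spec_dpi[OF a, of \<zeta>] insert b
    by (simp add: dpi_spec_def H_alg_hom_def hc_monom_insert_min[OF a] del: atLeastAtMost_iff)
  then show ?case
    using H_entire_mult[OF H_entire_dpi_gen[OF b]] insert by simp
qed

lemma H_entire_dpi_star:
  fixes a :: "nat \<Rightarrow> 'v::euclidean_space"
  assumes a: "orthonormal_seq a" and I: "I \<subseteq> {1..DIM('v)}"
  shows "H_entire DIM('v) (\<lambda>\<zeta>. dpi a \<zeta> (hc_star a I))"
proof -
  let ?w = "hc_monom a ({1..DIM('v)} - I)"
  have w: "H_entire DIM('v) (\<lambda>\<zeta>. dpi a \<zeta> ?w)" by (rule H_entire_dpi_monom[OF a]) auto
  have "dpi a \<zeta> (- 1 *\<^sub>R ?w) = H_scale (- 1) (dpi a \<zeta> ?w)" for \<zeta>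
    using dpi_spec_dpi[OF a, of \<zeta>] unfolding dpi_spec_def H_alg_hom_def by (metis of_real_1 of_real_minus)
  then have "H_entire DIM('v) (\<lambda>\<zeta>. dpi a \<zeta> (- ?w))"
    using H_entire_scale[OF _ w, of "\<lambda>\<zeta>. - 1"] by simp
  with w show ?thesis using hc_star_cases[OF a I] by auto
qed

section \<open>The Fourier transform\<close>

lemma H_entire_sum:
  assumes "\<And>s. s \<in> S \<Longrightarrow> H_entire n (G s)"
  shows "H_entire n (\<lambda>\<zeta>. H_sum n (\<lambda>s. G s \<zeta>) S)"
proof -
  \<comment> \<open>For even n the sum must stay in the subspace without \<epsilon>, so its second
    component is checked to be a sum of zeros.\<close>
  have "even n \<Longrightarrow> s \<in> S \<Longrightarrow> snd (G s \<zeta>) = 0\<^sub>m (2 ^ (n div 2)) (2 ^ (n div 2))" for s \<zeta>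
    using assms[of s] by (simp add: H_entire_def hc_H_iff)
  then have "H_sum n (\<lambda>s. G s \<zeta>) S \<in> hc_H n" for \<zeta>
    by (auto simp: H_sum_def hc_H_iff Let_def intro!: eq_matI sum.neutral)
  then show ?thesis
    using assms unfolding H_entire_def
    by (auto simp: H_sum_def Let_def intro!: holomorphic_intros)
qed

lemma H_entire_pairing:
  fixes a :: "nat \<Rightarrow> 'v::euclidean_space"
  assumes a: "orthonormal_seq a" and U: "U \<in> E_HC a"
  shows "H_entire DIM('v) (pairing_pi a U)"
  unfolding pairing_pi_def[abs_def]
proof (intro H_entire_sum H_entire_scale)
  fix I
  assume "I \<in> Pow {1..DIM('v)}"
  then have I: "I \<subseteq> {1..DIM('v)}" by simp
  show "H_entire DIM('v) (\<lambda>\<zeta>. dpi a \<zeta> (hc_star a I))" by (rule H_entire_dpi_star[OF a I])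
  \<comment> \<open>The scalar coefficient is the entire function of w from the one-variable case,
    taken at w = \<i> \<zeta>.\<close>
  have "(\<lambda>w. hc_components a U I (\<lambda>x. exp (w * of_real x))) \<circ> (\<lambda>\<zeta>. \<i> * \<zeta>) holomorphic_on UNIV"
    using E_real_exp_holomorphic[OF hc_components_E_real[OF a U I]]
    by (intro holomorphic_on_compose_gen[where t = UNIV] holomorphic_intros) auto
  then show "(\<lambda>\<zeta>. hc_components a U I (\<lambda>x. exp (\<i> * \<zeta> * of_real x))) holomorphic_on UNIV"
    by (simp add: comp_def)
qed

text \<open>The pairing formula makes sense at complex arguments and is itself the extension, so
  both equations hold by reflexivity. Holomorphy is that of \<open>pairing_pi\<close> composed with
  the reflection of \<zeta>.\<close>

theorem theorem4p11:
  fixes a :: "nat \<Rightarrow> 'v::euclidean_space"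
    and U :: "('v hc_uea \<Rightarrow> real \<Rightarrow> complex) \<Rightarrow> complex"
  assumes "orthonormal_seq a"
    and "U \<in> E_HC a"
  shows "\<exists>Uhat :: complex \<Rightarrow> hc_mats.
           (\<forall>\<zeta>::real. Uhat (complex_of_real \<zeta>) = pairing_pi a U (- complex_of_real \<zeta>)) \<and>
           (\<forall>\<zeta>::complex. Uhat \<zeta> = pairing_pi a U (- \<zeta>)) \<and>
           H_entire (DIM('v)) Uhat"
proof (intro exI[of _ "\<lambda>\<zeta>. pairing_pi a U (- \<zeta>)"] conjI allI refl)
  have reflect: "(\<lambda>\<zeta>. f (- \<zeta>)) holomorphic_on UNIV" if "f holomorphic_on UNIV" for f :: "complex \<Rightarrow> complex"
    using holomorphic_on_compose_gen[of uminus UNIV f UNIV] that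
    by (simp add: comp_def holomorphic_on_minus holomorphic_on_ident)
  show "H_entire DIM('v) (\<lambda>\<zeta>. pairing_pi a U (- \<zeta>))"
    using H_entire_pairing[OF assms] unfolding H_entire_def by (auto intro: reflect)
qed

end
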